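(* Let $\rho\in(0,1)$. For $\gamma_1<-1/2$ close to $-1/2$, set $\gamma_2=(\gamma_1+1/2)/\rho-1/2$ (so that $\gamma_1\ge\gamma_2$, $\gamma_i\in(-1,-1/2)$ and $\gamma_1+\gamma_2>-3/2$), and let $$Z_{\gamma_1,\gamma_2}=A(\gamma_1,\gamma_2)\int_{\mathbb{R}^2}\left(\int_0^1(s-x_1)_+^{\gamma_1}(s-x_2)_+^{\gamma_2}\,ds\right)dB_{x_1}dB_{x_2}.$$ Let $Y_\rho=\frac{a_\rho}{\sqrt2}(Z_1^2-1)+\frac{b_\rho}{\sqrt2}(Z_2^2-1)$ with $Z_1,Z_2$ independent standard normal random variables and $$a_\rho=\frac{(\rho+1)^{-1}+(2\sqrt\rho)^{-1}}{\sqrt{2(\rho+1)^{-2}+(2\rho)^{-1}}},\qquad b_\rho=\frac{(\rho+1)^{-1}-(2\sqrt\rho)^{-1}}{\sqrt{2(\rho+1)^{-2}+(2\rho)^{-1}}}.$$ Then for any integer $m\ge3$, as $\gamma_1\to-1/2$, $$\kappa_m(Z_{\gamma_1,\gamma_2})=\kappa_m(Y_\rho)+O\Big(-\gamma_1-\frac12\Big).$$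
   Context: $\kappa_m(X)$ denotes the $m$th cumulant of $X$. $B$ is a standard two-sided Brownian motion and the double integral is a double Wiener–Itô integral on $\mathbb{R}^2$ (diagonal excluded). $u_+^{\gamma}=u^\gamma$ if $u>0$ and $0$ otherwise. With $B(\alpha,\beta)=\int_0^1u^{\alpha-1}(1-u)^{\beta-1}du$, the normalizing constant (which makes $\mathbb{E}[Z_{\gamma_1,\gamma_2}^2]=1$) is $$A(\gamma_1,\gamma_2)=\big[(\gamma_1+\gamma_2+2)(2(\gamma_1+\gamma_2)+3)\big]^{1/2}\big[B(\gamma_1+1,-\gamma_1-\gamma_2-1)B(\gamma_2+1,-\gamma_1-\gamma_2-1)+B(\gamma_1+1,-2\gamma_1-1)B(\gamma_2+1,-2\gamma_2-1)\big]^{-1/2}.$$ The implied constant may depend on $m$ and $\rho$. *)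

theory Defs
  imports "HOL-Probability.Probability" "HOL-Library.Landau_Symbols"
begin

section \<open>Cumulants\<close>

(* kappa_m(X) = (-i)^m (d/dt)^m log E[exp(i t X)] at t = 0.  The principal branch Ln is the right
   one, since the characteristic function is continuous with value 1 at 0.  The right-hand side
   is real whenever E|X|^m is finite; vector_derivative takes an unspecified value where the
   derivative does not exist. *)
definition cumulant :: "'a measure \<Rightarrow> ('a \<Rightarrow> real) \<Rightarrow> nat \<Rightarrow> real" where
  "cumulant M X m =
     Re ((- \<i>) ^ m * ((\<lambda>f t. vector_derivative f (at t)) ^^ m)
                       (\<lambda>t. Ln (char (distr M borel X) t)) 0)"


section \<open>Two-sided Brownian motion\<close>

locale two_sided_brownian_motion = prob_space M for M :: "'a measure" +
  fixes B :: "real \<Rightarrow> 'a \<Rightarrow> real"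
  assumes measurable_B: "B t \<in> borel_measurable M"
    and B_zero: "AE \<omega> in M. B 0 \<omega> = 0"
    and increments_normal:
      "s < t \<Longrightarrow>
        distributed M lborel (\<lambda>\<omega>. B t \<omega> - B s \<omega>) (normal_density 0 (sqrt (t - s)))"
    and increments_indep:
      "(\<And>i. i < n \<Longrightarrow> \<tau> i < \<tau> (Suc i)) \<Longrightarrow>
        indep_vars (\<lambda>_. borel) (\<lambda>i \<omega>. B (\<tau> (Suc i)) \<omega> - B (\<tau> i) \<omega>) {..<n}"
    and continuous_paths: "AE \<omega> in M. continuous_on UNIV (\<lambda>t. B t \<omega>)"


section \<open>Double Wiener--Ito integral\<close>

(* Off-diagonal step functions on the plane: n + 1 grid points \<tau> 0 < ... < \<tau> n, and a coefficient
   c i j for the box (\<tau> i, \<tau> (i+1)] x (\<tau> j, \<tau> (j+1)], which is zero on the diagonal boxes.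
   The coefficients need not be symmetric. *)
definition offdiag_step :: "nat \<Rightarrow> (nat \<Rightarrow> real) \<Rightarrow> (nat \<Rightarrow> nat \<Rightarrow> real) \<Rightarrow> bool" where
  "offdiag_step n \<tau> c \<longleftrightarrow> (\<forall>i<n. \<tau> i < \<tau> (Suc i)) \<and> (\<forall>i<n. c i i = 0)"

definition step_fun :: "nat \<Rightarrow> (nat \<Rightarrow> real) \<Rightarrow> (nat \<Rightarrow> nat \<Rightarrow> real) \<Rightarrow> real \<times> real \<Rightarrow> real" where
  "step_fun n \<tau> c z =
     (\<Sum>i<n. \<Sum>j<n. c i j * indicator {\<tau> i<..\<tau> (Suc i)} (fst z)
                          * indicator {\<tau> j<..\<tau> (Suc j)} (snd z))"

definition step_integral ::
    "(real \<Rightarrow> 'a \<Rightarrow> real) \<Rightarrow> nat \<Rightarrow> (nat \<Rightarrow> real) \<Rightarrow> (nat \<Rightarrow> nat \<Rightarrow> real) \<Rightarrow> 'a \<Rightarrow> real" where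
  "step_integral B n \<tau> c \<omega> =
     (\<Sum>i<n. \<Sum>j<n. c i j * (B (\<tau> (Suc i)) \<omega> - B (\<tau> i) \<omega>) * (B (\<tau> (Suc j)) \<omega> - B (\<tau> j) \<omega>))"

(* X is a version of the double Wiener--Ito integral of f: the L2 limit of the integrals of
   off-diagonal step functions that converge to f in L2 of the plane. *)
definition has_double_wiener_integral ::
    "'a measure \<Rightarrow> (real \<Rightarrow> 'a \<Rightarrow> real) \<Rightarrow> (real \<times> real \<Rightarrow> real) \<Rightarrow> ('a \<Rightarrow> real) \<Rightarrow> bool" where
  "has_double_wiener_integral M B f X \<longleftrightarrow>
     f \<in> borel_measurable borel \<and> X \<in> borel_measurable M \<and>
     (\<exists>n \<tau> c. (\<forall>k. offdiag_step (n k) (\<tau> k) (c k)) \<and>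
        (\<lambda>k. \<integral>\<^sup>+ z. ennreal ((f z - step_fun (n k) (\<tau> k) (c k) z)\<^sup>2) \<partial>lborel)
          \<longlonglongrightarrow> 0 \<and>
        (\<lambda>k. \<integral>\<^sup>+ \<omega>. ennreal ((X \<omega> - step_integral B (n k) (\<tau> k) (c k) \<omega>)\<^sup>2) \<partial>M)
          \<longlonglongrightarrow> 0)"

(* For f in L2 of the plane the integral exists and is unique up to almost sure equality; the
   choice operator picks a version. *)
definition double_wiener_integral ::
    "'a measure \<Rightarrow> (real \<Rightarrow> 'a \<Rightarrow> real) \<Rightarrow> (real \<times> real \<Rightarrow> real) \<Rightarrow> 'a \<Rightarrow> real" where
  "double_wiener_integral M B f = (SOME X. has_double_wiener_integral M B f X)"


section \<open>The generalized Rosenblatt variable\<close>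

definition pos_powr :: "real \<Rightarrow> real \<Rightarrow> real" where
  "pos_powr u \<gamma> = (if u > 0 then u powr \<gamma> else 0)"

(* If fst z = snd z, the inner integral may diverge and the Lebesgue integral then returns 0;
   this concerns only the diagonal, a null set that the double integral does not see. *)
definition rosenblatt_kernel :: "real \<Rightarrow> real \<Rightarrow> real \<times> real \<Rightarrow> real" where
  "rosenblatt_kernel \<gamma>1 \<gamma>2 z =
     (LINT s:{0..1}|lborel. pos_powr (s - fst z) \<gamma>1 * pos_powr (s - snd z) \<gamma>2)"

(* Library Beta is given by Gamma functions; has_integral_Beta_real identifies it with the Euler
   integral for positive arguments, which is the case here for parameters in (-1,-1/2). *)
definition rosenblatt_const :: "real \<Rightarrow> real \<Rightarrow> real" where
  "rosenblatt_const \<gamma>1 \<gamma>2 =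
     ((\<gamma>1 + \<gamma>2 + 2) * (2 * (\<gamma>1 + \<gamma>2) + 3)) powr (1/2) *
     (Beta (\<gamma>1 + 1) (- \<gamma>1 - \<gamma>2 - 1) * Beta (\<gamma>2 + 1) (- \<gamma>1 - \<gamma>2 - 1)
      + Beta (\<gamma>1 + 1) (- 2 * \<gamma>1 - 1) * Beta (\<gamma>2 + 1) (- 2 * \<gamma>2 - 1)) powr (- 1/2)"

definition rosenblatt ::
    "'a measure \<Rightarrow> (real \<Rightarrow> 'a \<Rightarrow> real) \<Rightarrow> real \<Rightarrow> real \<Rightarrow> 'a \<Rightarrow> real" where
  "rosenblatt M B \<gamma>1 \<gamma>2 \<omega> =
     rosenblatt_const \<gamma>1 \<gamma>2 * double_wiener_integral M B (rosenblatt_kernel \<gamma>1 \<gamma>2) \<omega>"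


section \<open>The limit\<close>

definition a_coeff :: "real \<Rightarrow> real" where
  "a_coeff \<rho> = (1 / (\<rho> + 1) + 1 / (2 * sqrt \<rho>)) / sqrt (2 / (\<rho> + 1)\<^sup>2 + 1 / (2 * \<rho>))"

definition b_coeff :: "real \<Rightarrow> real" where
  "b_coeff \<rho> = (1 / (\<rho> + 1) - 1 / (2 * sqrt \<rho>)) / sqrt (2 / (\<rho> + 1)\<^sup>2 + 1 / (2 * \<rho>))"

definition Y_limit :: "real \<Rightarrow> ('b \<Rightarrow> real) \<Rightarrow> ('b \<Rightarrow> real) \<Rightarrow> 'b \<Rightarrow> real" where
  "Y_limit \<rho> Z1 Z2 \<omega> =
     a_coeff \<rho> / sqrt 2 * ((Z1 \<omega>)\<^sup>2 - 1) + b_coeff \<rho> / sqrt 2 * ((Z2 \<omega>)\<^sup>2 - 1)"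

end

theory Submission
  imports Defs
begin

text \<open>
  Everything is expressed by traces. A double Wiener--Ito integral with symmetrized kernel K
  is a limit of centred Gaussian quadratic forms, and its m-th cumulant is
  2^(m-1) (m-1)! tr(K^m) for m \<ge> 2, where K also denotes the integral operator.
  The variable Y of the statement is such a form of rank two, with eigenvalues a/\<surd>2 and b/\<surd>2.
  So it suffices to show that tr(K^m), after normalization, tends to the sum of the
  m-th powers of these two numbers, with an error of the order of \<delta> = -\<gamma>1 - 1/2.

  The kernel is an integral over s in [0,1] of the symmetrized product of
  h1_s(x) = (s-x)_+^\<gamma>1 and h2_s(x) = (s-x)_+^\<gamma>2. Expanding the trace by Tonelli leaves only
  the inner products of h_i at s with h_j at t (called overlap below), and these are
  |s-t|^(-c) / c up to a relative error O(c), where c = -\<gamma>i - \<gamma>j - 1 is a fixed multiple of \<delta>. As \<delta> tends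
  to 0 the singularity |s-t|^(-c) flattens to 1 and the overlaps blow up like 1/c, independently of s and
  t: after multiplication by the normalizing constant, which is of order \<delta>, the operator looks like
  a two by two matrix with the eigenvalues above. The bounds
  kernel_trace_lower and kernel_trace_upper make this quantitative: they enclose the
  trace between the traces of powers of two constant matrices, the upper one with an additional factor
  1 + O(\<delta>) from the singularity.

  For the cumulants of the double integral no spectral theorem is used. Gaussian integration by parts
  gives a recursion for the moments of a quadratic form in terms of the traces (moments_quad_form);
  it says that the moment series A and H = \<Sum> 2^(l-1) t_l z^l / l satisfy A' = A H', hence A = exp H,
  and the characteristic function is exp(H(is)) near 0 (char_eq_eval_moment_fps). This form passes to limits
  in mean square as soon as the traces converge. To control the traces the kernel, which is nonnegative
  and lower semicontinuous off the diagonal, is approximated from below by off-diagonal step functions: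
  then Fatou's lemma and domination give convergence of all traces (kernel_trace_tendsto), and dominated
  convergence gives convergence in L2 (chaos_law_lsc_kernel). That the double integral is
  defined by an arbitrary choice does no harm, because it is the limit along every approximating
  sequence (has_double_wiener_integral_tendsto).
\<close>

section \<open>Moments of Gaussian quadratic forms\<close>

text \<open>
  The Taylor coefficients of exp(\<Sum>l\<ge>2. 2^(l-1) t_l z^l / l), written as the recursion that the
  logarithmic derivative gives. The number t_l stands for the trace of the l-th power of an operator;
  the sum starts with the second power because the variables are centred.
\<close>

fun quad_coeff :: "(nat \<Rightarrow> real) \<Rightarrow> nat \<Rightarrow> real" where
  "quad_coeff t 0 = 1"
| "quad_coeff t (Suc n) = (\<Sum>l\<in>{1..n}. 2 ^ l * t (Suc l) * quad_coeff t (n - l)) / real (Suc n)"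

declare quad_coeff.simps(2) [simp del]

text \<open>
  The entry (a, b) of (c V)^n c, where V is the diagonal matrix with entries v.
\<close>

fun chain :: "'i set \<Rightarrow> ('i \<Rightarrow> real) \<Rightarrow> ('i \<Rightarrow> 'i \<Rightarrow> real) \<Rightarrow> nat \<Rightarrow> 'i \<Rightarrow> 'i \<Rightarrow> real" where
  "chain I v c 0 a b = c a b"
| "chain I v c (Suc n) a b = (\<Sum>d\<in>I. c a d * v d * chain I v c n d b)"

text \<open>
  For symmetric c and n \<ge> 2 this is the trace of the n-th power of V c.
\<close>

definition trace_power :: "'i set \<Rightarrow> ('i \<Rightarrow> real) \<Rightarrow> ('i \<Rightarrow> 'i \<Rightarrow> real) \<Rightarrow> nat \<Rightarrow> real" where
  "trace_power I v c n = (\<Sum>a\<in>I. \<Sum>b\<in>I. v a * v b * c a b * chain I v c (n - 2) a b)"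

locale gaussian_family = prob_space M for M :: "'a measure" +
  fixes I :: "'i set" and G :: "'i \<Rightarrow> 'a \<Rightarrow> real" and v :: "'i \<Rightarrow> real"
  assumes finite_I: "finite I"
    and indep_G: "indep_vars (\<lambda>_. borel) G I"
    and v_pos: "i \<in> I \<Longrightarrow> 0 < v i"
    and normal_G: "i \<in> I \<Longrightarrow> distributed M lborel (G i) (normal_density 0 (sqrt (v i)))"
begin

lemma measurable_G [measurable]: "i \<in> I \<Longrightarrow> G i \<in> borel_measurable M"
  using normal_G[of i] by (auto simp: distributed_def)

lemma integrable_G_power: "i \<in> I \<Longrightarrow> integrable M (\<lambda>\<omega>. G i \<omega> ^ k)"
  using integrable_normal_moment[of "sqrt (v i)" 0 k] v_pos[of i]
    distributed_integrable[OF normal_G, of i "\<lambda>x. x ^ k"] by auto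

text \<open>
  Integration by parts for powers of one normal variable; it is the base case of the
  calculus below.
\<close>

lemma expectation_G_power_Suc:
  assumes i: "i \<in> I"
  shows "expectation (\<lambda>\<omega>. G i \<omega> ^ Suc k) = v i * real k * expectation (\<lambda>\<omega>. G i \<omega> ^ (k - 1))"
proof -
  have E: "expectation (\<lambda>\<omega>. G i \<omega> ^ n) = (\<integral>x. normal_density 0 (sqrt (v i)) x * (x - 0) ^ n \<partial>lborel)" for n
    using distributed_integral[OF normal_G[OF i], of "\<lambda>x. x ^ n"] by simp
  have s: "0 < sqrt (v i)" and vp: "v i > 0" using v_pos[OF i] by auto
  show ?thesis
  proof (cases "even k")
    case True
    then obtain r where k: "k = 2 * r" by auto
    have "expectation (\<lambda>\<omega>. G i \<omega> ^ Suc k) = 0"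
      unfolding E k using integral_normal_moment_odd[OF s, of 0 r] by (simp only: Suc_eq_plus1)
    moreover have "real k * expectation (\<lambda>\<omega>. G i \<omega> ^ (k - 1)) = 0"
    proof (cases r)
      case (Suc q)
      have "k - 1 = 2 * q + 1" using Suc k by simp
      then show ?thesis using integral_normal_moment_odd[OF s, of 0 q] by (simp only: E mult_zero_right)
    qed (simp add: k)
    ultimately show ?thesis by simp
  next
    case False
    then obtain r where k: "k = 2 * r + 1" using oddE by blast
    have "expectation (\<lambda>\<omega>. G i \<omega> ^ Suc k) = fact (2 * Suc r) / ((2 / v i) ^ Suc r * fact (Suc r))"
      using integral_normal_moment_even[OF s, of 0 "Suc r"] vp unfolding E k by simp
    also have "fact (2 * Suc r) = 2 * real (Suc r) * real k * fact (2 * r)"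
      by (simp add: k algebra_simps)
    also have "(2 / v i) ^ Suc r * fact (Suc r) = 2 / v i * real (Suc r) * ((2 / v i) ^ r * fact r)"
      by (simp only: power_Suc fact_Suc of_nat_mult mult_ac)
    also have "2 * real (Suc r) * real k * fact (2 * r) / (2 / v i * real (Suc r) * ((2 / v i) ^ r * fact r))
        = v i * real k * (fact (2 * r) / ((2 / v i) ^ r * fact r))"
      using vp by (simp add: divide_simps del: of_nat_Suc)
    also have "fact (2 * r) / ((2 / v i) ^ r * fact r) = expectation (\<lambda>\<omega>. G i \<omega> ^ (k - 1))"
      using integral_normal_moment_even[OF s, of 0 r] vp unfolding E k by simp
    finally show ?thesis .
  qed
qed

definition monomial :: "('i \<Rightarrow> nat) \<Rightarrow> 'a \<Rightarrow> real" where
  "monomial e \<omega> = (\<Prod>i\<in>I. G i \<omega> ^ e i)"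

lemma indep_G_powers: "indep_vars (\<lambda>_. borel) (\<lambda>i \<omega>. G i \<omega> ^ e i) I"
  using indep_vars_compose2[OF indep_G, of "\<lambda>i x. x ^ e i" "\<lambda>_. borel"] by simp

lemma integrable_monomial: "integrable M (monomial e)"
  unfolding monomial_def [abs_def]
  by (rule indep_vars_integrable[OF finite_I indep_G_powers]) (rule integrable_G_power)

lemma expectation_monomial: "expectation (monomial e) = (\<Prod>i\<in>I. expectation (\<lambda>\<omega>. G i \<omega> ^ e i))"
  unfolding monomial_def [abs_def]
  by (rule indep_vars_lebesgue_integral[OF finite_I indep_G_powers]) (rule integrable_G_power)

lemma monomial_Suc: "i \<in> I \<Longrightarrow> monomial (e(i := Suc (e i))) \<omega> = G i \<omega> * monomial e \<omega>"
  unfolding monomial_def using finite_I by (simp add: prod.remove[of I i])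

text \<open>
  Gaussian integration by parts, E[G_j f] = v_j E[f'] with f' the partial derivative of f with respect to
  G_j, is required against every monomial: in this form it is inherited by products of f with a coordinate,
  which the formula for the empty monomial alone is not. The last summand is the derivative
  of the monomial; if e j = 0, its factor makes the truncated exponent harmless.
\<close>

definition stein_pair :: "'i \<Rightarrow> ('a \<Rightarrow> real) \<Rightarrow> ('a \<Rightarrow> real) \<Rightarrow> bool" where
  "stein_pair j f f' \<longleftrightarrow> (\<forall>e. integrable M (\<lambda>\<omega>. monomial e \<omega> * f \<omega>)
      \<and> integrable M (\<lambda>\<omega>. monomial e \<omega> * f' \<omega>)
      \<and> expectation (\<lambda>\<omega>. monomial (e(j := Suc (e j))) \<omega> * f \<omega>)
        = v j * (expectation (\<lambda>\<omega>. monomial e \<omega> * f' \<omega>)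
             + real (e j) * expectation (\<lambda>\<omega>. monomial (e(j := e j - 1)) \<omega> * f \<omega>)))"

lemma stein_pair_one: assumes j: "j \<in> I" shows "stein_pair j (\<lambda>_. 1) (\<lambda>_. 0)"
proof -
  have "expectation (monomial (e(j := Suc (e j))))
     = v j * real (e j) * expectation (monomial (e(j := e j - 1)))" for e
    unfolding expectation_monomial using finite_I j
    by (simp add: prod.remove[of I j] expectation_G_power_Suc del: power_Suc)
  then show ?thesis unfolding stein_pair_def using integrable_monomial by simp
qed

lemma stein_pair_add:
  assumes "stein_pair j f f'" "stein_pair j g g'"
  shows "stein_pair j (\<lambda>\<omega>. f \<omega> + g \<omega>) (\<lambda>\<omega>. f' \<omega> + g' \<omega>)"
  using assms unfolding stein_pair_def by (simp add: distrib_left)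

lemma stein_pair_scale:
  assumes "stein_pair j f f'"
  shows "stein_pair j (\<lambda>\<omega>. c * f \<omega>) (\<lambda>\<omega>. c * f' \<omega>)"
proof -
  have [simp]: "x * (c * y) = c * (x * y)" for x y :: real by simp
  show ?thesis
  using assms unfolding stein_pair_def by (simp add: distrib_left del: mult.left_commute)
qed

lemma stein_pair_zero: "stein_pair j (\<lambda>_. 0) (\<lambda>_. 0)"
  by (simp add: stein_pair_def)

lemma stein_pair_sum:
  assumes "\<And>a. a \<in> A \<Longrightarrow> stein_pair j (f a) (f' a)"
  shows "stein_pair j (\<lambda>\<omega>. \<Sum>a\<in>A. f a \<omega>) (\<lambda>\<omega>. \<Sum>a\<in>A. f' a \<omega>)"
  using assms
  by (induction A rule: infinite_finite_induct) (auto intro: stein_pair_zero stein_pair_add)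

text \<open>
  Multiplying f by G i amounts to raising the exponent of i in the monomial, so the claim is the hypothesis
  at another monomial.
\<close>

lemma stein_pair_times_G:
  assumes f: "stein_pair j f f'" and i: "i \<in> I" and j: "j \<in> I"
  shows "stein_pair j (\<lambda>\<omega>. G i \<omega> * f \<omega>) (\<lambda>\<omega>. G i \<omega> * f' \<omega> + (if i = j then f \<omega> else 0))"
proof -
  have shift: "monomial e \<omega> * (G i \<omega> * h) = monomial (e(i := Suc (e i))) \<omega> * h" for e \<omega> h
    using monomial_Suc[OF i] by simp
  have int: "integrable M (\<lambda>\<omega>. monomial e \<omega> * f \<omega>)" "integrable M (\<lambda>\<omega>. monomial e \<omega> * f' \<omega>)" for e
    using f by (auto simp: stein_pair_def)
  have st: "expectation (\<lambda>\<omega>. monomial (e(j := Suc (e j))) \<omega> * f \<omega>)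
        = v j * (expectation (\<lambda>\<omega>. monomial e \<omega> * f' \<omega>)
             + real (e j) * expectation (\<lambda>\<omega>. monomial (e(j := e j - 1)) \<omega> * f \<omega>))" for e
    using f by (auto simp: stein_pair_def)
  show ?thesis
  proof (cases "i = j")
    case False
    then have sw: "e(j := n, i := k) = e(i := k, j := n)" for e n k
      by (simp add: fun_upd_twist)
    show ?thesis using False st[of "e(i := Suc (e i))" for e] int
      by (simp add: stein_pair_def shift sw)
  next
    case True
    have up: "monomial e \<omega> * (G j \<omega> * h) = monomial (e(j := Suc (e j))) \<omega> * h" for e \<omega> h
      using shift True by simp
    have sum: "monomial e \<omega> * (G j \<omega> * f' \<omega> + f \<omega>)
      = monomial (e(j := Suc (e j))) \<omega> * f' \<omega> + monomial e \<omega> * f \<omega>" for e \<omega>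
      unfolding distrib_left up by simp
    have low: "real (e j) * expectation (\<lambda>\<omega>. monomial (e(j := Suc (e j - Suc 0))) \<omega> * f \<omega>)
      = real (e j) * expectation (\<lambda>\<omega>. monomial e \<omega> * f \<omega>)" for e
      by (cases "e j = 0") simp_all
    show ?thesis using True st[of "e(j := Suc (e j))" for e] int
      by (simp add: stein_pair_def up sum low distrib_left distrib_right)
  qed
qed

lemma stein_pair_cong: "stein_pair j f g' \<Longrightarrow> (\<And>\<omega>. g' \<omega> = f' \<omega>) \<Longrightarrow> stein_pair j f f'"
  by (simp add: stein_pair_def)

definition quad_form :: "('i \<Rightarrow> 'i \<Rightarrow> real) \<Rightarrow> 'a \<Rightarrow> real" where
  "quad_form c \<omega> = (\<Sum>a\<in>I. \<Sum>b\<in>I. c a b * (G a \<omega> * G b \<omega>)) - (\<Sum>a\<in>I. c a a * v a)"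

lemma stein_pair_times_quad_form:
  assumes f: "stein_pair j f f'" and j: "j \<in> I" and sym: "\<And>a b. c a b = c b a"
  shows "stein_pair j (\<lambda>\<omega>. quad_form c \<omega> * f \<omega>)
    (\<lambda>\<omega>. quad_form c \<omega> * f' \<omega> + 2 * (\<Sum>b\<in>I. c j b * (G b \<omega> * f \<omega>)))"
proof -
  let ?d = "\<lambda>a b \<omega>. G a \<omega> * (G b \<omega> * f' \<omega> + (if b = j then f \<omega> else 0))
            + (if a = j then G b \<omega> * f \<omega> else 0)"
  have "stein_pair j (\<lambda>\<omega>. (\<Sum>a\<in>I. \<Sum>b\<in>I. c a b * (G a \<omega> * (G b \<omega> * f \<omega>)))
             + (- (\<Sum>a\<in>I. c a a * v a)) * f \<omega>)
     (\<lambda>\<omega>. (\<Sum>a\<in>I. \<Sum>b\<in>I. c a b * ?d a b \<omega>)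
             + (- (\<Sum>a\<in>I. c a a * v a)) * f' \<omega>)" (is "stein_pair j ?L ?R")
    by (intro stein_pair_add stein_pair_sum stein_pair_scale stein_pair_times_G f j)
  moreover have "?L = (\<lambda>\<omega>. quad_form c \<omega> * f \<omega>)"
    by (simp add: quad_form_def fun_eq_iff algebra_simps sum_distrib_left)
  moreover have "?R \<omega> = quad_form c \<omega> * f' \<omega> + 2 * (\<Sum>b\<in>I. c j b * (G b \<omega> * f \<omega>))" for \<omega>
  proof -
    have "(\<Sum>a\<in>I. \<Sum>b\<in>I. c a b * ?d a b \<omega>)
       = (\<Sum>a\<in>I. \<Sum>b\<in>I. c a b * (G a \<omega> * G b \<omega>) * f' \<omega>)
         + (\<Sum>a\<in>I. \<Sum>b\<in>I. if b = j then c a b * (G a \<omega> * f \<omega>) else 0)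
         + (\<Sum>a\<in>I. \<Sum>b\<in>I. if a = j then c a b * (G b \<omega> * f \<omega>) else 0)"
      unfolding sum.distrib [symmetric] by (intro sum.cong refl) (simp add: algebra_simps)
    also have "(\<Sum>a\<in>I. \<Sum>b\<in>I. if b = j then c a b * (G a \<omega> * f \<omega>) else 0)
        = (\<Sum>a\<in>I. c j a * (G a \<omega> * f \<omega>))"
      using finite_I j sym[of _ j] by simp
    also have "(\<Sum>a\<in>I. \<Sum>b\<in>I. if a = j then c a b * (G b \<omega> * f \<omega>) else 0)
        = (\<Sum>b\<in>I. c j b * (G b \<omega> * f \<omega>))"
      using finite_I j by (subst sum.swap) simp
    finally show ?thesis
      by (simp add: quad_form_def sum_distrib_right left_diff_distrib)
  qed
  ultimately show ?thesis by (simp add: stein_pair_cong)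
qed

lemma stein_pair_quad_form_power:
  assumes j: "j \<in> I" and sym: "\<And>a b. c a b = c b a"
  shows "stein_pair j (\<lambda>\<omega>. quad_form c \<omega> ^ n)
    (\<lambda>\<omega>. 2 * real n * (\<Sum>b\<in>I. c j b * (G b \<omega> * quad_form c \<omega> ^ (n - 1))))"
proof (induction n)
  case 0
  show ?case using stein_pair_one[OF j] by simp
next
  case (Suc n)
  from stein_pair_times_quad_form[OF Suc j sym]
  have "stein_pair j (\<lambda>\<omega>. quad_form c \<omega> * quad_form c \<omega> ^ n)
     (\<lambda>\<omega>. quad_form c \<omega> * (2 * real n * (\<Sum>b\<in>I. c j b * (G b \<omega> * quad_form c \<omega> ^ (n - 1))))
         + 2 * (\<Sum>b\<in>I. c j b * (G b \<omega> * quad_form c \<omega> ^ n)))" .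
  then show ?case
    by (cases n) (auto elim!: stein_pair_cong simp: sum_distrib_left sum.distrib algebra_simps
         intro!: sum.cong)
qed

lemma stein_pair_integrable:
  assumes "stein_pair j f f'" shows "integrable M f"
  using assms[unfolded stein_pair_def, rule_format, of "\<lambda>_. 0"] by (simp add: monomial_def)

lemma expectation_stein:
  assumes "stein_pair j f f'" "j \<in> I"
  shows "expectation (\<lambda>\<omega>. G j \<omega> * f \<omega>) = v j * expectation f'"
  using assms(1)[unfolded stein_pair_def, rule_format, of "\<lambda>_. 0"]
    monomial_Suc[OF assms(2), of "\<lambda>_. 0"] by (simp add: monomial_def)

lemma integrable_quad_form_power:
  assumes sym: "\<And>a b. c a b = c b a"
  shows "integrable M (\<lambda>\<omega>. quad_form c \<omega> ^ n)"
proof (cases "I = {}")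
  case False
  then obtain j where "j \<in> I" by auto
  from stein_pair_quad_form_power[OF this sym] show ?thesis by (rule stein_pair_integrable)
next
  case True
  then show ?thesis unfolding quad_form_def by simp
qed

abbreviation quad_moment :: "('i \<Rightarrow> 'i \<Rightarrow> real) \<Rightarrow> nat \<Rightarrow> real" where
  "quad_moment c n \<equiv> expectation (\<lambda>\<omega>. quad_form c \<omega> ^ n)"

abbreviation mixed_moment :: "('i \<Rightarrow> 'i \<Rightarrow> real) \<Rightarrow> 'i \<Rightarrow> 'i \<Rightarrow> nat \<Rightarrow> real" where
  "mixed_moment c a b n \<equiv> expectation (\<lambda>\<omega>. G a \<omega> * (G b \<omega> * quad_form c \<omega> ^ n))"

text \<open>
  Integration by parts with respect to G a for the function G b Q^n, whose derivative consists of
  the derivative of G b and of 2 n G b Q^(n-1) times the a-th entry of c G.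
\<close>

lemma mixed_moment_rec:
  assumes a: "a \<in> I" and b: "b \<in> I" and sym: "\<And>a b. c a b = c b a"
  shows "(mixed_moment c a b n) =
     v a * ((if a = b then (quad_moment c n) else 0)
       + 2 * real n * (\<Sum>d\<in>I. c a d * (mixed_moment c d b (n - 1))))"
    and mixed_moment_integrable: "integrable M (\<lambda>\<omega>. G a \<omega> * (G b \<omega> * quad_form c \<omega> ^ n))"
proof -
  have int: "integrable M (\<lambda>\<omega>. G a \<omega> * (G b \<omega> * quad_form c \<omega> ^ n))"
    if "a \<in> I" "b \<in> I" for a b n
    by (rule stein_pair_integrable, rule stein_pair_times_G, rule stein_pair_times_G,
        rule stein_pair_quad_form_power) (use that sym in auto)
  then show "integrable M (\<lambda>\<omega>. G a \<omega> * (G b \<omega> * quad_form c \<omega> ^ n))" using a b by simp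
  have *: "(mixed_moment c a b n) = v a * expectation
     (\<lambda>\<omega>. G b \<omega> * (2 * real n * (\<Sum>d\<in>I. c a d * (G d \<omega> * quad_form c \<omega> ^ (n - 1))))
          + (if b = a then quad_form c \<omega> ^ n else 0))"
    by (rule expectation_stein[OF stein_pair_times_G[OF stein_pair_quad_form_power[OF a sym] b a] a])
  have "(\<lambda>\<omega>. G b \<omega> * (2 * real n * (\<Sum>d\<in>I. c a d * (G d \<omega> * quad_form c \<omega> ^ (n - 1))))
          + (if b = a then quad_form c \<omega> ^ n else 0))
     = (\<lambda>\<omega>. 2 * real n * (\<Sum>d\<in>I. c a d * (G d \<omega> * (G b \<omega> * quad_form c \<omega> ^ (n - 1))))
          + (if a = b then quad_form c \<omega> ^ n else 0))"
    by (auto simp: fun_eq_iff sum_distrib_left algebra_simps)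
  then show "(mixed_moment c a b n) =
     v a * ((if a = b then (quad_moment c n) else 0)
       + 2 * real n * (\<Sum>d\<in>I. c a d * (mixed_moment c d b (n - 1))))"
    unfolding * using int integrable_quad_form_power[OF sym] b
    by (auto simp: integrable_sum)
qed

text \<open>
  The recursion, iterated until the power of Q is used up: each step contributes one factor 2 v c, and stops
  when the two indices meet.
\<close>

lemma mixed_moment_eq:
  assumes a: "a \<in> I" and b: "b \<in> I" and sym: "\<And>a b. c a b = c b a"
  shows "(mixed_moment c a b n) / fact n =
    (if a = b then v a * ((quad_moment c n) / fact n) else 0)
    + (\<Sum>l\<in>{1..n}. 2 ^ l * (v a * chain I v c (l - 1) a b * v b)
          * ((quad_moment c (n - l)) / fact (n - l)))"
  using a b
proof (induction n arbitrary: a b)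
  case 0
  then show ?case using mixed_moment_rec(1)[where c = c and n = 0, OF 0 sym] by simp
next
  case (Suc n)
  let ?\<mu> = "\<lambda>n. (quad_moment c n) / fact n"
  let ?m = "\<lambda>d n. (mixed_moment c d b n) / fact n"
  have r: "real (Suc n) / fact (Suc n) = 1 / fact n" by (simp del: of_nat_Suc)
  have "?m a (Suc n) = (if a = b then v a * ?\<mu> (Suc n) else 0)
       + 2 * v a * (real (Suc n) / fact (Suc n)) * (\<Sum>d\<in>I. c a d * (mixed_moment c d b n))"
    by (subst mixed_moment_rec[OF Suc.prems sym])
       (auto simp add: add_divide_distrib distrib_left simp del: fact_Suc of_nat_Suc)
  also have "\<dots> = (if a = b then v a * ?\<mu> (Suc n) else 0) + 2 * v a * (\<Sum>d\<in>I. c a d * ?m d n)"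
    unfolding r by (simp add: sum_distrib_left sum_distrib_right sum_divide_distrib)
  also have "(\<Sum>d\<in>I. c a d * ?m d n) =
     (\<Sum>d\<in>I. c a d * ((if d = b then v d * ?\<mu> n else 0)
     + (\<Sum>l\<in>{1..n}. 2 ^ l * (v d * chain I v c (l - 1) d b * v b) * ?\<mu> (n - l))))"
    by (intro sum.cong refl arg_cong2[where f = "(*)"] Suc.IH Suc.prems)
  also have "\<dots> = c a b * v b * ?\<mu> n
     + (\<Sum>d\<in>I. \<Sum>l\<in>{1..n}. c a d * (2 ^ l * (v d * chain I v c (l - 1) d b * v b) * ?\<mu> (n - l)))"
    using finite_I Suc.prems
    by (simp add: distrib_left sum.distrib sum_distrib_left if_distrib[of "\<lambda>x. _ * x"] mult.assoc cong: if_cong)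
  also have "(\<Sum>d\<in>I. \<Sum>l\<in>{1..n}. c a d * (2 ^ l * (v d * chain I v c (l - 1) d b * v b) * ?\<mu> (n - l)))
     = (\<Sum>l\<in>{1..n}. 2 ^ l * (chain I v c l a b * v b) * ?\<mu> (n - l))"
  proof (subst sum.swap, intro sum.cong refl)
    fix l assume "l \<in> {1..n}"
    then obtain k where l: "l = Suc k" by (cases l) auto
    show "(\<Sum>d\<in>I. c a d * (2 ^ l * (v d * chain I v c (l - 1) d b * v b) * ?\<mu> (n - l)))
       = 2 ^ l * (chain I v c l a b * v b) * ?\<mu> (n - l)"
      unfolding l by (simp add: sum_distrib_left sum_distrib_right sum_divide_distrib mult_ac)
  qed
  also have "c a b * v b * ?\<mu> n + (\<Sum>l\<in>{1..n}. 2 ^ l * (chain I v c l a b * v b) * ?\<mu> (n - l))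
     = (\<Sum>l\<in>{0..n}. 2 ^ l * (chain I v c l a b * v b) * ?\<mu> (n - l))"
    by (simp add: sum.atLeast_Suc_atMost)
  also have "2 * v a * \<dots> = (\<Sum>l\<in>{1..Suc n}. 2 ^ l * (v a * chain I v c (l - 1) a b * v b)
          * ?\<mu> (Suc n - l))"
    unfolding One_nat_def sum.atLeast_Suc_atMost_Suc_shift
    by (simp add: sum_distrib_left mult_ac)
  finally show ?case .
qed

text \<open>
  Contract the mixed moments with c. The diagonal contribution is \<Sum> c a a v a times the previous moment,
  and the centring of the form cancels exactly this term; what remains is the recursion of quad_coeff.
\<close>

theorem moments_quad_form:
  assumes sym: "\<And>a b. c a b = c b a"
  shows "(quad_moment c n) / fact n = quad_coeff (trace_power I v c) n"
proof (induction n rule: less_induct)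
  case (less n)
  show ?case
  proof (cases n)
    case 0
    then show ?thesis by (simp add: prob_space)
  next
    case (Suc k)
    let ?\<mu> = "\<lambda>n. (quad_moment c n) / fact n"
    have "(quad_moment c (Suc k))
      = expectation (\<lambda>\<omega>. (\<Sum>a\<in>I. \<Sum>b\<in>I. c a b * (G a \<omega> * (G b \<omega> * quad_form c \<omega> ^ k)))
           - (\<Sum>a\<in>I. c a a * v a) * quad_form c \<omega> ^ k)"
      by (rule Bochner_Integration.integral_cong)
        (auto simp: left_diff_distrib sum_distrib_right sum_distrib_left mult_ac quad_form_def)
    also have "\<dots> = (\<Sum>a\<in>I. \<Sum>b\<in>I. c a b * (mixed_moment c a b k))
          - (\<Sum>a\<in>I. c a a * v a) * (quad_moment c k)"
      using integrable_quad_form_power[where c=c and n=k, OF sym] mixed_moment_integrable[where c=c and n=k, OF _ _ sym]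
      by (subst Bochner_Integration.integral_diff)
        (auto intro!: integrable_sum Bochner_Integration.integral_diff)
    finally have "(quad_moment c (Suc k)) / fact k
      = (\<Sum>a\<in>I. \<Sum>b\<in>I. c a b * ((mixed_moment c a b k) / fact k))
          - (\<Sum>a\<in>I. c a a * v a) * ?\<mu> k"
      by (simp add: diff_divide_distrib sum_divide_distrib)
    also have "(\<Sum>a\<in>I. \<Sum>b\<in>I. c a b * ((mixed_moment c a b k) / fact k))
       = (\<Sum>a\<in>I. \<Sum>b\<in>I. (if a = b then c a b * v a * ?\<mu> k else 0)
         + (\<Sum>l\<in>{1..k}. 2 ^ l * (v a * v b * c a b * chain I v c (l - 1) a b) * ?\<mu> (k - l)))"
      by (intro sum.cong refl, subst mixed_moment_eq[OF _ _ sym])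
         (auto simp: distrib_left sum_distrib_left mult_ac intro!: sum.cong)
    also have "\<dots> = (\<Sum>a\<in>I. c a a * v a) * ?\<mu> k
         + (\<Sum>a\<in>I. \<Sum>b\<in>I. \<Sum>l\<in>{1..k}. 2 ^ l * (v a * v b * c a b * chain I v c (l - 1) a b) * ?\<mu> (k - l))"
      using finite_I by (simp add: sum.distrib sum_distrib_right sum_divide_distrib)
    also have "(\<Sum>a\<in>I. \<Sum>b\<in>I. \<Sum>l\<in>{1..k}. 2 ^ l * (v a * v b * c a b * chain I v c (l - 1) a b) * ?\<mu> (k - l))
      = (\<Sum>l\<in>{1..k}. \<Sum>a\<in>I. \<Sum>b\<in>I. 2 ^ l * (v a * v b * c a b * chain I v c (l - 1) a b) * ?\<mu> (k - l))"
      by (subst sum.swap[of _ I "{1..k}"], subst sum.swap[of _ I "{1..k}"]) (rule refl)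
    also have "\<dots> = (\<Sum>l\<in>{1..k}. 2 ^ l * trace_power I v c (Suc l) * ?\<mu> (k - l))"
      by (simp add: trace_power_def sum_distrib_left sum_distrib_right sum_divide_distrib mult_ac)
    also have "\<dots> = (\<Sum>l\<in>{1..k}. 2 ^ l * trace_power I v c (Suc l) * quad_coeff (trace_power I v c) (k - l))"
      using less Suc by (intro sum.cong refl arg_cong2[where f = "(*)"]) auto
    also have "\<dots> = real (Suc k) * quad_coeff (trace_power I v c) (Suc k)"
      by (simp add: quad_coeff.simps(2))
    finally have *: "(quad_moment c (Suc k)) / fact k
      = real (Suc k) * quad_coeff (trace_power I v c) (Suc k)"
      by simp
    have "(quad_moment c (Suc k)) / fact (Suc k)
      = (quad_moment c (Suc k)) / fact k / real (Suc k)"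
      by (simp only: fact_Suc divide_divide_eq_left mult.commute)
    then show ?thesis unfolding * Suc by (simp del: of_nat_Suc)
  qed
qed

end

section \<open>Characteristic functions and cumulants\<close>

lemma fps_conv_radius_geometric:
  fixes f :: "complex fps"
  assumes "\<And>n. norm (fps_nth f n) \<le> K ^ n" and "K > 0"
  shows "fps_conv_radius f \<ge> ereal (1 / K)"
  unfolding fps_conv_radius_def
proof (rule conv_radius_geI_ex')
  fix r :: real assume r: "0 < r" "ereal r < ereal (1 / K)"
  then have "K * r < 1" using assms(2) by (simp add: field_simps)
  then have "summable (\<lambda>n. (K * r) ^ n)" using r assms(2) by (intro summable_geometric) auto
  moreover have "norm (fps_nth f n * of_real r ^ n) \<le> (K * r) ^ n" for n
    using assms(1)[of n] r by (simp add: norm_mult norm_power power_mult_distrib mult_right_mono)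
  ultimately show "summable (\<lambda>n. fps_nth f n * of_real r ^ n)"
    by (rule summable_comparison_test'[where N = 0])
qed

text \<open>
  The logarithm of the moment series. It lacks the terms of degree 0 and 1, in
  accordance with the centring.
\<close>

definition cumulant_fps :: "(nat \<Rightarrow> real) \<Rightarrow> complex fps" where
  "cumulant_fps t = Abs_fps (\<lambda>n. if n < 2 then 0 else of_real (2 ^ (n - 1) * t n / real n))"

definition moment_fps :: "(nat \<Rightarrow> real) \<Rightarrow> complex fps" where
  "moment_fps t = Abs_fps (\<lambda>n. of_real (quad_coeff t n))"

lemma quad_coeff_bound:
  assumes t: "\<And>n. 2 \<le> n \<Longrightarrow> \<bar>t n\<bar> \<le> h ^ n" and h: "0 < h"
  shows "\<bar>quad_coeff t n\<bar> \<le> (2 * h) ^ n"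
proof (induction n rule: less_induct)
  case (less n)
  show ?case
  proof (cases n)
    case (Suc k)
    have "\<bar>\<Sum>l\<in>{1..k}. 2 ^ l * t (Suc l) * quad_coeff t (k - l)\<bar> \<le> (\<Sum>l\<in>{1..k}. (2 * h) ^ Suc k)"
    proof (rule order.trans[OF sum_abs sum_mono])
      fix l assume l: "l \<in> {1..k}"
      have "\<bar>2 ^ l * t (Suc l) * quad_coeff t (k - l)\<bar> \<le> 2 ^ l * h ^ Suc l * (2 * h) ^ (k - l)"
        unfolding abs_mult using l less[of "k - l"] t[of "Suc l"] h Suc
        by (intro mult_mono) auto
      also have "\<dots> = 2 ^ (l + (k - l)) * h ^ (Suc l + (k - l))"
        by (simp only: power_mult_distrib power_add mult_ac)
      also have "\<dots> = 2 ^ k * h ^ Suc k" using l by simp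
      also have "\<dots> \<le> (2 * h) ^ Suc k" using h by (simp add: power_mult_distrib)
      finally show "\<bar>2 ^ l * t (Suc l) * quad_coeff t (k - l)\<bar> \<le> (2 * h) ^ Suc k" .
    qed
    also have "\<dots> \<le> (2 * h) ^ Suc k * real (Suc k)" using h by simp
    finally show ?thesis
      unfolding Suc quad_coeff.simps(2) by (simp add: abs_divide pos_divide_le_eq del: of_nat_Suc power_Suc)
  qed simp
qed

lemma conv_radius_cumulant_fps:
  assumes t: "\<And>n. 2 \<le> n \<Longrightarrow> \<bar>t n\<bar> \<le> h ^ n" and h: "0 < h"
  shows "fps_conv_radius (cumulant_fps t) \<ge> ereal (1 / (2 * h))"
proof (rule fps_conv_radius_geometric)
  fix n
  show "norm (fps_nth (cumulant_fps t) n) \<le> (2 * h) ^ n"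
  proof (cases "n < 2")
    case False
    then have "\<bar>2 ^ (n - 1) * t n / real n\<bar> \<le> 2 ^ (n - 1) * h ^ n / 1"
      unfolding abs_mult abs_divide using t[of n] h by (intro frac_le mult_mono) auto
    also have "\<dots> \<le> (2 * h) ^ n"
      using h by (simp add: power_mult_distrib)
    finally have "\<bar>2 ^ (n - 1) * t n / real n\<bar> \<le> (2 * h) ^ n" .
    then show ?thesis using False by (simp add: cumulant_fps_def del: of_real_mult of_real_divide of_real_power)
  qed (use h in \<open>auto simp: cumulant_fps_def\<close>)
qed (use h in auto)

lemma conv_radius_moment_fps:
  assumes t: "\<And>n. 2 \<le> n \<Longrightarrow> \<bar>t n\<bar> \<le> h ^ n" and h: "0 < h"
  shows "fps_conv_radius (moment_fps t) \<ge> ereal (1 / (2 * h))"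
  by (rule fps_conv_radius_geometric) (use quad_coeff_bound[OF t h] h in \<open>auto simp: moment_fps_def\<close>)

text \<open>
  With A the moment series and H the cumulant series, the recursion for quad_coeff is the comparison of
  coefficients in A' = A H'.
\<close>

lemma fps_deriv_moment_fps: "fps_deriv (moment_fps t) = moment_fps t * fps_deriv (cumulant_fps t)"
proof (rule fps_ext)
  fix n
  let ?g = "\<lambda>l. fps_nth (fps_deriv (cumulant_fps t)) l"
  have g: "?g l = (if l = 0 then 0 else of_real (2 ^ l * t (Suc l)))" for l
    by (simp add: cumulant_fps_def del: of_nat_Suc)
  have "fps_nth (moment_fps t * fps_deriv (cumulant_fps t)) n
     = (\<Sum>l=0..n. of_real (quad_coeff t (n - l)) * ?g l)"
    unfolding mult.commute[of "moment_fps t"] by (simp add: fps_mult_nth moment_fps_def mult.commute)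
  also have "\<dots> = (\<Sum>l=1..n. of_real (2 ^ l * t (Suc l) * quad_coeff t (n - l)))"
    unfolding g by (simp add: sum.atLeast_Suc_atMost mult_ac)
  also have "\<dots> = of_real (real (Suc n) * quad_coeff t (Suc n))"
    by (simp add: quad_coeff.simps(2) del: of_nat_Suc of_real_mult)
  also have "\<dots> = fps_nth (fps_deriv (moment_fps t)) n"
    by (simp add: moment_fps_def del: of_nat_Suc)
  finally show "fps_nth (fps_deriv (moment_fps t)) n = fps_nth (moment_fps t * fps_deriv (cumulant_fps t)) n"
    by simp
qed

text \<open>
  By the previous differential equation A exp(-H) has derivative 0 on the disc of radius 1 / (2 h), on
  which both series converge.
\<close>

lemma eval_moment_fps:
  assumes t: "\<And>n. 2 \<le> n \<Longrightarrow> \<bar>t n\<bar> \<le> h ^ n" and h: "0 < h" and z: "norm z < 1 / (2 * h)"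
  shows "eval_fps (moment_fps t) z = exp (eval_fps (cumulant_fps t) z)"
proof -
  let ?A = "eval_fps (moment_fps t)" and ?H = "eval_fps (cumulant_fps t)"
  let ?S = "ball 0 (1 / (2 * h)) :: complex set"
  define Q where "Q = (\<lambda>z. ?A z * exp (- ?H z))"
  have "(Q has_field_derivative 0) (at w within ?S)" if w: "w \<in> ?S" for w
  proof -
    have rA: "norm w < fps_conv_radius (moment_fps t)"
      by (rule less_le_trans[OF _ conv_radius_moment_fps[OF t h]]) (use w in simp)
    have rH: "norm w < fps_conv_radius (cumulant_fps t)"
      by (rule less_le_trans[OF _ conv_radius_cumulant_fps[OF t h]]) (use w in simp)
    have "norm w < fps_conv_radius (fps_deriv (cumulant_fps t))"
      using rH fps_conv_radius_deriv by (rule less_le_trans)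
    then have "eval_fps (fps_deriv (moment_fps t)) w = ?A w * eval_fps (fps_deriv (cumulant_fps t)) w"
      unfolding fps_deriv_moment_fps using rA by (simp add: eval_fps_mult)
    then show ?thesis unfolding Q_def
      by (auto intro!: derivative_eq_intros has_field_derivative_eval_fps rA rH)
  qed
  then obtain c where "\<And>w. w \<in> ?S \<Longrightarrow> Q w = c"
    using has_field_derivative_zero_constant[of ?S Q] convex_ball by blast
  then have "Q z = Q 0" using z h by simp
  moreover have "Q 0 = 1"
    by (simp add: Q_def eval_fps_at_0 moment_fps_def cumulant_fps_def)
  ultimately have "?A z * exp (- ?H z) = 1" by (simp add: Q_def)
  then show ?thesis by (simp add: exp_minus field_simps)
qed

context prob_space begin

text \<open>
  The remainder of the Taylor expansion of a characteristic function is bounded by an absolute moment. In even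
  degree this is an ordinary moment, so the remainders of even degree tend to 0, which suffices
  since the full series converges.
\<close>

lemma char_eq_eval_moment_fps:
  assumes [measurable]: "random_variable borel X"
    and int: "\<And>n. integrable M (\<lambda>\<omega>. X \<omega> ^ n)"
    and mom: "\<And>n. expectation (\<lambda>\<omega>. X \<omega> ^ n) / fact n = quad_coeff t n"
    and t: "\<And>n. 2 \<le> n \<Longrightarrow> \<bar>t n\<bar> \<le> h ^ n" and h: "0 < h" and s: "\<bar>s\<bar> < 1 / (2 * h)"
  shows "char (distr M borel X) s = eval_fps (moment_fps t) (\<i> * of_real s)"
proof -
  let ?z = "\<i> * of_real s :: complex"
  define S where "S = (\<lambda>n. \<Sum>k\<le>n. fps_nth (moment_fps t) k * ?z ^ k)"
  have q: "2 * h * \<bar>s\<bar> < 1" "0 \<le> 2 * h * \<bar>s\<bar>" using s h by (auto simp: field_simps)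
  have "norm ?z < fps_conv_radius (moment_fps t)"
    by (rule less_le_trans[OF _ conv_radius_moment_fps[OF t h]]) (use s in \<open>simp add: norm_mult\<close>)
  then have "S \<longlonglongrightarrow> eval_fps (moment_fps t) ?z"
    unfolding S_def eval_fps_def by (intro summable_LIMSEQ' summable_fps)
  then have *: "(\<lambda>n. S (2 * n)) \<longlonglongrightarrow> eval_fps (moment_fps t) ?z"
    by (rule filterlim_compose) (auto intro!: filterlim_subseq strict_monoI)
  have bd: "norm (char (distr M borel X) s - S (2 * n)) \<le> 2 * ((2 * h * \<bar>s\<bar>) ^ 2) ^ n" for n
  proof -
    have "norm (char (distr M borel X) s - S (2 * n))
      \<le> (2 * \<bar>s\<bar> ^ (2 * n) / fact (2 * n)) * expectation (\<lambda>\<omega>. \<bar>X \<omega>\<bar> ^ (2 * n))"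
      using char_approx1'[OF int assms(1) refl, where n = "2 * n" and t = s]
      by (simp add: S_def moment_fps_def mom[symmetric] mult_ac)
    also have "\<dots> = 2 * \<bar>s\<bar> ^ (2 * n) * \<bar>quad_coeff t (2 * n)\<bar>"
      by (simp flip: mom add: power_even_abs integral_nonneg_AE)
    also have "\<dots> \<le> 2 * \<bar>s\<bar> ^ (2 * n) * (2 * h) ^ (2 * n)"
      by (intro mult_left_mono quad_coeff_bound[OF t h]) auto
    also have "\<dots> = 2 * ((2 * h * \<bar>s\<bar>) ^ 2) ^ n"
      by (simp only: power_mult[symmetric] power_mult_distrib mult_ac)
    finally show ?thesis .
  qed
  have "(\<lambda>n. 2 * ((2 * h * \<bar>s\<bar>) ^ 2) ^ n) \<longlonglongrightarrow> 2 * 0"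
    by (intro tendsto_mult tendsto_const LIMSEQ_power_zero)
      (use q in \<open>simp only: real_norm_def abs_power2 abs_square_less_1 abs_of_nonneg\<close>)
  then have "(\<lambda>n. 2 * ((2 * h * \<bar>s\<bar>) ^ 2) ^ n) \<longlonglongrightarrow> 0" by (simp only: mult_zero_right)
  then have "(\<lambda>n. char (distr M borel X) s - S (2 * n)) \<longlonglongrightarrow> 0"
    by (rule Lim_null_comparison[rotated]) (use bd in simp)
  from tendsto_diff[OF tendsto_const[of "char (distr M borel X) s"] this]
  have "(\<lambda>n. S (2 * n)) \<longlonglongrightarrow> char (distr M borel X) s" by simp
  with * show ?thesis by (rule LIMSEQ_unique[symmetric])
qed

end

lemma tendsto_quad_coeff:
  assumes "\<And>n. 2 \<le> n \<Longrightarrow> (\<lambda>k. T k n) \<longlonglongrightarrow> t n"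
  shows "(\<lambda>k. quad_coeff (T k) n) \<longlonglongrightarrow> quad_coeff t n"
proof (induction n rule: less_induct)
  case (less n)
  show ?case
  proof (cases n)
    case (Suc m)
    show ?thesis unfolding Suc quad_coeff.simps(2)
      using less assms Suc by (intro tendsto_intros) auto
  qed simp
qed

lemma tendsto_eval_moment_fps:
  assumes lim: "\<And>n. 2 \<le> n \<Longrightarrow> (\<lambda>k. T k n) \<longlonglongrightarrow> t n"
    and T: "\<And>k n. 2 \<le> n \<Longrightarrow> \<bar>T k n\<bar> \<le> h ^ n" and h: "0 < h" and z: "norm z < 1 / (2 * h)"
  shows "(\<lambda>k. eval_fps (moment_fps (T k)) z) \<longlonglongrightarrow> eval_fps (moment_fps t) z"
proof -
  have q: "2 * h * norm z < 1" using z h by (simp add: field_simps)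
  have "norm (of_real (quad_coeff (T k) n) * z ^ n) \<le> (2 * h * norm z) ^ n" for n k
    unfolding norm_mult norm_power power_mult_distrib[of _ "norm z"]
    using quad_coeff_bound[where t = "T k" and n = n, OF T h] by (intro mult_right_mono) auto
  then have ev: "\<forall>\<^sub>F (n, k) in at_top \<times>\<^sub>F sequentially.
      norm (of_real (quad_coeff (T k) n) * z ^ n) \<le> (2 * h * norm z) ^ n"
    by (intro always_eventually) auto
  have pw: "(\<lambda>k. of_real (quad_coeff (T k) n) * z ^ n) \<longlonglongrightarrow> of_real (quad_coeff t n) * z ^ n" for n
    by (intro tendsto_intros tendsto_quad_coeff lim)
  have "summable (\<lambda>n. (2 * h * norm z) ^ n)"
    using q h by (intro summable_geometric) auto
  from tannerys_theorem[OF pw ev this] show ?thesis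
    by (simp add: eval_fps_def moment_fps_def)
qed

lemma iterated_vector_derivative_eval_fps:
  assumes u: "\<And>s. \<bar>s\<bar> < r \<Longrightarrow> u s = eval_fps H (\<i> * of_real s)"
    and r: "0 < r" "ereal r \<le> fps_conv_radius H" and s: "\<bar>s\<bar> < r"
  shows "((\<lambda>f t. vector_derivative f (at t)) ^^ m) u s
    = \<i> ^ m * eval_fps ((fps_deriv ^^ m) H) (\<i> * of_real s)"
  using s
proof (induction m arbitrary: s)
  case (Suc m)
  let ?D = "(\<lambda>f t. vector_derivative f (at t)) ^^ m" and ?H = "(fps_deriv ^^ m) H"
  have rad: "fps_conv_radius ((fps_deriv ^^ m) H) \<ge> fps_conv_radius H"
    by (induction m) (auto intro: order.trans fps_conv_radius_deriv)
  have ev: "eventually (\<lambda>x. x \<in> UNIV \<longrightarrow> ?D u x = \<i> ^ m * eval_fps ?H (\<i> * of_real x)) (nhds s)"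
    using eventually_nhds_in_open[of "ball 0 r" s] Suc.prems
    by (auto elim!: eventually_mono intro!: Suc.IH)
  have "((\<lambda>z. \<i> ^ m * eval_fps ?H (\<i> * z)) has_field_derivative
       \<i> ^ m * (eval_fps (fps_deriv ?H) (\<i> * of_real s) * \<i>)) (at (of_real s))"
    using Suc.prems less_le_trans[OF _ order.trans[OF r(2) rad]]
    by (auto intro!: derivative_eq_intros DERIV_chain2[where f = "eval_fps ?H"]
        has_field_derivative_eval_fps simp: norm_mult)
  then have "((\<lambda>x. \<i> ^ m * eval_fps ?H (\<i> * of_real x)) has_vector_derivative
      \<i> ^ m * (eval_fps (fps_deriv ?H) (\<i> * of_real s) * \<i>)) (at s)"
    by (rule has_vector_derivative_real_field)
  then show ?case
    by (simp add: vector_derivative_cong_eq[OF ev refl refl] vector_derivative_at mult_ac)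
qed (use u in simp)

text \<open>
  This is the law of a double integral for which t n is the trace of the n-th power of the operator. The
  formula is demanded only near 0, where it determines all cumulants; h controls the radius.
\<close>

definition chaos_law :: "'a measure \<Rightarrow> ('a \<Rightarrow> real) \<Rightarrow> (nat \<Rightarrow> real) \<Rightarrow> bool" where
  "chaos_law M X t \<longleftrightarrow> (\<exists>h>0. (\<forall>n\<ge>2. \<bar>t n\<bar> \<le> h ^ n) \<and>
     (\<forall>s. \<bar>s\<bar> < 1 / (2 * h) \<longrightarrow>
        char (distr M borel X) s = exp (eval_fps (cumulant_fps t) (\<i> * of_real s))))"

lemma chaos_lawI:
  assumes h: "0 < h" and t: "\<And>n. 2 \<le> n \<Longrightarrow> \<bar>t n\<bar> \<le> h ^ n"
    and c: "\<And>s. \<bar>s\<bar> < 1 / (2 * h) \<Longrightarrow>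
        char (distr M borel X) s = eval_fps (moment_fps t) (\<i> * of_real s)"
  shows "chaos_law M X t"
  unfolding chaos_law_def
  using h t c eval_moment_fps[OF t h, of "\<i> * of_real s" for s] by (intro exI[of _ h]) (simp add: norm_mult)

lemma chaos_law_cong: "chaos_law M X t \<Longrightarrow> (\<And>n. 2 \<le> n \<Longrightarrow> t n = t' n) \<Longrightarrow> chaos_law M X t'"
  by (simp add: chaos_law_def cumulant_fps_def cong: if_cong)

text \<open>
  Near 0 the exponent H has small imaginary part, so the principal branch of the logarithm undoes the
  exponential, and the m-th derivative at 0 picks out the m-th coefficient of H.
\<close>

lemma cumulant_chaos_law:
  assumes "chaos_law M X t" and m: "2 \<le> m"
  shows "cumulant M X m = 2 ^ (m - 1) * fact (m - 1) * t m"
proof -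
  obtain h where h: "0 < h" and t: "\<And>n. 2 \<le> n \<Longrightarrow> \<bar>t n\<bar> \<le> h ^ n"
    and c: "\<And>s. \<bar>s\<bar> < 1 / (2 * h) \<Longrightarrow>
        char (distr M borel X) s = exp (eval_fps (cumulant_fps t) (\<i> * of_real s))"
    using assms(1) by (auto simp: chaos_law_def)
  let ?H = "cumulant_fps t"
  have rad: "ereal (1 / (2 * h)) \<le> fps_conv_radius ?H"
    by (rule conv_radius_cumulant_fps[OF t h])
  have "isCont (eval_fps ?H) 0"
    using less_le_trans[OF _ rad, of 0] h by (intro DERIV_isCont[OF has_field_derivative_eval_fps]) (auto simp flip: zero_ereal_def)
  then have "((\<lambda>s. eval_fps ?H (\<i> * of_real s)) \<longlongrightarrow> eval_fps ?H 0) (at (0 :: real))"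
    by (rule isCont_tendsto_compose) (auto intro!: tendsto_eq_intros)
  then have "((\<lambda>s. Im (eval_fps ?H (\<i> * of_real s))) \<longlongrightarrow> 0) (at (0 :: real))"
    by (auto simp: eval_fps_at_0 cumulant_fps_def dest: tendsto_Im)
  then have "eventually (\<lambda>s. \<bar>Im (eval_fps ?H (\<i> * of_real s))\<bar> < pi) (at (0 :: real))"
    by (auto simp: tendsto_iff dest: spec[where x = pi])
  then obtain d where d: "d > 0" "\<And>s :: real. s \<noteq> 0 \<Longrightarrow> \<bar>s\<bar> < d \<Longrightarrow> \<bar>Im (eval_fps ?H (\<i> * of_real s))\<bar> < pi"
    by (auto simp: eventually_at)
  define r where "r = min d (1 / (2 * h))"
  have u: "Ln (char (distr M borel X) s) = eval_fps ?H (\<i> * of_real s)" if s: "\<bar>s\<bar> < r" for s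
  proof -
    have "\<bar>Im (eval_fps ?H (\<i> * of_real s))\<bar> < pi"
      using d(2)[of s] s by (cases "s = 0") (auto simp: r_def eval_fps_at_0 cumulant_fps_def)
    moreover have "char (distr M borel X) s = exp (eval_fps ?H (\<i> * of_real s))"
      using c[of s] s by (simp add: r_def)
    ultimately show ?thesis by (simp add: abs_less_iff)
  qed
  have r: "0 < r" "ereal r \<le> fps_conv_radius ?H"
    using d(1) h rad by (auto simp: r_def intro: order.trans[rotated])
  have "((\<lambda>f t. vector_derivative f (at t)) ^^ m) (\<lambda>s. Ln (char (distr M borel X) s)) 0
    = \<i> ^ m * (fact m * fps_nth ?H m)"
    using iterated_vector_derivative_eval_fps[OF u r, of 0 m] r
    by (simp add: eval_fps_at_0 fps_0th_higher_deriv)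
  then have "cumulant M X m = Re ((- \<i>) ^ m * (\<i> ^ m * (fact m * fps_nth ?H m)))"
    by (simp only: cumulant_def)
  moreover have "fact m * fps_nth ?H m = of_real (2 ^ (m - 1) * fact (m - 1) * t m)"
    using m by (cases m) (auto simp: cumulant_fps_def simp del: of_nat_Suc)
  moreover have "(- \<i>) ^ m * (\<i> ^ m * z) = z" for z
    by (simp flip: mult.assoc power_mult_distrib)
  ultimately show ?thesis by (simp only: Re_complex_of_real)
qed

lemma chaos_law_scale:
  assumes X: "chaos_law M X t" and [measurable]: "X \<in> borel_measurable M"
  shows "chaos_law M (\<lambda>\<omega>. A * X \<omega>) (\<lambda>n. A ^ n * t n)"
proof -
  obtain h where h: "0 < h" and t: "\<And>n. 2 \<le> n \<Longrightarrow> \<bar>t n\<bar> \<le> h ^ n"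
    and c: "\<And>s. \<bar>s\<bar> < 1 / (2 * h) \<Longrightarrow>
        char (distr M borel X) s = exp (eval_fps (cumulant_fps t) (\<i> * of_real s))"
    using X by (auto simp: chaos_law_def)
  let ?h = "h * (\<bar>A\<bar> + 1)"
  have hp: "0 < ?h" using h by simp
  have 1: "\<bar>A ^ n * t n\<bar> \<le> ?h ^ n" if "2 \<le> n" for n
  proof -
    have "\<bar>A\<bar> ^ n * \<bar>t n\<bar> \<le> (\<bar>A\<bar> + 1) ^ n * h ^ n"
      using t[OF that] h by (intro mult_mono power_mono) auto
    then show ?thesis by (simp add: abs_mult power_abs power_mult_distrib mult.commute)
  qed
  have 2: "char (distr M borel (\<lambda>\<omega>. A * X \<omega>)) s = exp (eval_fps (cumulant_fps (\<lambda>n. A ^ n * t n)) (\<i> * of_real s))"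
    if s: "\<bar>s\<bar> < 1 / (2 * ?h)" for s
  proof -
    have "\<bar>A * s\<bar> * (2 * h) \<le> \<bar>s\<bar> * (2 * ?h)"
      using h by (simp add: abs_mult algebra_simps)
    also have "\<dots> < 1" using s hp by (simp only: pos_less_divide_eq mult_pos_pos zero_less_numeral)
    finally have "\<bar>A * s\<bar> < 1 / (2 * h)" using h by (simp add: pos_less_divide_eq)
    note c[OF this]
    moreover have "char (distr M borel (\<lambda>\<omega>. A * X \<omega>)) s = char (distr M borel X) (A * s)"
      unfolding char_def by (simp add: integral_distr mult_ac)
    moreover have "eval_fps (cumulant_fps (\<lambda>n. A ^ n * t n)) (\<i> * of_real s)
       = eval_fps (cumulant_fps t) (\<i> * of_real (A * s))"
      unfolding eval_fps_def cumulant_fps_def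
      by (intro suminf_cong) (simp add: power_mult_distrib mult_ac)
    ultimately show ?thesis by simp
  qed
  show ?thesis unfolding chaos_law_def using hp 1 2 by blast
qed

section \<open>Limits in mean square and the law of Y\<close>

lemma (in gaussian_family) measurable_quad_form [measurable]: "quad_form c \<in> borel_measurable M"
  unfolding quad_form_def [abs_def] by measurable

lemma (in gaussian_family) char_quad_form:
  assumes sym: "\<And>a b. c a b = c b a"
    and t: "\<And>n. 2 \<le> n \<Longrightarrow> \<bar>trace_power I v c n\<bar> \<le> h ^ n" and h: "0 < h" and s: "\<bar>s\<bar> < 1 / (2 * h)"
  shows "char (distr M borel (quad_form c)) s
    = eval_fps (moment_fps (trace_power I v c)) (\<i> * of_real s)"
  by (rule char_eq_eval_moment_fps[OF measurable_quad_form integrable_quad_form_power[OF sym]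
        moments_quad_form[OF sym] t h s])

lemma (in gaussian_family) chaos_law_quad_form:
  assumes "\<And>a b. c a b = c b a" "\<And>n. 2 \<le> n \<Longrightarrow> \<bar>trace_power I v c n\<bar> \<le> h ^ n" "0 < h"
  shows "chaos_law M (quad_form c) (trace_power I v c)"
  by (rule chaos_lawI[OF assms(3,2) char_quad_form[OF assms]])

lemma norm_iexp_diff_le: "norm (iexp a - iexp b) \<le> \<bar>a - b\<bar>"
proof -
  have "iexp a - iexp b = iexp b * (iexp (a - b) - 1)"
    by (simp add: algebra_simps flip: exp_add)
  then show ?thesis using iexp_approx1[of "a - b" 0] by (simp add: norm_mult)
qed

abbreviation L2_sq :: "'a measure \<Rightarrow> ('a \<Rightarrow> real) \<Rightarrow> ('a \<Rightarrow> real) \<Rightarrow> ennreal" where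
  "L2_sq M u v \<equiv> \<integral>\<^sup>+x. ennreal ((u x - v x)\<^sup>2) \<partial>M"

text \<open>
  The function exp(i s x) is Lipschitz with constant |s|, and the mean of |X - Y k| is at
  most its norm in L2.
\<close>

lemma (in prob_space) tendsto_char_of_L2:
  assumes [measurable]: "X \<in> borel_measurable M" "\<And>k. Y k \<in> borel_measurable M"
    and lim: "(\<lambda>k. L2_sq M X (Y k)) \<longlonglongrightarrow> 0"
  shows "(\<lambda>k. char (distr M borel (Y k)) s) \<longlonglongrightarrow> char (distr M borel X) s"
proof -
  define d where "d k = norm (char (distr M borel X) s - char (distr M borel (Y k)) s)" for k
  have bd: "ennreal (d k ^ 2) \<le> ennreal (s\<^sup>2) * L2_sq M X (Y k)" for k
  proof -
    have int: "integrable M (\<lambda>\<omega>. iexp (s * X \<omega>))" "integrable M (\<lambda>\<omega>. iexp (s * Y k \<omega>))"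
      by (auto intro!: integrable_const_bound[where B = 1])
    have "char (distr M borel X) s - char (distr M borel (Y k)) s
       = (CLINT \<omega>|M. iexp (s * X \<omega>) - iexp (s * Y k \<omega>))"
      using int by (simp add: char_def integral_distr)
    then have "ennreal (d k) \<le> (\<integral>\<^sup>+\<omega>. norm (iexp (s * X \<omega>) - iexp (s * Y k \<omega>)) \<partial>M)"
      unfolding d_def using integral_norm_bound_ennreal[OF Bochner_Integration.integrable_diff[OF int]]
      by (simp only:)
    also have "\<dots> \<le> (\<integral>\<^sup>+\<omega>. ennreal \<bar>s\<bar> * (ennreal \<bar>X \<omega> - Y k \<omega>\<bar> * 1) \<partial>M)"
    proof (intro nn_integral_mono)
      fix \<omega>
      have "norm (iexp (s * X \<omega>) - iexp (s * Y k \<omega>)) \<le> \<bar>s * X \<omega> - s * Y k \<omega>\<bar>"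
        by (rule norm_iexp_diff_le)
      also have "\<dots> = \<bar>s\<bar> * \<bar>X \<omega> - Y k \<omega>\<bar>" by (simp add: abs_mult flip: right_diff_distrib)
      finally show "ennreal (norm (iexp (s * X \<omega>) - iexp (s * Y k \<omega>))) \<le> ennreal \<bar>s\<bar> * (ennreal \<bar>X \<omega> - Y k \<omega>\<bar> * 1)"
        by (simp add: ennreal_mult' [symmetric] ennreal_leI)
    qed
    also have "\<dots> = ennreal \<bar>s\<bar> * (\<integral>\<^sup>+\<omega>. ennreal \<bar>X \<omega> - Y k \<omega>\<bar> * 1 \<partial>M)"
      by (rule nn_integral_cmult) measurable
    finally have "ennreal (d k) ^ 2 \<le> ennreal \<bar>s\<bar> ^ 2 * (\<integral>\<^sup>+\<omega>. ennreal \<bar>X \<omega> - Y k \<omega>\<bar> * 1 \<partial>M) ^ 2"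
      by (metis power_mono power_mult_distrib zero_le)
    also have "\<dots> \<le> ennreal \<bar>s\<bar> ^ 2 * ((\<integral>\<^sup>+\<omega>. ennreal \<bar>X \<omega> - Y k \<omega>\<bar> ^ 2 \<partial>M) * (\<integral>\<^sup>+\<omega>. 1 ^ 2 \<partial>M))"
      by (intro mult_left_mono Cauchy_Schwarz_nn_integral) auto
    finally show ?thesis
      by (simp add: ennreal_power emeasure_space_1 d_def)
  qed
  have "(\<lambda>k. ennreal (s\<^sup>2) * L2_sq M X (Y k)) \<longlonglongrightarrow> ennreal (s\<^sup>2) * 0"
    by (intro ennreal_tendsto_cmult lim) auto
  then have lim0: "(\<lambda>k. ennreal (s\<^sup>2) * L2_sq M X (Y k)) \<longlonglongrightarrow> 0"
    by (simp only: mult_zero_right)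
  have "(\<lambda>k. ennreal (d k ^ 2)) \<longlonglongrightarrow> 0"
    by (rule tendsto_sandwich[OF _ _ tendsto_const lim0]) (simp_all only: bd zero_le eventually_True)
  then have "(\<lambda>k. ennreal (d k ^ 2)) \<longlonglongrightarrow> ennreal 0" by (simp only: ennreal_0)
  then have "(\<lambda>k. d k ^ 2) \<longlonglongrightarrow> 0"
    by (subst (asm) tendsto_ennreal_iff) (auto intro: always_eventually)
  then have "(\<lambda>k. sqrt (d k ^ 2)) \<longlonglongrightarrow> sqrt 0" by (rule tendsto_real_sqrt)
  have "(\<lambda>k. char (distr M borel X) s - char (distr M borel (Y k)) s) \<longlonglongrightarrow> 0"
    by (rule tendsto_norm_zero_cancel) (use \<open>(\<lambda>k. sqrt (d k ^ 2)) \<longlonglongrightarrow> sqrt 0\<close> in \<open>simp add: d_def\<close>)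
  from tendsto_diff[OF tendsto_const[of "char (distr M borel X) s"] this] show ?thesis by simp
qed

text \<open>
  Y is a quadratic form in two independent normal variables with diagonal coefficients. The index type is
  bool because the independence of a pair is by definition that of a family indexed by bool.
\<close>

lemma chaos_law_Y_limit:
  assumes "prob_space N"
    and Z: "distributed N lborel Z1 std_normal_density" "distributed N lborel Z2 std_normal_density"
    and ind: "prob_space.indep_var N borel Z1 borel Z2"
  shows "chaos_law N (Y_limit \<rho> Z1 Z2) (\<lambda>n. (a_coeff \<rho> / sqrt 2) ^ n + (b_coeff \<rho> / sqrt 2) ^ n)"
proof -
  interpret prob_space N by fact
  let ?G = "case_bool Z1 Z2" and ?v = "\<lambda>_ :: bool. 1 :: real"
  define l where "l = case_bool (a_coeff \<rho> / sqrt 2) (b_coeff \<rho> / sqrt 2)"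
  define c where "c = (\<lambda>i j. if i = j then l i else 0)"
  have *: "case_bool borel borel = (\<lambda>_. borel :: real measure)" by (auto simp: fun_eq_iff split: bool.split)
  interpret gaussian_family N UNIV ?G ?v
    using ind Z by unfold_locales (auto simp: indep_var_def * split: bool.split)
  have chain: "chain UNIV ?v c n i j = (if i = j then l i ^ Suc n else 0)" for n i j
    by (induction n arbitrary: i) (auto simp: c_def if_distrib[of "\<lambda>x. x * _"] cong: if_cong)
  have tr: "trace_power UNIV ?v c n = l True ^ n + l False ^ n" if "2 \<le> n" for n
  proof -
    define k where "k = n - 2"
    have n: "n = Suc (Suc k)" using that by (simp add: k_def)
    show ?thesis unfolding trace_power_def chain n by (simp add: UNIV_bool c_def)
  qed
  have qf: "quad_form c = Y_limit \<rho> Z1 Z2"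
    unfolding fun_eq_iff quad_form_def Y_limit_def
    by (simp add: UNIV_bool c_def l_def power2_eq_square algebra_simps diff_divide_distrib)
  define h where "h = \<bar>l True\<bar> + \<bar>l False\<bar> + 1"
  have h: "0 < h" by (simp add: h_def)
  have bd: "\<bar>l True ^ n + l False ^ n\<bar> \<le> h ^ n" if "2 \<le> n" for n
  proof -
    define k where "k = n - 1"
    have n: "n = Suc k" using that by (simp add: k_def)
    have "\<bar>l True ^ n + l False ^ n\<bar> \<le> \<bar>l True\<bar> * \<bar>l True\<bar> ^ k + \<bar>l False\<bar> * \<bar>l False\<bar> ^ k"
      using abs_triangle_ineq[of "l True ^ n" "l False ^ n"] by (simp add: n abs_mult power_abs)
    also have "\<dots> \<le> \<bar>l True\<bar> * h ^ k + \<bar>l False\<bar> * h ^ k"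
      by (intro add_mono mult_left_mono power_mono) (auto simp: h_def)
    also have "\<dots> \<le> h ^ n" by (simp add: n h_def algebra_simps)
    finally show ?thesis .
  qed
  have "chaos_law N (quad_form c) (trace_power UNIV ?v c)"
    by (rule chaos_law_quad_form[OF _ _ h]) (simp_all add: c_def[abs_def] tr[unfolded c_def] bd)
  then show ?thesis unfolding qf by (rule chaos_law_cong) (simp add: tr l_def)
qed

section \<open>Step functions and their refinement\<close>

abbreviation mesh :: "(nat \<Rightarrow> real) \<Rightarrow> nat \<Rightarrow> real" where
  "mesh \<tau> \<equiv> \<lambda>i. \<tau> (Suc i) - \<tau> i"

abbreviation is_grid :: "nat \<Rightarrow> (nat \<Rightarrow> real) \<Rightarrow> bool" where
  "is_grid n \<tau> \<equiv> \<forall>i<n. \<tau> i < \<tau> (Suc i)"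

abbreviation plane :: "(real \<times> real) measure" where
  "plane \<equiv> lborel \<Otimes>\<^sub>M lborel"

abbreviation cell_ind :: "(nat \<Rightarrow> real) \<Rightarrow> nat \<Rightarrow> real \<Rightarrow> real" where
  "cell_ind \<tau> i x \<equiv> indicator {\<tau> i<..\<tau> (Suc i)} x"

lemma grid_less:
  assumes "is_grid n \<tau>" "i < j" "j \<le> n"
  shows "\<tau> i < \<tau> j"
  using assms(2,3)
proof (induction j)
  case (Suc j)
  then show ?case using assms(1) by (cases "i = j") (auto intro: less_trans)
qed simp

lemma grid_le:
  assumes "is_grid n \<tau>" "i \<le> j" "j \<le> n"
  shows "\<tau> i \<le> \<tau> j"
  using grid_less[OF assms(1), of i j] assms(2,3) by (cases "i = j") auto

lemma cell_unique:
  assumes g: "is_grid n \<tau>" and "i < n" "j < n"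
    and x: "x \<in> {\<tau> i<..\<tau> (Suc i)}" "x \<in> {\<tau> j<..\<tau> (Suc j)}"
  shows "i = j"
proof -
  have "\<not> i < j" "\<not> j < i"
    using grid_le[OF g, of "Suc i" j] grid_le[OF g, of "Suc j" i] assms by auto
  then show ?thesis by simp
qed

lemma cell_ind_prod:
  assumes "is_grid n \<tau>" "i < n" "j < n"
  shows "cell_ind \<tau> i x * cell_ind \<tau> j x = (if i = j then cell_ind \<tau> i x else 0)"
  using cell_unique[OF assms, of x] by (auto simp: indicator_def)

lemma step_fun_cell:
  assumes g: "is_grid n \<tau>" and ij: "i < n" "j < n"
    and x: "x \<in> {\<tau> i<..\<tau> (Suc i)}" and y: "y \<in> {\<tau> j<..\<tau> (Suc j)}"
  shows "step_fun n \<tau> c (x, y) = c i j"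
proof -
  have "cell_ind \<tau> k w = (if k = a then 1 else 0)"
    if "k < n" "a < n" "w \<in> {\<tau> a<..\<tau> (Suc a)}" for k a w
    using cell_unique[OF g that(1,2) _ that(3)] that(3) by (cases "k = a") (auto simp: indicator_def)
  note * = this[OF _ ij(1) x] this[OF _ ij(2) y]
  have "step_fun n \<tau> c (x, y) = (\<Sum>k<n. \<Sum>l<n. if l = j then (if k = i then c k l else 0) else 0)"
    unfolding step_fun_def by (intro sum.cong refl) (simp add: *)
  then show ?thesis using ij by simp
qed

lemma step_fun_outside:
  assumes "(\<forall>i<n. x \<notin> {\<tau> i<..\<tau> (Suc i)}) \<or> (\<forall>j<n. y \<notin> {\<tau> j<..\<tau> (Suc j)})"
  shows "step_fun n \<tau> c (x, y) = 0"
  unfolding step_fun_def using assms by (auto intro!: sum.neutral)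

lemma step_fun_map2:
  assumes g: "is_grid n \<tau>" and "F 0 0 = 0"
  shows "step_fun n \<tau> (\<lambda>i j. F (c i j) (d i j)) z = F (step_fun n \<tau> c z) (step_fun n \<tau> d z)"
proof (cases "\<exists>i<n. \<exists>j<n. fst z \<in> {\<tau> i<..\<tau> (Suc i)} \<and> snd z \<in> {\<tau> j<..\<tau> (Suc j)}")
  case True
  then obtain i j where "i < n" "j < n" "fst z \<in> {\<tau> i<..\<tau> (Suc i)}" "snd z \<in> {\<tau> j<..\<tau> (Suc j)}" by auto
  from step_fun_cell[OF g this] show ?thesis by simp
next
  case False
  then have *: "(\<forall>i<n. fst z \<notin> {\<tau> i<..\<tau> (Suc i)}) \<or> (\<forall>j<n. snd z \<notin> {\<tau> j<..\<tau> (Suc j)})" by auto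
  from step_fun_outside[OF *] show ?thesis using assms(2) by simp
qed

lemma measurable_step_fun [measurable]: "step_fun n \<tau> c \<in> borel_measurable borel"
proof -
  have "(\<lambda>z. fst z :: real) \<in> borel_measurable (borel :: (real \<times> real) measure)"
       "(\<lambda>z. snd z :: real) \<in> borel_measurable (borel :: (real \<times> real) measure)"
    unfolding borel_prod[symmetric] by measurable
  note [measurable] = this
  show ?thesis unfolding step_fun_def [abs_def] by measurable
qed

lemma nn_integral_cell: "\<tau> i < \<tau> (Suc i) \<Longrightarrow> (\<integral>\<^sup>+x. ennreal (cell_ind \<tau> i x) \<partial>lborel) = ennreal (\<tau> (Suc i) - \<tau> i)"
  by (simp add: ennreal_indicator)

lemma nn_integral_step_fun:
  assumes g: "is_grid n \<tau>" and c: "\<And>i j. 0 \<le> c i j"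
  shows "(\<integral>\<^sup>+z. ennreal (step_fun n \<tau> c z) \<partial>lborel)
    = ennreal (\<Sum>i<n. \<Sum>j<n. c i j * (\<tau> (Suc i) - \<tau> i) * (\<tau> (Suc j) - \<tau> j))"
proof -
  let ?cvv = "\<lambda>i j. c i j * (\<tau> (Suc i) - \<tau> i) * (\<tau> (Suc j) - \<tau> j)"
  have e: "ennreal (step_fun n \<tau> c (x, y)) = (\<Sum>i<n. \<Sum>j<n. ennreal (c i j) * ennreal (cell_ind \<tau> i x) * ennreal (cell_ind \<tau> j y))" for x y
  proof -
    have "ennreal (c i j) * ennreal (cell_ind \<tau> i x) * ennreal (cell_ind \<tau> j y)
      = ennreal (c i j * cell_ind \<tau> i x * cell_ind \<tau> j y)" for i j
      using c[of i j] by (simp only: ennreal_mult mult_nonneg_nonneg indicator_pos_le)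
    then show ?thesis using c by (simp only: step_fun_def fst_conv snd_conv sum_ennreal
      sum_nonneg mult_nonneg_nonneg indicator_pos_le)
  qed
  have "(\<integral>\<^sup>+z. ennreal (step_fun n \<tau> c z) \<partial>lborel) = (\<integral>\<^sup>+z. ennreal (step_fun n \<tau> c z) \<partial>plane)"
    by (simp add: lborel_prod)
  also have "\<dots> = (\<integral>\<^sup>+x. \<integral>\<^sup>+y. ennreal (step_fun n \<tau> c (x, y)) \<partial>lborel \<partial>lborel)"
    by (rule lborel.nn_integral_fst[symmetric]) (simp add: lborel_prod)
  also have "\<dots> = (\<Sum>i<n. \<Sum>j<n. ennreal (c i j) * ennreal (\<tau> (Suc i) - \<tau> i) * ennreal (\<tau> (Suc j) - \<tau> j))"
    unfolding e using g by (simp add: nn_integral_sum nn_integral_cmult nn_integral_multc nn_integral_cell)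
  also have "\<dots> = ennreal (\<Sum>i<n. \<Sum>j<n. (?cvv i j))"
  proof -
    have "ennreal (c i j) * ennreal (\<tau> (Suc i) - \<tau> i) * ennreal (\<tau> (Suc j) - \<tau> j)
      = ennreal (?cvv i j)" if "i < n" "j < n" for i j
      using c[of i j] g that by (simp add: ennreal_mult less_imp_le)
    moreover have nn: "0 \<le> (?cvv i j)" if "i < n" "j < n" for i j
      using c[of i j] g that by (simp add: less_imp_le)
    ultimately have "?thesis \<longleftrightarrow> (\<Sum>i<n. \<Sum>j<n. ennreal (?cvv i j))
      = ennreal (\<Sum>i<n. \<Sum>j<n. (?cvv i j))"
      by (intro arg_cong2[where f = "(=)"] sum.cong refl) auto
    moreover have "(\<Sum>i<n. \<Sum>j<n. ennreal (?cvv i j))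
       = (\<Sum>i<n. ennreal (\<Sum>j<n. (?cvv i j)))"
      by (intro sum.cong refl sum_ennreal nn) auto
    moreover have "\<dots> = ennreal (\<Sum>i<n. \<Sum>j<n. (?cvv i j))"
      by (rule sum_ennreal) (auto intro!: sum_nonneg nn)
    ultimately show ?thesis by simp
  qed
  finally show ?thesis .
qed

text \<open>
  The cells of the grid p inside (p a, p b] are those whose right end lies in this interval.
\<close>

lemma telescope_cells:
  fixes p :: "nat \<Rightarrow> real" and U :: "real \<Rightarrow> real"
  assumes g: "is_grid N p" and ab: "a \<le> b" "b \<le> N"
  shows "U (p b) - U (p a) = (\<Sum>l<N. indicator {p a<..p b} (p (Suc l)) * (U (p (Suc l)) - U (p l)))"
proof -
  have ind: "p (Suc l) \<in> {p a<..p b} \<longleftrightarrow> l \<in> {a..<b}" if "l < N" for l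
  proof
    assume *: "p (Suc l) \<in> {p a<..p b}"
    show "l \<in> {a..<b}"
    proof (rule ccontr)
      assume "l \<notin> {a..<b}"
      then have "Suc l \<le> a \<or> b < Suc l" by auto
      then show False
        using grid_le[OF g, of "Suc l" a] grid_less[OF g, of b "Suc l"] ab that * by auto
    qed
  next
    assume "l \<in> {a..<b}"
    then show "p (Suc l) \<in> {p a<..p b}"
      using grid_less[OF g, of a "Suc l"] grid_le[OF g, of "Suc l" b] ab by auto
  qed
  have "(\<Sum>l<N. indicator {p a<..p b} (p (Suc l)) * (U (p (Suc l)) - U (p l)))
     = (\<Sum>l<N. if l \<in> {a..<b} then U (p (Suc l)) - U (p l) else 0)"
    using ind by (intro sum.cong refl) (auto simp: indicator_def)
  also have "\<dots> = (\<Sum>l\<in>{a..<b}. U (p (Suc l)) - U (p l))"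
    using ab by (subst sum.If_cases) (auto intro!: sum.cong)
  also have "\<dots> = U (p b) - U (p a)" by (rule sum_Suc_diff'[OF ab(1), of "\<lambda>l. U (p l)"])
  finally show ?thesis by simp
qed

lemma sum_swap_pairs:
  "(\<Sum>i\<in>A. \<Sum>j\<in>B. \<Sum>k\<in>C. \<Sum>l\<in>D. f i j k l) = (\<Sum>k\<in>C. \<Sum>l\<in>D. \<Sum>i\<in>A. \<Sum>j\<in>B. f i j k l)"
  (is "?L = _")
proof -
  have "?L = (\<Sum>i\<in>A. \<Sum>k\<in>C. \<Sum>j\<in>B. \<Sum>l\<in>D. f i j k l)"
    by (rule sum.cong[OF refl], rule sum.swap)
  also have "\<dots> = (\<Sum>k\<in>C. \<Sum>i\<in>A. \<Sum>j\<in>B. \<Sum>l\<in>D. f i j k l)"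
    by (rule sum.swap)
  also have "\<dots> = (\<Sum>k\<in>C. \<Sum>i\<in>A. \<Sum>l\<in>D. \<Sum>j\<in>B. f i j k l)"
    by (rule sum.cong[OF refl], rule sum.cong[OF refl], rule sum.swap)
  also have "\<dots> = (\<Sum>k\<in>C. \<Sum>l\<in>D. \<Sum>i\<in>A. \<Sum>j\<in>B. f i j k l)"
    by (rule sum.cong[OF refl], rule sum.swap)
  finally show ?thesis .
qed

text \<open>
  A common form for a step function and its integral: with U and V the Brownian path it is the
  integral, and with U and V the indicator functions of [x, \<infinity>) and [y, \<infinity>) it is the value at (x, y). One
  refinement lemma therefore serves both.
\<close>

definition bilinear_step :: "nat \<Rightarrow> (nat \<Rightarrow> real) \<Rightarrow> (nat \<Rightarrow> nat \<Rightarrow> real) \<Rightarrow> (real \<Rightarrow> real) \<Rightarrow> (real \<Rightarrow> real) \<Rightarrow> real" where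
  "bilinear_step n \<tau> c U V = (\<Sum>i<n. \<Sum>j<n. c i j * (U (\<tau> (Suc i)) - U (\<tau> i)) * (V (\<tau> (Suc j)) - V (\<tau> j)))"

lemma step_integral_bilinear: "step_integral B n \<tau> c \<omega> = bilinear_step n \<tau> c (\<lambda>t. B t \<omega>) (\<lambda>t. B t \<omega>)"
  by (simp add: step_integral_def bilinear_step_def)

lemma step_fun_bilinear:
  assumes "is_grid n \<tau>"
  shows "step_fun n \<tau> c z = bilinear_step n \<tau> c (\<lambda>t. indicator {fst z..} t) (\<lambda>t. indicator {snd z..} t)"
proof -
  have *: "cell_ind \<tau> i x = indicator {x..} (\<tau> (Suc i)) - indicator {x..} (\<tau> i)" if "i < n" for i x
    using assms[rule_format, OF that] by (auto simp: indicator_def)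
  show ?thesis unfolding step_fun_def bilinear_step_def
    by (intro sum.cong refl) (simp add: *)
qed

text \<open>
  Cells are closed on the right, so on a finer cell a step function has the value of its upper
  right corner.
\<close>

lemma bilinear_step_refine:
  assumes g: "is_grid n \<tau>" and p: "is_grid N p"
    and sub: "\<tau> ` {..n} \<subseteq> p ` {..N}"
  shows "bilinear_step n \<tau> c U V = bilinear_step N p (\<lambda>k l. step_fun n \<tau> c (p (Suc k), p (Suc l))) U V"
proof -
  let ?t = "\<lambda>i j k l. c i j * cell_ind \<tau> i (p (Suc k)) * cell_ind \<tau> j (p (Suc l))
      * (U (p (Suc k)) - U (p k)) * (V (p (Suc l)) - V (p l))"
  have tel: "W (\<tau> (Suc i)) - W (\<tau> i) = (\<Sum>l<N. cell_ind \<tau> i (p (Suc l)) * (W (p (Suc l)) - W (p l)))"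
    if i: "i < n" for i and W :: "real \<Rightarrow> real"
  proof -
    have "\<tau> i \<in> p ` {..N}" "\<tau> (Suc i) \<in> p ` {..N}" using sub i by auto
    then obtain a b where ab: "\<tau> i = p a" "\<tau> (Suc i) = p b" "a \<le> N" "b \<le> N" by auto
    have "p a < p b" using g i ab by auto
    then have "a \<le> b" using grid_le[OF p, of b a] ab by (metis leI less_imp_le_nat not_less)
    from telescope_cells[OF p this ab(4), of W] ab show ?thesis by simp
  qed
  have "bilinear_step n \<tau> c U V = (\<Sum>i<n. \<Sum>j<n. \<Sum>k<N. \<Sum>l<N. (?t i j k l))"
    unfolding bilinear_step_def
  proof (intro sum.cong refl)
    fix i j assume "i \<in> {..<n}" "j \<in> {..<n}"
    then have ij: "i < n" "j < n" by auto
    show "c i j * (U (\<tau> (Suc i)) - U (\<tau> i)) * (V (\<tau> (Suc j)) - V (\<tau> j))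
      = (\<Sum>k<N. \<Sum>l<N. c i j * cell_ind \<tau> i (p (Suc k)) * cell_ind \<tau> j (p (Suc l))
          * (U (p (Suc k)) - U (p k)) * (V (p (Suc l)) - V (p l)))"
      unfolding tel[OF ij(1)] tel[OF ij(2)] mult.assoc[of "c i j"] sum_product
      by (subst sum_distrib_left, intro sum.cong refl, subst sum_distrib_left) (simp only: mult_ac)
  qed
  also have "\<dots> = (\<Sum>k<N. \<Sum>l<N. \<Sum>i<n. \<Sum>j<n. (?t i j k l))"
    by (rule sum_swap_pairs)
  also have "\<dots> = bilinear_step N p (\<lambda>k l. step_fun n \<tau> c (p (Suc k), p (Suc l))) U V"
    unfolding bilinear_step_def step_fun_def
    by (simp only: sum_distrib_right fst_conv snd_conv)
  finally show ?thesis .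
qed

lemma bilinear_step_diff:
  "bilinear_step n \<tau> (\<lambda>i j. c i j - d i j) U V = bilinear_step n \<tau> c U V - bilinear_step n \<tau> d U V"
  by (simp add: bilinear_step_def left_diff_distrib sum_subtractf)

lemma step_fun_diagonal: "offdiag_step n \<tau> c \<Longrightarrow> step_fun n \<tau> c (x, x) = 0"
proof (cases "\<exists>i<n. x \<in> {\<tau> i<..\<tau> (Suc i)}")
  case True
  assume o: "offdiag_step n \<tau> c"
  from True obtain i where "i < n" "x \<in> {\<tau> i<..\<tau> (Suc i)}" by auto
  then show ?thesis using step_fun_cell[of n \<tau> i i x x c] o by (auto simp: offdiag_step_def)
qed (use step_fun_outside in auto)

lemma common_grid:
  fixes P :: "real set"
  assumes "finite P" "P \<noteq> {}"
  obtains N p where "is_grid N p" "p ` {..N} = P"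
proof -
  define L where "L = sorted_list_of_set P"
  have L: "sorted_wrt (<) L" "set L = P" "L \<noteq> []"
    using assms by (auto simp: L_def)
  show ?thesis
  proof (rule that[of "length L - 1" "\<lambda>i. L ! i"])
    show "\<forall>i<length L - 1. L ! i < L ! Suc i"
      using L(1) by (auto simp: sorted_wrt_iff_nth_less)
    have "{..length L - 1} = {..<length L}" using L(3) by (cases L) (simp_all add: lessThan_Suc_atMost)
    moreover have "(!) L ` {..<length L} = set L"
      by (simp add: set_conv_nth image_def lessThan_def) blast
    ultimately show "(!) L ` {..length L - 1} = P" using L(2) by simp
  qed
qed

text \<open>
  Linearity of the integral, for two step functions on unrelated grids. On the common
  refinement the coefficients of diagonal cells are values on the diagonal, hence 0.
\<close>

lemma offdiag_step_diff:
  assumes o: "offdiag_step n \<tau> c" "offdiag_step n' \<tau>' c'"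
  obtains N p d where "offdiag_step N p d"
    "\<And>z. step_fun N p d z = step_fun n \<tau> c z - step_fun n' \<tau>' c' z"
    "\<And>B :: real \<Rightarrow> 'a \<Rightarrow> real. \<And>\<omega>. step_integral B N p d \<omega> = step_integral B n \<tau> c \<omega> - step_integral B n' \<tau>' c' \<omega>"
proof -
  have g: "is_grid n \<tau>" "is_grid n' \<tau>'" using o by (auto simp: offdiag_step_def)
  obtain N p where p: "is_grid N p" and P: "p ` {..N} = \<tau> ` {..n} \<union> \<tau>' ` {..n'}"
    by (rule common_grid[of "\<tau> ` {..n} \<union> \<tau>' ` {..n'}"]) auto
  have s: "\<tau> ` {..n} \<subseteq> p ` {..N}" "\<tau>' ` {..n'} \<subseteq> p ` {..N}" using P by auto
  define d where "d k l = step_fun n \<tau> c (p (Suc k), p (Suc l)) - step_fun n' \<tau>' c' (p (Suc k), p (Suc l))" for k l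
  have "bilinear_step N p d U V = bilinear_step n \<tau> c U V - bilinear_step n' \<tau>' c' U V" for U V
    unfolding bilinear_step_refine[OF g(1) p s(1)] bilinear_step_refine[OF g(2) p s(2)] d_def
    by (rule bilinear_step_diff)
  moreover have "offdiag_step N p d"
    using p o by (auto simp: offdiag_step_def[of N] d_def step_fun_diagonal)
  ultimately show ?thesis
    using that[of N p d] by (simp add: step_fun_bilinear g p step_integral_bilinear)
qed

section \<open>The isometry for step functions\<close>

definition sym_coeff :: "(nat \<Rightarrow> nat \<Rightarrow> real) \<Rightarrow> nat \<Rightarrow> nat \<Rightarrow> real" where
  "sym_coeff c i j = (c i j + c j i) / 2"

lemma sym_coeff_commute: "sym_coeff c i j = sym_coeff c j i"
  by (simp add: sym_coeff_def)

context two_sided_brownian_motion begin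

abbreviation increments :: "(nat \<Rightarrow> real) \<Rightarrow> nat \<Rightarrow> 'a \<Rightarrow> real" where
  "increments \<tau> \<equiv> \<lambda>i \<omega>. B (\<tau> (Suc i)) \<omega> - B (\<tau> i) \<omega>"

lemma gaussian_family_increments:
  assumes "is_grid n \<tau>"
  shows "gaussian_family M {..<n} (increments \<tau>) (mesh \<tau>)"
  using assms increments_indep[of n \<tau>] increments_normal by unfold_locales auto

lemma step_integral_quad_form:
  assumes o: "offdiag_step n \<tau> c"
  shows "step_integral B n \<tau> c \<omega> = gaussian_family.quad_form {..<n} (increments \<tau>)
     (mesh \<tau>) (sym_coeff c) \<omega>"
proof -
  interpret gaussian_family M "{..<n}" "increments \<tau>" "mesh \<tau>"
    using o by (intro gaussian_family_increments) (simp add: offdiag_step_def)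
  let ?D = "\<lambda>i. B (\<tau> (Suc i)) \<omega> - B (\<tau> i) \<omega>"
  have "(\<Sum>i<n. \<Sum>j<n. c j i * (?D i * ?D j)) = (\<Sum>i<n. \<Sum>j<n. c i j * (?D i * ?D j))"
    by (subst sum.swap) (simp add: mult.commute)
  then have "(\<Sum>i<n. \<Sum>j<n. sym_coeff c i j * (?D i * ?D j)) = (\<Sum>i<n. \<Sum>j<n. c i j * (?D i * ?D j))"
    by (simp add: sym_coeff_def add_divide_distrib distrib_right sum.distrib flip: sum_divide_distrib)
  then show ?thesis
    using o by (simp add: quad_form_def step_integral_def offdiag_step_def sym_coeff_def mult.assoc)
qed

lemma measurable_step_integral [measurable]: "step_integral B n \<tau> c \<in> borel_measurable M"
  unfolding step_integral_def [abs_def] using measurable_B by measurable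

text \<open>
  The second moment of a form is twice the squared norm of its symmetrized coefficients, and
  symmetrizing does not increase the norm.
\<close>

lemma step_integral_bound:
  assumes o: "offdiag_step n \<tau> c"
  shows "(\<integral>\<^sup>+\<omega>. ennreal ((step_integral B n \<tau> c \<omega>)\<^sup>2) \<partial>M) \<le> 2 * (\<integral>\<^sup>+z. ennreal ((step_fun n \<tau> c z)\<^sup>2) \<partial>lborel)"
proof -
  let ?v = "mesh \<tau>"
  have g: "is_grid n \<tau>" using o by (auto simp: offdiag_step_def)
  interpret gaussian_family M "{..<n}" "increments \<tau>" ?v
    by (rule gaussian_family_increments[OF g])
  let ?Q = "quad_form (sym_coeff c)"
  have "(\<integral>\<^sup>+\<omega>. ennreal ((step_integral B n \<tau> c \<omega>)\<^sup>2) \<partial>M) = ennreal (expectation (\<lambda>\<omega>. ?Q \<omega> ^ 2))"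
    unfolding step_integral_quad_form[OF o]
    using integrable_quad_form_power[of "sym_coeff c" 2, OF sym_coeff_commute]
    by (intro nn_integral_eq_integral) auto
  also have "expectation (\<lambda>\<omega>. ?Q \<omega> ^ 2) = 2 * trace_power {..<n} ?v (sym_coeff c) 2"
    using moments_quad_form[of "sym_coeff c" 2, OF sym_coeff_commute]
    by (simp add: quad_coeff.simps(2) numeral_2_eq_2)
  also have "trace_power {..<n} ?v (sym_coeff c) 2 \<le> (\<Sum>i<n. \<Sum>j<n. (c i j)\<^sup>2 * ?v i * ?v j)"
  proof -
    have "trace_power {..<n} ?v (sym_coeff c) 2 = (\<Sum>i<n. \<Sum>j<n. ?v i * ?v j * (sym_coeff c i j)\<^sup>2)"
      by (simp add: trace_power_def power2_eq_square mult_ac)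
    also have "\<dots> \<le> (\<Sum>i<n. \<Sum>j<n. ?v i * ?v j * (((c i j)\<^sup>2 + (c j i)\<^sup>2) / 2))"
    proof (intro sum_mono mult_left_mono)
      fix i j
      have "0 \<le> (c i j - c j i)\<^sup>2" by simp
      then show "(sym_coeff c i j)\<^sup>2 \<le> ((c i j)\<^sup>2 + (c j i)\<^sup>2) / 2"
        by (simp add: sym_coeff_def power2_eq_square field_simps)
    qed (use g in \<open>auto simp: less_imp_le\<close>)
    also have "\<dots> = ((\<Sum>i<n. \<Sum>j<n. ?v i * ?v j * (c i j)\<^sup>2) + (\<Sum>i<n. \<Sum>j<n. ?v i * ?v j * (c j i)\<^sup>2)) / 2"
      by (simp add: sum.distrib distrib_left add_divide_distrib sum_divide_distrib)
    also have "(\<Sum>i<n. \<Sum>j<n. ?v i * ?v j * (c j i)\<^sup>2) = (\<Sum>i<n. \<Sum>j<n. ?v i * ?v j * (c i j)\<^sup>2)"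
      by (subst sum.swap) (simp add: mult_ac)
    finally show ?thesis by (simp add: mult_ac)
  qed
  also have "ennreal (2 * (\<Sum>i<n. \<Sum>j<n. (c i j)\<^sup>2 * ?v i * ?v j)) = 2 * (\<integral>\<^sup>+z. ennreal ((step_fun n \<tau> c z)\<^sup>2) \<partial>lborel)"
    using nn_integral_step_fun[OF g, of "\<lambda>i j. (c i j)\<^sup>2"] step_fun_map2[OF g, of "\<lambda>x y. x\<^sup>2" c c]
    by (simp add: ennreal_mult')
  finally show ?thesis by (simp add: ennreal_leI)
qed

end

section \<open>The double integral as a limit\<close>

lemma L2_triangle:
  fixes u v w :: "'a \<Rightarrow> real"
  assumes [measurable]: "u \<in> borel_measurable M" "v \<in> borel_measurable M" "w \<in> borel_measurable M"
  shows "L2_sq M u w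
     \<le> 2 * L2_sq M u v + 2 * L2_sq M v w"
proof -
  have "(u x - w x)\<^sup>2 \<le> 2 * (u x - v x)\<^sup>2 + 2 * (v x - w x)\<^sup>2" for x
  proof -
    have "0 \<le> ((u x - v x) - (v x - w x))\<^sup>2" by simp
    then show ?thesis by (simp add: power2_eq_square algebra_simps)
  qed
  then have "ennreal ((u x - w x)\<^sup>2) \<le> 2 * ennreal ((u x - v x)\<^sup>2) + 2 * ennreal ((v x - w x)\<^sup>2)" for x
    using ennreal_leI[of "(u x - w x)\<^sup>2" "2 * (u x - v x)\<^sup>2 + 2 * (v x - w x)\<^sup>2"]
    by (simp add: ennreal_plus ennreal_mult)
  then have "L2_sq M u w
     \<le> (\<integral>\<^sup>+x. 2 * ennreal ((u x - v x)\<^sup>2) + 2 * ennreal ((v x - w x)\<^sup>2) \<partial>M)"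
    by (intro nn_integral_mono)
  then show ?thesis by (simp add: nn_integral_add nn_integral_cmult)
qed

lemma ennreal_power2_le_imp_le: "x\<^sup>2 \<le> y\<^sup>2 \<Longrightarrow> x \<le> (y :: ennreal)"
  by (cases x; cases y) (auto simp: ennreal_power top_unique abs_le_square_iff[symmetric])

text \<open>
  A subsequence with increments of mean at most 2^(-j) converges almost surely, and by Fatou's lemma its
  limit is also the limit in mean square of the whole sequence.
\<close>

lemma (in prob_space) L2_complete:
  fixes X :: "nat \<Rightarrow> 'a \<Rightarrow> real"
  assumes [measurable]: "\<And>k. X k \<in> borel_measurable M"
    and cauchy: "\<And>e :: real. 0 < e \<Longrightarrow> \<exists>N. \<forall>m\<ge>N. \<forall>n\<ge>N. L2_sq M (X m) (X n) \<le> ennreal e"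
  obtains Y where "Y \<in> borel_measurable M" "(\<lambda>k. L2_sq M Y (X k)) \<longlonglongrightarrow> 0"
proof -
  obtain N where N: "\<And>j m n. N j \<le> m \<Longrightarrow> N j \<le> n \<Longrightarrow>
      L2_sq M (X m) (X n) \<le> ennreal ((1 / 4) ^ j)"
    using cauchy[of "(1 / 4) ^ j" for j] by (simp add: choice_iff') metis
  \<comment> \<open>Partial sums make the chosen indices increasing.\<close>
  define r where "r j = (\<Sum>i\<le>j. Suc (N i))" for j
  have r: "N j \<le> r j" "r j \<le> r (Suc j)" "j \<le> r j" for j
    by (induction j) (auto simp: r_def)
  define D where "D j \<omega> = X (r (Suc j)) \<omega> - X (r j) \<omega>" for j \<omega>
  have [measurable]: "D j \<in> borel_measurable M" for j unfolding D_def [abs_def] by measurable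
  have D: "(\<integral>\<^sup>+\<omega>. ennreal \<bar>D j \<omega>\<bar> \<partial>M) \<le> ennreal ((1 / 2) ^ j)" for j
  proof -
    have "(\<integral>\<^sup>+\<omega>. ennreal \<bar>D j \<omega>\<bar> * 1 \<partial>M)\<^sup>2 \<le> (\<integral>\<^sup>+\<omega>. ennreal \<bar>D j \<omega>\<bar> ^ 2 \<partial>M) * (\<integral>\<^sup>+\<omega>. 1 ^ 2 \<partial>M)"
      by (intro Cauchy_Schwarz_nn_integral) measurable
    also have "\<dots> = (\<integral>\<^sup>+\<omega>. ennreal ((D j \<omega>)\<^sup>2) \<partial>M)"
      by (simp add: emeasure_space_1 ennreal_power)
    also have "\<dots> \<le> ennreal ((1 / 4) ^ j)"
      unfolding D_def using r[of j] r[of "Suc j"] by (intro N) auto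
    also have "\<dots> = ennreal ((1 / 2) ^ j) ^ 2"
    proof -
      have "((1 / 2) ^ j)\<^sup>2 = (1 / 4 :: real) ^ j"
        by (simp add: power2_eq_square flip: power_mult_distrib)
      then show ?thesis by (simp add: ennreal_power)
    qed
    finally show ?thesis by (simp add: ennreal_power2_le_imp_le)
  qed
  have "(\<integral>\<^sup>+\<omega>. (\<Sum>j. ennreal \<bar>D j \<omega>\<bar>) \<partial>M) = (\<Sum>j. \<integral>\<^sup>+\<omega>. ennreal \<bar>D j \<omega>\<bar> \<partial>M)"
    by (intro nn_integral_suminf) measurable
  also have "\<dots> \<le> (\<Sum>j. ennreal ((1 / 2) ^ j))"
    by (intro suminf_le D) auto
  also have "\<dots> = ennreal (\<Sum>j. (1 / 2) ^ j)"
    by (intro suminf_ennreal2) (auto intro: summable_geometric)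
  finally have "(\<integral>\<^sup>+\<omega>. (\<Sum>j. ennreal \<bar>D j \<omega>\<bar>) \<partial>M) < \<infinity>"
    by (rule le_less_trans) simp
  then have "AE \<omega> in M. (\<Sum>j. ennreal \<bar>D j \<omega>\<bar>) \<noteq> \<infinity>"
    by (intro nn_integral_PInf_AE) auto
  then have conv: "AE \<omega> in M. convergent (\<lambda>j. X (r j) \<omega>)"
  proof eventually_elim
    case (elim \<omega>)
    then have "summable (\<lambda>j. \<bar>D j \<omega>\<bar>)" by (intro summable_suminf_not_top) auto
    then have "summable (\<lambda>j. D j \<omega>)" by (rule summable_rabs_cancel)
    then have "convergent (\<lambda>n. \<Sum>j<n. D j \<omega>)" by (simp add: summable_iff_convergent)
    then have "convergent (\<lambda>n. (\<Sum>j<n. X (r (Suc j)) \<omega> - X (r j) \<omega>) + X (r 0) \<omega>)"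
      unfolding D_def by (intro convergent_add convergent_const)
    then show ?case by (simp add: sum_lessThan_telescope[of "\<lambda>j. X (r j) \<omega>"])
  qed
  define Y where "Y \<omega> = lim (\<lambda>j. X (r j) \<omega>)" for \<omega>
  have [measurable]: "Y \<in> borel_measurable M" unfolding Y_def [abs_def] by measurable
  have Y: "AE \<omega> in M. (\<lambda>j. X (r j) \<omega>) \<longlonglongrightarrow> Y \<omega>"
    using conv by eventually_elim (simp add: Y_def convergent_LIMSEQ_iff)
  have "(\<lambda>k. L2_sq M Y (X k)) \<longlonglongrightarrow> 0"
  proof (rule tendsto_0_if_Limsup_eq_0_ennreal, rule antisym)
    show "limsup (\<lambda>k. L2_sq M Y (X k)) \<le> 0"
    proof (rule ennreal_le_epsilon)
      fix e :: real assume e: "0 < e"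
      obtain K where K: "\<And>m n. K \<le> m \<Longrightarrow> K \<le> n \<Longrightarrow> L2_sq M (X m) (X n) \<le> ennreal e"
        using cauchy[OF e] by auto
      have "L2_sq M Y (X k) \<le> ennreal e" if k: "K \<le> k" for k
      proof -
        have "L2_sq M Y (X k)
           = (\<integral>\<^sup>+\<omega>. liminf (\<lambda>j. ennreal ((X (r j) \<omega> - X k \<omega>)\<^sup>2)) \<partial>M)"
        proof (rule nn_integral_cong_AE, use Y in eventually_elim)
          case (elim \<omega>)
          then have "(\<lambda>j. ennreal ((X (r j) \<omega> - X k \<omega>)\<^sup>2)) \<longlonglongrightarrow> ennreal ((Y \<omega> - X k \<omega>)\<^sup>2)"
            by (intro tendsto_intros)
          then show ?case by (rule lim_imp_Liminf[OF sequentially_bot, symmetric])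
        qed
        also have "\<dots> \<le> liminf (\<lambda>j. L2_sq M (X (r j)) (X k))"
          by (intro nn_integral_liminf) measurable
        also have "\<dots> \<le> ennreal e"
        proof (rule Liminf_le)
          show "eventually (\<lambda>j. L2_sq M (X (r j)) (X k) \<le> ennreal e) sequentially"
            using eventually_ge_at_top[of K]
            by eventually_elim (use r(3) k in \<open>auto intro!: K intro: order.trans\<close>)
        qed simp
        finally show ?thesis .
      qed
      then have "limsup (\<lambda>k. L2_sq M Y (X k)) \<le> ennreal e"
        by (intro Limsup_bounded) (auto simp: eventually_sequentially)
      then show "limsup (\<lambda>k. L2_sq M Y (X k)) \<le> 0 + ennreal e" by simp
    qed
  qed simp
  then show ?thesis by (rule that[rotated]) measurable
qed

context two_sided_brownian_motion begin

lemma step_integral_diff_bound: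
  assumes "offdiag_step n \<tau> c" "offdiag_step n' \<tau>' c'"
  shows "L2_sq M (step_integral B n \<tau> c) (step_integral B n' \<tau>' c')
     \<le> 2 * L2_sq lborel (step_fun n \<tau> c) (step_fun n' \<tau>' c')"
proof -
  obtain N p d where d: "offdiag_step N p d"
    "\<And>z. step_fun N p d z = step_fun n \<tau> c z - step_fun n' \<tau>' c' z"
    "\<And>\<omega>. step_integral B N p d \<omega> = step_integral B n \<tau> c \<omega> - step_integral B n' \<tau>' c' \<omega>"
    using offdiag_step_diff[OF assms] by metis
  show ?thesis using step_integral_bound[OF d(1)] by (simp add: d)
qed

lemma has_double_wiener_integral_exists:
  assumes f: "f \<in> borel_measurable borel"
    and o: "\<And>k. offdiag_step (n k) (\<tau> k) (c k)"
    and lim: "(\<lambda>k. L2_sq lborel f (step_fun (n k) (\<tau> k) (c k))) \<longlonglongrightarrow> 0"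
  obtains X where "has_double_wiener_integral M B f X"
proof -
  let ?F = "\<lambda>k. step_fun (n k) (\<tau> k) (c k)" and ?I = "\<lambda>k. step_integral B (n k) (\<tau> k) (c k)"
  define d where "d k = L2_sq lborel f (?F k)" for k
  note [measurable] = f
  have cauchy: "\<exists>N. \<forall>m\<ge>N. \<forall>n\<ge>N. L2_sq M (?I m) (?I n) \<le> ennreal e" if e: "0 < e" for e :: real
  proof -
    have "eventually (\<lambda>k. d k < ennreal (e / 8)) sequentially"
      using lim e unfolding d_def by (intro order_tendstoD(2)) auto
    then obtain N where N: "\<And>k. N \<le> k \<Longrightarrow> d k \<le> ennreal (e / 8)"
      by (auto simp: eventually_sequentially intro: less_imp_le)
    have "L2_sq M (?I m) (?I k) \<le> ennreal e" if "N \<le> m" "N \<le> k" for m k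
    proof -
      have "L2_sq lborel (?F m) (?F k)
         \<le> 2 * L2_sq lborel (?F m) f + 2 * L2_sq lborel f (?F k)"
        by (intro L2_triangle) measurable
      also have "\<dots> = 2 * d m + 2 * d k" by (simp add: d_def power2_commute[of "f _" "?F m _"])
      also have "\<dots> \<le> 2 * ennreal (e / 8) + 2 * ennreal (e / 8)"
        using N that by (intro add_mono mult_left_mono) auto
      finally have "2 * L2_sq lborel (?F m) (?F k) \<le> 2 * (2 * ennreal (e / 8) + 2 * ennreal (e / 8))"
        by (rule mult_left_mono) simp
      also have "\<dots> = ennreal e"
        using e by (simp flip: ennreal_numeral ennreal_mult' ennreal_plus)
      finally show ?thesis
        using step_integral_diff_bound[OF o o, of m k] by (rule order.trans[rotated])
    qed
    then show ?thesis by blast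
  qed
  obtain X where X: "X \<in> borel_measurable M" "(\<lambda>k. L2_sq M X (?I k)) \<longlonglongrightarrow> 0"
    by (rule L2_complete[of ?I, OF measurable_step_integral cauchy])
  show ?thesis
  proof (rule that)
    show "has_double_wiener_integral M B f X"
      unfolding has_double_wiener_integral_def
      by (intro conjI exI[of _ n] exI[of _ \<tau>] exI[of _ c] allI f o lim X)
  qed
qed

text \<open>
  A version of the integral comes with some approximating sequence; by the isometry every other sequence of
  step functions that approximates the same kernel leads to the same limit.
\<close>

lemma has_double_wiener_integral_tendsto:
  assumes D: "has_double_wiener_integral M B f D"
    and o: "\<And>k. offdiag_step (n k) (\<tau> k) (c k)"
    and lim: "(\<lambda>k. L2_sq lborel f (step_fun (n k) (\<tau> k) (c k))) \<longlonglongrightarrow> 0"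
  shows "(\<lambda>k. L2_sq M D (step_integral B (n k) (\<tau> k) (c k))) \<longlonglongrightarrow> 0"
proof -
  have [measurable]: "f \<in> borel_measurable borel" "D \<in> borel_measurable M"
    using D by (auto simp: has_double_wiener_integral_def)
  obtain n' \<tau>' c' where o': "\<And>k. offdiag_step (n' k) (\<tau>' k) (c' k)" and
    F': "(\<lambda>k. L2_sq lborel f (step_fun (n' k) (\<tau>' k) (c' k))) \<longlonglongrightarrow> 0" and
    I': "(\<lambda>k. L2_sq M D (step_integral B (n' k) (\<tau>' k) (c' k))) \<longlonglongrightarrow> 0"
    using D by (auto simp: has_double_wiener_integral_def)
  let ?F = "\<lambda>k. step_fun (n k) (\<tau> k) (c k)" and ?I = "\<lambda>k. step_integral B (n k) (\<tau> k) (c k)"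
  let ?F' = "\<lambda>k. step_fun (n' k) (\<tau>' k) (c' k)" and ?I' = "\<lambda>k. step_integral B (n' k) (\<tau>' k) (c' k)"
  let ?u = "\<lambda>k. 2 * L2_sq M D (?I' k) + 2 * (2 * (2 * L2_sq lborel f (?F' k) + 2 * L2_sq lborel f (?F k)))"
  have bd: "L2_sq M D (?I k) \<le> ?u k" for k
  proof -
    have "L2_sq M D (?I k) \<le> 2 * L2_sq M D (?I' k) + 2 * L2_sq M (?I' k) (?I k)"
      by (intro L2_triangle) measurable
    also have "L2_sq M (?I' k) (?I k) \<le> 2 * L2_sq lborel (?F' k) (?F k)"
      by (rule step_integral_diff_bound[OF o' o])
    also have "L2_sq lborel (?F' k) (?F k) \<le> 2 * L2_sq lborel (?F' k) f + 2 * L2_sq lborel f (?F k)"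
      by (intro L2_triangle) measurable
    also have "L2_sq lborel (?F' k) f = L2_sq lborel f (?F' k)"
      by (simp add: power2_commute[of "f _" "?F' k _"])
    finally show ?thesis by (simp add: mult_left_mono add_left_mono)
  qed
  have "?u \<longlonglongrightarrow> 2 * 0 + 2 * (2 * (2 * 0 + 2 * 0))"
    by (intro tendsto_add ennreal_tendsto_cmult lim F' I') auto
  then have "?u \<longlonglongrightarrow> 0" by simp
  from tendsto_sandwich[OF _ _ tendsto_const this] show ?thesis
    using bd by (simp add: always_eventually)
qed

theorem chaos_law_double_wiener_integral:
  fixes n :: "nat \<Rightarrow> nat"
  defines "T \<equiv> \<lambda>k \<tau> c. trace_power {..<n k} (mesh (\<tau> k)) (sym_coeff (c k))"
  assumes f: "f \<in> borel_measurable borel"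
    and o: "\<And>k. offdiag_step (n k) (\<tau> k) (c k)"
    and lim: "(\<lambda>k. L2_sq lborel f (step_fun (n k) (\<tau> k) (c k))) \<longlonglongrightarrow> 0"
    and h: "0 < h" "\<And>k j. 2 \<le> j \<Longrightarrow> \<bar>T k \<tau> c j\<bar> \<le> h ^ j"
    and t: "\<And>j. 2 \<le> j \<Longrightarrow> (\<lambda>k. T k \<tau> c j) \<longlonglongrightarrow> t j"
  shows "chaos_law M (double_wiener_integral M B f) t"
    and "double_wiener_integral M B f \<in> borel_measurable M"
proof -
  let ?I = "\<lambda>k. step_integral B (n k) (\<tau> k) (c k)"
  let ?X = "double_wiener_integral M B f"
  obtain X where X: "has_double_wiener_integral M B f X"
    by (rule has_double_wiener_integral_exists[OF f o lim])
  have D: "has_double_wiener_integral M B f ?X"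
    unfolding double_wiener_integral_def by (rule someI[of "has_double_wiener_integral M B f"]) (rule X)
  then show m: "double_wiener_integral M B f \<in> borel_measurable M"
    by (simp add: has_double_wiener_integral_def)
  have "char (distr M borel ?X) s = eval_fps (moment_fps t) (\<i> * of_real s)" if s: "\<bar>s\<bar> < 1 / (2 * h)" for s
  proof -
    have "char (distr M borel (?I k)) s = eval_fps (moment_fps (T k \<tau> c)) (\<i> * of_real s)" for k
    proof -
      have g: "is_grid (n k) (\<tau> k)" using o[of k] by (auto simp: offdiag_step_def)
      interpret gaussian_family M "{..<n k}" "increments (\<tau> k)" "mesh (\<tau> k)"
        by (rule gaussian_family_increments[OF g])
      have "?I k = quad_form (sym_coeff (c k))" using step_integral_quad_form[OF o] by (rule ext)
      then show ?thesis
        using char_quad_form[of "sym_coeff (c k)" h s, OF sym_coeff_commute] h s by (simp add: T_def)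
    qed
    moreover have "(\<lambda>k. char (distr M borel (?I k)) s) \<longlonglongrightarrow> char (distr M borel ?X) s"
      using m measurable_step_integral has_double_wiener_integral_tendsto[OF D o lim] by (rule tendsto_char_of_L2)
    moreover have "(\<lambda>k. eval_fps (moment_fps (T k \<tau> c)) (\<i> * of_real s)) \<longlonglongrightarrow> eval_fps (moment_fps t) (\<i> * of_real s)"
      using s h by (intro tendsto_eval_moment_fps[OF t]) (auto simp: norm_mult)
    ultimately show ?thesis using LIMSEQ_unique by simp
  qed
  moreover have "\<bar>t j\<bar> \<le> h ^ j" if "2 \<le> j" for j
    using tendsto_rabs[OF t[OF that]] h(2)[OF that] by (intro LIMSEQ_le_const2) auto
  ultimately show "chaos_law M ?X t" using h(1) by (intro chaos_lawI[of h])
qed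

end

section \<open>Iterated kernels and traces\<close>

text \<open>
  The (n+1)-fold composition of the kernel with itself. All kernels are nonnegative and take values
  in ennreal, so that Tonelli's theorem and Fatou's lemma apply without any integrability condition.
\<close>

fun kernel_power :: "(real \<Rightarrow> real \<Rightarrow> ennreal) \<Rightarrow> nat \<Rightarrow> real \<Rightarrow> real \<Rightarrow> ennreal" where
  "kernel_power K 0 x y = K x y"
| "kernel_power K (Suc n) x y = (\<integral>\<^sup>+z. K x z * kernel_power K n z y \<partial>lborel)"

text \<open>
  For a symmetric kernel and n \<ge> 2, the trace of the n-th power of its operator.
\<close>

definition kernel_trace :: "(real \<Rightarrow> real \<Rightarrow> ennreal) \<Rightarrow> nat \<Rightarrow> ennreal" where
  "kernel_trace K n = (\<integral>\<^sup>+x. \<integral>\<^sup>+y. K x y * kernel_power K (n - 2) x y \<partial>lborel \<partial>lborel)"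

lemma measurable_kernel_power:
  assumes K: "(\<lambda>(x, y). K x y) \<in> borel_measurable plane"
  shows "(\<lambda>(x, y). kernel_power K n x y) \<in> borel_measurable plane"
proof (induction n)
  case (Suc n)
  have 1: "(\<lambda>q :: (real \<times> real) \<times> real. K (fst (fst q)) (snd q)) \<in> borel_measurable (plane \<Otimes>\<^sub>M lborel)"
    using measurable_compose[OF _ K, of "\<lambda>(p, z). (fst p, z)" "plane \<Otimes>\<^sub>M lborel"]
    by (simp add: split_beta')
  have 2: "(\<lambda>q :: (real \<times> real) \<times> real. kernel_power K n (snd q) (snd (fst q))) \<in> borel_measurable (plane \<Otimes>\<^sub>M lborel)"
    using measurable_compose[OF _ Suc, of "\<lambda>(p, z). (z, snd p)" "plane \<Otimes>\<^sub>M lborel"]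
    by (simp add: split_beta')
  have "(\<lambda>(p, z). K (fst p) z * kernel_power K n z (snd p)) \<in> borel_measurable (plane \<Otimes>\<^sub>M lborel)"
    unfolding split_beta' using 1 2 by (rule borel_measurable_times_ennreal)
  then have "(\<lambda>p. \<integral>\<^sup>+z. K (fst p) z * kernel_power K n z (snd p) \<partial>lborel) \<in> borel_measurable plane"
    by (rule lborel.borel_measurable_nn_integral)
  then show ?case by (simp add: split_beta')
qed (use K in simp)

lemma kernel_power_mono:
  assumes "\<And>x y. K x y \<le> L x y"
  shows "kernel_power K n x y \<le> kernel_power L n x y"
  by (induction n arbitrary: x y) (auto intro!: nn_integral_mono mult_mono assms)

lemma kernel_trace_mono:
  assumes "\<And>x y. K x y \<le> L x y"
  shows "kernel_trace K n \<le> kernel_trace L n"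
  unfolding kernel_trace_def by (intro nn_integral_mono mult_mono kernel_power_mono assms) auto

lemma liminf_mult_ennreal:
  fixes a b :: "nat \<Rightarrow> ennreal"
  shows "liminf a * liminf b \<le> liminf (\<lambda>n. a n * b n)"
proof -
  let ?A = "\<lambda>n. INF m\<in>{n..}. a m" and ?B = "\<lambda>n. INF m\<in>{n..}. b m"
  have mono: "?A i \<le> ?A j" "?B i \<le> ?B j" if "i \<le> j" for i j
    using that by (auto intro!: INF_superset_mono)
  have le: "?A i * ?B j \<le> (SUP n. INF m\<in>{n..}. a m * b m)" for i j
  proof -
    have "?A i * ?B j \<le> ?A (max i j) * ?B (max i j)"
      by (intro mult_mono mono) auto
    also have "\<dots> \<le> (INF m\<in>{max i j..}. a m * b m)"
      by (intro INF_greatest mult_mono INF_lower) auto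
    also have "\<dots> \<le> (SUP n. INF m\<in>{n..}. a m * b m)"
      by (rule SUP_upper) simp
    finally show ?thesis .
  qed
  have "liminf a * liminf b = (SUP j. SUP i. ?A i * ?B j)"
    unfolding liminf_SUP_INF by (simp add: SUP_mult_left_ennreal SUP_mult_right_ennreal)
  also have "\<dots> \<le> (SUP n. INF m\<in>{n..}. a m * b m)"
    by (intro SUP_least le)
  finally show ?thesis unfolding liminf_SUP_INF .
qed

text \<open>
  Fatou's lemma at each composition. Only the values off the diagonal enter, because for given x and y the
  set of intermediate points equal to x or y is a null set.
\<close>

lemma kernel_power_liminf:
  assumes m: "\<And>k. (\<lambda>(x, y). K k x y) \<in> borel_measurable plane"
    and lim: "\<And>x y. x \<noteq> y \<Longrightarrow> L x y \<le> liminf (\<lambda>k. K k x y)" and "x \<noteq> y"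
  shows "kernel_power L n x y \<le> liminf (\<lambda>k. kernel_power (K k) n x y)"
  using \<open>x \<noteq> y\<close>
proof (induction n arbitrary: x y)
  case (Suc n)
  have 1: "(\<lambda>z. K k x z) \<in> borel_measurable lborel" for k
    using measurable_compose[OF _ m[of k], of "\<lambda>z. (x, z)" lborel] by simp
  have 2: "(\<lambda>z. kernel_power (K k) n z y) \<in> borel_measurable lborel" for k
    using measurable_compose[OF _ measurable_kernel_power[OF m[of k]], of "\<lambda>z. (z, y)" lborel] by simp
  have "AE z in lborel. z \<noteq> x" "AE z in lborel. z \<noteq> y"
    by (auto intro: AE_lborel_singleton)
  then have "(\<integral>\<^sup>+z. L x z * kernel_power L n z y \<partial>lborel)
      \<le> (\<integral>\<^sup>+z. liminf (\<lambda>k. K k x z * kernel_power (K k) n z y) \<partial>lborel)"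
    by (intro nn_integral_mono_AE, eventually_elim)
      (rule order.trans[OF mult_mono liminf_mult_ennreal], auto intro!: lim Suc.IH)
  also have "\<dots> \<le> liminf (\<lambda>k. \<integral>\<^sup>+z. K k x z * kernel_power (K k) n z y \<partial>lborel)"
    by (intro nn_integral_liminf borel_measurable_times_ennreal 1 2)
  finally show ?case by simp
qed (use lim in simp)

lemma kernel_trace_liminf:
  assumes m: "\<And>k. (\<lambda>(x, y). K k x y) \<in> borel_measurable plane"
    and lim: "\<And>x y. x \<noteq> y \<Longrightarrow> L x y \<le> liminf (\<lambda>k. K k x y)"
  shows "kernel_trace L n \<le> liminf (\<lambda>k. kernel_trace (K k) n)"
proof -
  let ?I = "\<lambda>k x y. K k x y * kernel_power (K k) (n - 2) x y"
  have prod: "(\<lambda>(x, y). (?I k x y)) \<in> borel_measurable plane" for k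
    using borel_measurable_times_ennreal[OF m[of k] measurable_kernel_power[OF m[of k], of "n - 2"]]
    by (simp add: split_beta')
  have inner: "(\<integral>\<^sup>+y. L x y * kernel_power L (n - 2) x y \<partial>lborel)
     \<le> liminf (\<lambda>k. \<integral>\<^sup>+y. (?I k x y) \<partial>lborel)" for x
  proof -
    have "AE y in lborel. y \<noteq> x" by (rule AE_lborel_singleton)
    then have "(\<integral>\<^sup>+y. L x y * kernel_power L (n - 2) x y \<partial>lborel)
       \<le> (\<integral>\<^sup>+y. liminf (\<lambda>k. (?I k x y)) \<partial>lborel)"
      by (intro nn_integral_mono_AE, eventually_elim)
        (rule order.trans[OF mult_mono liminf_mult_ennreal], auto intro!: lim kernel_power_liminf m)
    also have "\<dots> \<le> liminf (\<lambda>k. \<integral>\<^sup>+y. (?I k x y) \<partial>lborel)"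
      by (intro nn_integral_liminf)
        (use measurable_compose[OF _ prod, of "\<lambda>y. (x, y)" lborel] in simp)
    finally show ?thesis .
  qed
  have "kernel_trace L n \<le> (\<integral>\<^sup>+x. liminf (\<lambda>k. \<integral>\<^sup>+y. (?I k x y) \<partial>lborel) \<partial>lborel)"
    unfolding kernel_trace_def by (intro nn_integral_mono inner)
  also have "\<dots> \<le> liminf (\<lambda>k. kernel_trace (K k) n)"
    unfolding kernel_trace_def
    by (intro nn_integral_liminf lborel.borel_measurable_nn_integral prod)
  finally show ?thesis .
qed

text \<open>
  Traces are monotone in the kernel, which gives the upper bound, and lower semicontinuous by Fatou's
  lemma.
\<close>

lemma kernel_trace_tendsto:
  assumes m: "\<And>k. (\<lambda>(x, y). K k x y) \<in> borel_measurable plane"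
    and lim: "\<And>x y. x \<noteq> y \<Longrightarrow> L x y \<le> liminf (\<lambda>k. K k x y)"
    and le: "\<And>k x y. K k x y \<le> L x y"
  shows "(\<lambda>k. kernel_trace (K k) n) \<longlonglongrightarrow> kernel_trace L n"
proof (rule Liminf_eq_Limsup[OF sequentially_bot])
  have up: "limsup (\<lambda>k. kernel_trace (K k) n) \<le> kernel_trace L n"
    by (intro Limsup_bounded always_eventually allI kernel_trace_mono le)
  have lo: "kernel_trace L n \<le> liminf (\<lambda>k. kernel_trace (K k) n)"
    by (rule kernel_trace_liminf[OF m lim])
  have "liminf (\<lambda>k. kernel_trace (K k) n) \<le> limsup (\<lambda>k. kernel_trace (K k) n)"
    by (rule Liminf_le_Limsup[OF sequentially_bot])
  with up lo show "liminf (\<lambda>k. kernel_trace (K k) n) = kernel_trace L n"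
    "limsup (\<lambda>k. kernel_trace (K k) n) = kernel_trace L n"
    by (auto intro: antisym order.trans)
qed

text \<open>
  Cells are disjoint, so of the products of cell indicators at the intermediate point z only those with equal
  indices survive.
\<close>

lemma step_fun_convolution:
  assumes g: "is_grid n \<tau>"
  shows "step_fun n \<tau> d (x, z) * step_fun n \<tau> P (z, y)
    = (\<Sum>l<n. (\<Sum>i<n. d i l * cell_ind \<tau> i x) * (\<Sum>j<n. P l j * cell_ind \<tau> j y) * cell_ind \<tau> l z)"
proof -
  define a where "a l = (\<Sum>i<n. d i l * cell_ind \<tau> i x)" for l
  define b where "b l = (\<Sum>j<n. P l j * cell_ind \<tau> j y)" for l
  have "step_fun n \<tau> d (x, z) = (\<Sum>l<n. a l * cell_ind \<tau> l z)"
    unfolding step_fun_def a_def by (subst sum.swap) (simp only: sum_distrib_right fst_conv snd_conv)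
  moreover have "step_fun n \<tau> P (z, y) = (\<Sum>l<n. b l * cell_ind \<tau> l z)"
    unfolding step_fun_def b_def sum_distrib_right by (intro sum.cong refl) (simp only: fst_conv snd_conv mult_ac)
  ultimately have "step_fun n \<tau> d (x, z) * step_fun n \<tau> P (z, y)
    = (\<Sum>l<n. \<Sum>k<n. a l * cell_ind \<tau> l z * (b k * cell_ind \<tau> k z))"
    by (simp only: sum_product)
  also have "\<dots> = (\<Sum>l<n. \<Sum>k<n. if k = l then a l * b l * cell_ind \<tau> l z else 0)"
  proof (intro sum.cong refl)
    fix l k assume "l \<in> {..<n}" "k \<in> {..<n}"
    then have "cell_ind \<tau> l z * cell_ind \<tau> k z = (if l = k then cell_ind \<tau> l z else 0)"
      by (intro cell_ind_prod[OF g]) auto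
    moreover have "a l * cell_ind \<tau> l z * (b k * cell_ind \<tau> k z) = a l * b k * (cell_ind \<tau> l z * cell_ind \<tau> k z)"
      by (simp only: mult_ac)
    ultimately show "a l * cell_ind \<tau> l z * (b k * cell_ind \<tau> k z) = (if k = l then a l * b l * cell_ind \<tau> l z else 0)"
      by auto
  qed
  also have "\<dots> = (\<Sum>l<n. a l * b l * cell_ind \<tau> l z)" by simp
  finally show ?thesis by (simp only: a_def b_def)
qed

lemma step_fun_nonneg: "(\<And>i j. 0 \<le> c i j) \<Longrightarrow> 0 \<le> step_fun n \<tau> c z"
  unfolding step_fun_def by (intro sum_nonneg mult_nonneg_nonneg) auto

lemma chain_nonneg:
  assumes "\<And>i j. 0 \<le> d i j" "\<And>i. i \<in> I \<Longrightarrow> 0 \<le> v i"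
  shows "0 \<le> chain I v d m i j"
  using assms by (induction m arbitrary: i j) (auto intro!: sum_nonneg)

text \<open>
  Composing step kernels is multiplication of their coefficient matrices, with the lengths of the cells
  in between.
\<close>

lemma kernel_power_step:
  assumes g: "is_grid n \<tau>" and d: "\<And>i j. 0 \<le> d i j"
  defines "v \<equiv> \<lambda>i. \<tau> (Suc i) - \<tau> i"
  shows "kernel_power (\<lambda>x y. ennreal (step_fun n \<tau> d (x, y))) m x y
    = ennreal (step_fun n \<tau> (chain {..<n} v d m) (x, y))"
proof (induction m arbitrary: x y)
  case (Suc m)
  let ?P = "chain {..<n} v d m"
  have v: "0 \<le> v i" if "i < n" for i using g that by (simp add: v_def less_imp_le)
  have P: "0 \<le> ?P i j" for i j by (rule chain_nonneg) (use d v in auto)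
  define w where "w l = (\<Sum>i<n. d i l * cell_ind \<tau> i x) * (\<Sum>j<n. ?P l j * cell_ind \<tau> j y)" for l
  have w: "0 \<le> w l" for l
    unfolding w_def by (intro mult_nonneg_nonneg sum_nonneg d P) auto
  have conv: "step_fun n \<tau> d (x, z) * step_fun n \<tau> ?P (z, y) = (\<Sum>l<n. w l * cell_ind \<tau> l z)" for z
    unfolding w_def by (rule step_fun_convolution[OF g])
  have "kernel_power (\<lambda>x y. ennreal (step_fun n \<tau> d (x, y))) (Suc m) x y
    = (\<integral>\<^sup>+z. (\<Sum>l<n. ennreal (w l) * ennreal (cell_ind \<tau> l z)) \<partial>lborel)"
    unfolding kernel_power.simps Suc.IH
  proof (intro nn_integral_cong)
    fix z
    have "ennreal (step_fun n \<tau> d (x, z)) * ennreal (step_fun n \<tau> ?P (z, y))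
      = ennreal (\<Sum>l<n. w l * cell_ind \<tau> l z)"
      unfolding conv[symmetric] by (intro ennreal_mult[symmetric] step_fun_nonneg d P)
    also have "\<dots> = (\<Sum>l<n. ennreal (w l * cell_ind \<tau> l z))"
      by (intro sum_ennreal[symmetric] mult_nonneg_nonneg w) auto
    also have "\<dots> = (\<Sum>l<n. ennreal (w l) * ennreal (cell_ind \<tau> l z))"
      by (intro sum.cong refl ennreal_mult w) auto
    finally show "ennreal (step_fun n \<tau> d (x, z)) * ennreal (step_fun n \<tau> ?P (z, y))
      = (\<Sum>l<n. ennreal (w l) * ennreal (cell_ind \<tau> l z))" .
  qed
  also have "\<dots> = (\<Sum>l<n. ennreal (w l) * ennreal (v l))"
    using g by (simp add: nn_integral_sum nn_integral_cmult nn_integral_cell v_def)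
  also have "\<dots> = (\<Sum>l<n. ennreal (w l * v l))"
    using w v by (intro sum.cong refl ennreal_mult[symmetric]) auto
  also have "\<dots> = ennreal (\<Sum>l<n. w l * v l)"
    using w v by (intro sum_ennreal mult_nonneg_nonneg) auto
  also have "(\<Sum>l<n. w l * v l) = step_fun n \<tau> (chain {..<n} v d (Suc m)) (x, y)"
  proof -
    have "(\<Sum>l<n. w l * v l) = (\<Sum>l<n. \<Sum>i<n. \<Sum>j<n. d i l * v l * ?P l j * cell_ind \<tau> i x * cell_ind \<tau> j y)"
      unfolding w_def sum_product sum_distrib_right by (simp only: sum_distrib_left mult_ac)
    also have "\<dots> = (\<Sum>i<n. \<Sum>l<n. \<Sum>j<n. d i l * v l * ?P l j * cell_ind \<tau> i x * cell_ind \<tau> j y)"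
      by (rule sum.swap)
    also have "\<dots> = (\<Sum>i<n. \<Sum>j<n. \<Sum>l<n. d i l * v l * ?P l j * cell_ind \<tau> i x * cell_ind \<tau> j y)"
      by (rule sum.cong[OF refl], rule sum.swap)
    finally show ?thesis by (simp only: step_fun_def chain.simps sum_distrib_right fst_conv snd_conv)
  qed
  finally show ?case .
next
  case 0
  have "chain {..<n} v d 0 = d" by (simp add: fun_eq_iff)
  then show ?case by simp
qed

lemma kernel_trace_step:
  assumes g: "is_grid n \<tau>" and d: "\<And>i j. 0 \<le> d i j"
  defines "v \<equiv> \<lambda>i. \<tau> (Suc i) - \<tau> i"
  shows "kernel_trace (\<lambda>x y. ennreal (step_fun n \<tau> d (x, y))) m = ennreal (trace_power {..<n} v d m)"
proof -
  let ?K = "\<lambda>x y. ennreal (step_fun n \<tau> d (x, y))"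
  let ?P = "chain {..<n} v d (m - 2)"
  let ?dP = "step_fun n \<tau> (\<lambda>i j. d i j * ?P i j)"
  have P: "0 \<le> ?P i j" for i j by (rule chain_nonneg) (use d g in \<open>auto simp: v_def less_imp_le\<close>)
  have "kernel_trace ?K m
    = (\<integral>\<^sup>+x. \<integral>\<^sup>+y. ennreal (?dP (x, y)) \<partial>lborel \<partial>lborel)"
    unfolding kernel_trace_def
  proof (intro nn_integral_cong)
    fix x y
    have "kernel_power ?K (m - 2) x y = ennreal (step_fun n \<tau> ?P (x, y))"
      unfolding v_def by (rule kernel_power_step[OF g d])
    then have "ennreal (step_fun n \<tau> d (x, y)) * kernel_power ?K (m - 2) x y
      = ennreal (step_fun n \<tau> d (x, y) * step_fun n \<tau> ?P (x, y))"
      by (simp only: ennreal_mult step_fun_nonneg d P)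
    then show "ennreal (step_fun n \<tau> d (x, y)) * kernel_power ?K (m - 2) x y
      = ennreal (?dP (x, y))"
      by (simp only: step_fun_map2[OF g, of "(*)"] mult_zero_left)
  qed
  also have "\<dots> = (\<integral>\<^sup>+z. ennreal (?dP z) \<partial>plane)"
    by (rule lborel.nn_integral_fst) (simp add: lborel_prod)
  also have "\<dots> = ennreal (\<Sum>i<n. \<Sum>j<n. d i j * ?P i j * v i * v j)"
    unfolding lborel_prod v_def by (rule nn_integral_step_fun[OF g]) (use d P in \<open>simp add: v_def\<close>)
  finally show ?thesis by (simp only: trace_power_def mult_ac)
qed

section \<open>Approximation from below\<close>

text \<open>
  The grid of mesh 1/(k+1) on the interval from -(k+1) to k+1.
\<close>

definition grid_point :: "nat \<Rightarrow> nat \<Rightarrow> real" where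
  "grid_point k i = real i / real (Suc k) - real (Suc k)"

definition grid_size :: "nat \<Rightarrow> nat" where
  "grid_size k = 2 * Suc k * Suc k"

abbreviation grid_cell :: "nat \<Rightarrow> nat \<Rightarrow> real set" where
  "grid_cell k i \<equiv> {grid_point k i<..grid_point k (Suc i)}"

text \<open>
  The infimum over a cell keeps the step function below f, so that f itself is a dominating function, both in
  L2 and for the traces.
\<close>

definition lower_coeff :: "(real \<times> real \<Rightarrow> real) \<Rightarrow> nat \<Rightarrow> nat \<Rightarrow> nat \<Rightarrow> real" where
  "lower_coeff f k i j = (if i = j then 0 else INF z\<in>grid_cell k i \<times> grid_cell k j. f z)"

abbreviation lower_step :: "(real \<times> real \<Rightarrow> real) \<Rightarrow> nat \<Rightarrow> real \<times> real \<Rightarrow> real" where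
  "lower_step f k \<equiv> step_fun (grid_size k) (grid_point k) (lower_coeff f k)"

lemma grid_point_Suc: "grid_point k (Suc i) = grid_point k i + 1 / real (Suc k)"
  by (simp add: grid_point_def add_divide_distrib)

lemma grid_mono: "is_grid n (grid_point k)"
  by (simp add: grid_point_Suc)

lemma grid_cell_exists:
  assumes "\<bar>x\<bar> < real (Suc k)"
  obtains i where "i < grid_size k" "x \<in> grid_cell k i"
proof -
  let ?K = "real (Suc k)"
  define a where "a = (x + ?K) * ?K"
  have a: "0 < a" "a < 2 * ?K * ?K"
    using assms by (auto simp: a_def intro!: mult_pos_pos mult_strict_right_mono)
  \<comment> \<open>Cells are closed on the right, hence the ceiling minus one.\<close>
  define i where "i = nat (\<lceil>a\<rceil> - 1)"
  have c: "1 \<le> \<lceil>a\<rceil>" using a(1) by linarith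
  have i: "real i = of_int \<lceil>a\<rceil> - 1" using c by (simp add: i_def)
  have i1: "real i < a" "a \<le> real i + 1" unfolding i by linarith+
  have "real (grid_size k) = 2 * ?K * ?K" by (simp only: grid_size_def of_nat_mult of_nat_numeral)
  then have "real i < real (grid_size k)" using i1(1) a(2) by linarith
  then have "i < grid_size k" by simp
  moreover have "x = a / ?K - ?K" by (simp add: a_def del: of_nat_Suc)
  moreover have "real i / ?K < a / ?K" "a / ?K \<le> (real i + 1) / ?K"
    using i1 by (auto intro!: divide_strict_right_mono divide_right_mono)
  ultimately show ?thesis by (intro that[of i]) (auto simp: grid_point_def add.commute)
qed

lemma offdiag_lower_step: "offdiag_step (grid_size k) (grid_point k) (lower_coeff f k)"
  by (simp add: offdiag_step_def grid_mono lower_coeff_def)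

context
  fixes f :: "real \<times> real \<Rightarrow> real"
  assumes f_nonneg: "\<And>z. 0 \<le> f z"
begin

lemma grid_cell_nonempty: "grid_cell k i \<times> grid_cell k j \<noteq> {}"
  by (simp add: grid_point_Suc)

lemma lower_coeff_nonneg: "0 \<le> lower_coeff f k i j"
  unfolding lower_coeff_def using grid_cell_nonempty by (auto intro!: cINF_greatest f_nonneg)

lemma lower_step_nonneg: "0 \<le> lower_step f k z"
  by (rule step_fun_nonneg) (rule lower_coeff_nonneg)

lemma lower_step_le: "lower_step f k z \<le> f z"
proof (cases "\<exists>i<grid_size k. \<exists>j<grid_size k. fst z \<in> grid_cell k i \<and> snd z \<in> grid_cell k j")
  case True
  then obtain i j where ij: "i < grid_size k" "j < grid_size k" "fst z \<in> grid_cell k i" "snd z \<in> grid_cell k j"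
    by auto
  have "bdd_below (f ` (grid_cell k i \<times> grid_cell k j))"
    by (rule bdd_belowI2[of _ 0]) (rule f_nonneg)
  then have "(INF w\<in>grid_cell k i \<times> grid_cell k j. f w) \<le> f z"
    by (rule cINF_lower) (use ij in \<open>simp add: mem_Times_iff\<close>)
  then have "lower_coeff f k i j \<le> f z" using f_nonneg by (simp add: lower_coeff_def)
  then show ?thesis using step_fun_cell[OF grid_mono ij, of "lower_coeff f k"] by simp
next
  case False
  then have *: "(\<forall>i<grid_size k. fst z \<notin> grid_cell k i) \<or> (\<forall>j<grid_size k. snd z \<notin> grid_cell k j)"
    by auto
  from step_fun_outside[OF *, of "lower_coeff f k"] f_nonneg show ?thesis by simp
qed

lemma lower_step_near:
  assumes "x \<noteq> y" "\<bar>x\<bar> < real (Suc k)" "\<bar>y\<bar> < real (Suc k)" "1 / real (Suc k) < \<bar>x - y\<bar>"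
  shows "\<exists>p q. p \<noteq> q \<and> \<bar>p - x\<bar> \<le> 1 / real (Suc k) \<and> \<bar>q - y\<bar> \<le> 1 / real (Suc k)
     \<and> f (p, q) \<le> lower_step f k (x, y) + 1 / real (Suc k)"
proof -
  obtain i where i: "i < grid_size k" "x \<in> grid_cell k i" by (rule grid_cell_exists[OF assms(2)])
  obtain j where j: "j < grid_size k" "y \<in> grid_cell k j" by (rule grid_cell_exists[OF assms(3)])
  let ?C = "grid_cell k i \<times> grid_cell k j"
  have "i \<noteq> j"
  proof
    assume "i = j"
    then have "\<bar>x - y\<bar> < 1 / real (Suc k)" using i(2) j(2) by (auto simp: grid_point_Suc)
    then show False using assms(4) by simp
  qed
  then have F: "lower_step f k (x, y) = (INF w\<in>?C. f w)"
    using step_fun_cell[OF grid_mono i(1) j(1) i(2) j(2), of "lower_coeff f k"]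
    by (simp add: lower_coeff_def)
  have "\<exists>w\<in>?C. f w < (INF w\<in>?C. f w) + 1 / real (Suc k)"
  proof (subst cINF_less_iff[symmetric])
    show "bdd_below (f ` ?C)"
      by (rule bdd_belowI2[of _ 0]) (rule f_nonneg)
  qed (use grid_cell_nonempty in auto)
  then obtain p q where pq: "p \<in> grid_cell k i" "q \<in> grid_cell k j"
    "f (p, q) \<le> lower_step f k (x, y) + 1 / real (Suc k)" unfolding F by force
  have "p \<noteq> q" using cell_unique[OF grid_mono i(1) j(1), of p k] pq \<open>i \<noteq> j\<close> by auto
  moreover have "\<bar>p - x\<bar> \<le> 1 / real (Suc k)" "\<bar>q - y\<bar> \<le> 1 / real (Suc k)"
    using pq i(2) j(2) by (auto simp: grid_point_Suc)
  ultimately show ?thesis using pq(3) by blast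
qed

text \<open>
  Pick near-minimizers of f in the cells around (x, y). They converge to (x, y), so by lower
  semicontinuity their values, and with them the infima, are eventually above any number below
  f (x, y).
\<close>

lemma lower_step_tendsto:
  assumes "x \<noteq> y"
    and lsc: "\<And>u v. (u \<longlonglongrightarrow> x) \<Longrightarrow> (v \<longlonglongrightarrow> y) \<Longrightarrow> (\<And>k. u k \<noteq> v k) \<Longrightarrow>
        ennreal (f (x, y)) \<le> liminf (\<lambda>k. ennreal (f (u k, v k)))"
  shows "(\<lambda>k. lower_step f k (x, y)) \<longlonglongrightarrow> f (x, y)"
proof -
  let ?e = "\<lambda>k. 1 / real (Suc k)"
  have e0: "?e \<longlonglongrightarrow> 0" by (rule LIMSEQ_Suc[OF lim_1_over_n])
  have "eventually (\<lambda>k. ?e k < \<bar>x - y\<bar>) sequentially"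
    using assms(1) by (intro order_tendstoD(2)[OF e0]) simp
  moreover have "eventually (\<lambda>k. max \<bar>x\<bar> \<bar>y\<bar> < real (Suc k)) sequentially"
  proof -
    obtain n where n: "max \<bar>x\<bar> \<bar>y\<bar> < real n" using reals_Archimedean2 by blast
    show ?thesis using eventually_ge_at_top[of n] by (rule eventually_mono) (use n in auto)
  qed
  ultimately have "eventually (\<lambda>k. \<exists>w. fst w \<noteq> snd w \<and> \<bar>fst w - x\<bar> \<le> ?e k \<and> \<bar>snd w - y\<bar> \<le> ?e k
     \<and> f w \<le> lower_step f k (x, y) + ?e k) sequentially"
  proof eventually_elim
    case (elim k)
    then have "\<bar>x\<bar> < real (Suc k)" "\<bar>y\<bar> < real (Suc k)" by auto
    from lower_step_near[OF assms(1) this elim(1)] show ?case by force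
  qed
  then obtain N where N: "\<And>k. N \<le> k \<Longrightarrow> \<exists>w. fst w \<noteq> snd w \<and> \<bar>fst w - x\<bar> \<le> ?e k \<and> \<bar>snd w - y\<bar> \<le> ?e k
     \<and> f w \<le> lower_step f k (x, y) + ?e k"
    by (auto simp: eventually_sequentially)
  then obtain w where w: "\<And>k. N \<le> k \<Longrightarrow> fst (w k) \<noteq> snd (w k)" "\<And>k. N \<le> k \<Longrightarrow> \<bar>fst (w k) - x\<bar> \<le> ?e k"
     "\<And>k. N \<le> k \<Longrightarrow> \<bar>snd (w k) - y\<bar> \<le> ?e k" "\<And>k. N \<le> k \<Longrightarrow> f (w k) \<le> lower_step f k (x, y) + ?e k"
    by metis
  define u v where "u k = (if N \<le> k then fst (w k) else x)" and "v k = (if N \<le> k then snd (w k) else y)" for k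
  have u: "u \<longlonglongrightarrow> x"
    by (rule LIM_zero_cancel, rule Lim_null_comparison[OF _ e0]) (auto simp: u_def w(2) simp del: of_nat_Suc intro!: always_eventually)
  have v: "v \<longlonglongrightarrow> y"
    by (rule LIM_zero_cancel, rule Lim_null_comparison[OF _ e0]) (auto simp: v_def w(3) simp del: of_nat_Suc intro!: always_eventually)
  have uv: "u k \<noteq> v k" for k using w(1) assms(1) by (simp add: u_def v_def)
  have "f (u k, v k) - ?e k \<le> lower_step f k (x, y)" if "N \<le> k" for k
    using w(4)[OF that] that by (simp add: u_def v_def)
  then have low: "eventually (\<lambda>k. f (u k, v k) - ?e k \<le> lower_step f k (x, y)) sequentially"
    by (auto simp: eventually_sequentially)
  show ?thesis
  proof (rule order_tendstoI)
    fix a assume "f (x, y) < a"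
    then show "eventually (\<lambda>k. lower_step f k (x, y) < a) sequentially"
      by (intro always_eventually allI le_less_trans[OF lower_step_le])
  next
    fix a assume a: "a < f (x, y)"
    show "eventually (\<lambda>k. a < lower_step f k (x, y)) sequentially"
    proof (cases "a < 0")
      case True
      show ?thesis by (intro always_eventually allI less_le_trans[OF True lower_step_nonneg])
    next
      case False
      \<comment> \<open>The gap between a and b absorbs the error 1/(k+1) of the near-minimizers.\<close>
      define b where "b = (a + f (x, y)) / 2"
      have b: "a < b" "b < f (x, y)" "0 < b" using a False by (auto simp: b_def)
      have "ennreal b < ennreal (f (x, y))" using b by (simp add: ennreal_less_iff)
      also have "\<dots> \<le> liminf (\<lambda>k. ennreal (f (u k, v k)))" by (rule lsc[OF u v uv])
      finally have "eventually (\<lambda>k. ennreal b < ennreal (f (u k, v k))) sequentially"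
        by (rule less_LiminfD)
      moreover have "eventually (\<lambda>k. ?e k < b - a) sequentially"
        using b by (intro order_tendstoD(2)[OF e0]) simp
      ultimately show ?thesis using low
      proof eventually_elim
        case (elim k)
        have "b < f (u k, v k)" using elim(1) b by (simp add: ennreal_less_iff)
        then show ?case using elim(2,3) by linarith
      qed
    qed
  qed
qed

end

lemma AE_lborel_offdiagonal: "AE z in (lborel :: (real \<times> real) measure). fst z \<noteq> snd z"
proof -
  have "AE z in plane. fst z \<noteq> (snd z :: real)"
  proof (rule lborel_pair.AE_pair_measure)
    show "{z \<in> space plane. fst z \<noteq> (snd z :: real)} \<in> sets plane"
      by measurable
    show "AE x in lborel. AE y in lborel. fst (x, y) \<noteq> (snd (x, y) :: real)"
    proof (rule AE_I2)
      fix x :: real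
      show "AE y in lborel. fst (x, y) \<noteq> snd (x, y)"
        using AE_lborel_singleton[of x] by eventually_elim auto
    qed
  qed
  then show ?thesis unfolding lborel_prod .
qed

lemma step_fun_sym_coeff: "step_fun n \<tau> (sym_coeff c) (x, y) = (step_fun n \<tau> c (x, y) + step_fun n \<tau> c (y, x)) / 2"
proof -
  have "step_fun n \<tau> c (y, x) = (\<Sum>i<n. \<Sum>j<n. c j i * cell_ind \<tau> i x * cell_ind \<tau> j y)"
    unfolding step_fun_def by (subst sum.swap) (simp only: fst_conv snd_conv mult_ac)
  then show ?thesis
    unfolding step_fun_def sym_coeff_def
    by (simp only: add_divide_distrib distrib_right sum.distrib sum_divide_distrib times_divide_eq_left fst_conv snd_conv)
qed

text \<open>
  The passage from step functions to kernels. Lower semicontinuity makes the lower step functions converge off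
  the diagonal; domination by k then gives convergence in L2 and convergence of the traces.
\<close>

theorem (in two_sided_brownian_motion) chaos_law_lsc_kernel:
  fixes k :: "real \<Rightarrow> real \<Rightarrow> ennreal"
  defines "f \<equiv> \<lambda>z. enn2real (k (fst z) (snd z))" and "K \<equiv> \<lambda>x y. (k x y + k y x) / 2"
  assumes meas: "(\<lambda>(x, y). k x y) \<in> borel_measurable plane"
    and fin: "\<And>x y. x \<noteq> y \<Longrightarrow> k x y < \<infinity>"
    and lsc: "\<And>x y u v. x \<noteq> y \<Longrightarrow> (u \<longlonglongrightarrow> x) \<Longrightarrow> (v \<longlonglongrightarrow> y) \<Longrightarrow> k x y \<le> liminf (\<lambda>j. k (u j) (v j))"
    and L2: "(\<integral>\<^sup>+x. \<integral>\<^sup>+y. (k x y)\<^sup>2 \<partial>lborel \<partial>lborel) < \<infinity>"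
    and h: "0 < h" "\<And>m. 2 \<le> m \<Longrightarrow> kernel_trace K m \<le> ennreal (h ^ m)"
  shows "chaos_law M (double_wiener_integral M B f) (\<lambda>m. enn2real (kernel_trace K m))"
    and "double_wiener_integral M B f \<in> borel_measurable M"
proof -
  have f0: "0 \<le> f z" for z by (simp add: f_def)
  have fk: "ennreal (f (x, y)) = k x y" if "x \<noteq> y" for x y
    using fin[OF that] by (simp add: f_def)
  have fle: "ennreal (f (x, y)) \<le> k x y" for x y
    by (cases "k x y") (auto simp: f_def)
  have fm: "f \<in> borel_measurable borel"
  proof -
    have "f \<in> borel_measurable plane"
      using borel_measurable_enn2real[OF meas] by (simp add: f_def split_beta')
    then show ?thesis by (simp add: lborel_prod)
  qed
  have lim: "(\<lambda>j. lower_step f j (x, y)) \<longlonglongrightarrow> f (x, y)" if "x \<noteq> y" for x y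
    by (rule lower_step_tendsto[OF f0 that]) (use lsc[OF that] that in \<open>simp add: fk\<close>)
  have L2conv: "(\<lambda>j. L2_sq lborel f (lower_step f j)) \<longlonglongrightarrow> 0"
  proof -
    have "(\<lambda>j. L2_sq lborel f (lower_step f j)) \<longlonglongrightarrow> (\<integral>\<^sup>+ z. 0 \<partial>(lborel :: (real \<times> real) measure))"
    proof (rule nn_integral_dominated_convergence[where w = "\<lambda>z. ennreal ((f z)\<^sup>2)"])
      show "AE z in lborel. ennreal ((f z - lower_step f j z)\<^sup>2) \<le> ennreal ((f z)\<^sup>2)" for j
        using lower_step_le[of f, OF f0] lower_step_nonneg[of f, OF f0]
        by (intro AE_I2 ennreal_leI power_mono) (auto simp: diff_ge_0_iff_ge)
      have "(\<integral>\<^sup>+ z. ennreal ((f z)\<^sup>2) \<partial>lborel) = (\<integral>\<^sup>+ z. ennreal ((f z)\<^sup>2) \<partial>plane)"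
        by (simp add: lborel_prod)
      also have "\<dots> = (\<integral>\<^sup>+x. \<integral>\<^sup>+y. ennreal ((f (x, y))\<^sup>2) \<partial>lborel \<partial>lborel)"
        by (rule lborel.nn_integral_fst[symmetric]) (use fm in \<open>simp add: lborel_prod\<close>)
      also have "\<dots> \<le> (\<integral>\<^sup>+x. \<integral>\<^sup>+y. (k x y)\<^sup>2 \<partial>lborel \<partial>lborel)"
        by (intro nn_integral_mono) (metis ennreal_power f0 fle power_mono zero_le)
      finally show "(\<integral>\<^sup>+ z. ennreal ((f z)\<^sup>2) \<partial>lborel) < \<infinity>" using L2 by (rule le_less_trans)
      show "AE z in lborel. (\<lambda>j. ennreal ((f z - lower_step f j z)\<^sup>2)) \<longlonglongrightarrow> 0"
        using AE_lborel_offdiagonal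
      proof eventually_elim
        case (elim z)
        then have "(\<lambda>j. lower_step f j z) \<longlonglongrightarrow> f z" using lim[of "fst z" "snd z"] by simp
        then have "(\<lambda>j. ennreal ((f z - lower_step f j z)\<^sup>2)) \<longlonglongrightarrow> ennreal ((f z - f z)\<^sup>2)"
          by (intro tendsto_intros)
        then show ?case by simp
      qed
    qed (use fm in measurable)
    then show ?thesis by simp
  qed
  define d where "d j = sym_coeff (lower_coeff f j)" for j
  let ?T = "\<lambda>j m. trace_power {..<grid_size j} (mesh (grid_point j)) (d j) m"
  let ?F = "\<lambda>j x y. ennreal (step_fun (grid_size j) (grid_point j) (d j) (x, y))"
  have d0: "0 \<le> d j a b" for j a b
    using lower_coeff_nonneg[of f, OF f0] by (simp add: d_def sym_coeff_def)
  have tr: "kernel_trace (?F j) m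
      = ennreal (?T j m)" for j m
    by (rule kernel_trace_step[OF grid_mono d0])
  have half: "ennreal ((a + b) / 2) = (ennreal a + ennreal b) / 2" if "0 \<le> a" "0 \<le> b" for a b
    using that by (simp flip: ennreal_plus ennreal_numeral add: divide_ennreal)
  have Fle: "?F j x y \<le> K x y" for j x y
  proof -
    have 1: "ennreal (lower_step f j (x, y)) \<le> k x y" for x y
      using ennreal_leI[OF lower_step_le[of f, OF f0]] fle by (rule order.trans)
    have "?F j x y = (ennreal (lower_step f j (x, y)) + ennreal (lower_step f j (y, x))) / 2"
      unfolding d_def step_fun_sym_coeff by (rule half) (rule lower_step_nonneg[of f, OF f0])+
    also have "\<dots> \<le> K x y" unfolding K_def by (intro divide_right_mono_ennreal add_mono 1)
    finally show ?thesis .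
  qed
  have Flim: "K x y \<le> liminf (\<lambda>j. ?F j x y)" if "x \<noteq> y" for x y
  proof -
    have "(\<lambda>j. ?F j x y) \<longlonglongrightarrow> ennreal ((f (x, y) + f (y, x)) / 2)"
      unfolding d_def step_fun_sym_coeff using that by (intro tendsto_intros lim) auto
    then have "liminf (\<lambda>j. ?F j x y) = ennreal ((f (x, y) + f (y, x)) / 2)"
      by (rule lim_imp_Liminf[OF sequentially_bot])
    also have "\<dots> = K x y" using that by (simp add: half f0 fk K_def)
    finally show ?thesis by simp
  qed
  have Fm: "(\<lambda>(x, y). ?F j x y) \<in> borel_measurable plane" for j
    unfolding lborel_prod split_beta' prod.collapse by measurable
  have conv: "(\<lambda>j. kernel_trace (?F j) m) \<longlonglongrightarrow> kernel_trace K m" for m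
    by (rule kernel_trace_tendsto[OF Fm Flim Fle])
  have tp0: "0 \<le> (?T j m)" for j m
    unfolding trace_power_def using grid_mono d0
    by (intro sum_nonneg mult_nonneg_nonneg chain_nonneg) (auto simp: grid_point_Suc)
  have bd: "\<bar>(?T j m)\<bar> \<le> h ^ m"
    if "2 \<le> m" for j m
  proof -
    have "ennreal (?T j m) \<le> ennreal (h ^ m)"
      using order.trans[OF kernel_trace_mono[of "?F j", OF Fle] h(2)[OF that]] unfolding tr .
    then show ?thesis using tp0 h(1) by (simp add: ennreal_le_iff)
  qed
  have tconv: "(\<lambda>j. (?T j m))
      \<longlonglongrightarrow> enn2real (kernel_trace K m)" if "2 \<le> m" for m
  proof -
    have "kernel_trace K m < \<infinity>" using h(2)[OF that] by (rule le_less_trans) simp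
    then have "(\<lambda>j. kernel_trace (?F j) m) \<longlonglongrightarrow> ennreal (enn2real (kernel_trace K m))"
      using conv[of m] by (simp only: ennreal_enn2real infinity_ennreal_def)
    then have "(\<lambda>j. enn2real (kernel_trace (?F j) m)) \<longlonglongrightarrow> enn2real (kernel_trace K m)"
      by (rule tendsto_enn2real) simp
    then show ?thesis unfolding tr using tp0 by simp
  qed
  note * = chaos_law_double_wiener_integral[OF fm offdiag_lower_step L2conv h(1), folded d_def, OF bd tconv]
  show "chaos_law M (double_wiener_integral M B f) (\<lambda>m. enn2real (kernel_trace K m))" by (rule *)
  show "double_wiener_integral M B f \<in> borel_measurable M" by (rule *)
qed

section \<open>Overlaps of one-sided powers\<close>

abbreviation unit_integral :: "(real \<Rightarrow> ennreal) \<Rightarrow> ennreal" where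
  "unit_integral F \<equiv> \<integral>\<^sup>+u. F u * indicator {0..1} u \<partial>lborel"

lemma nn_integral_powr_tail:
  assumes "0 < c" "0 < d"
  shows "(\<integral>\<^sup>+u. ennreal (u powr (- c - 1)) * indicator {d..} u \<partial>lborel) = ennreal (d powr (- c) / c)"
proof -
  have "((\<lambda>u. u powr (- c - 1)) has_integral - (d powr (- c - 1 + 1)) / (- c - 1 + 1)) {d..}"
    by (rule has_integral_powr_to_inf) (use assms in auto)
  then have "((\<lambda>u. u powr (- c - 1)) has_integral d powr (- c) / c) {d..}" by simp
  then show ?thesis by (intro nn_integral_has_integral_lebesgue') auto
qed

lemma nn_integral_powr_head:
  assumes "-1 < a" "0 \<le> d"
  shows "(\<integral>\<^sup>+u. ennreal (u powr a) * indicator {0..d} u \<partial>lborel) = ennreal (d powr (a + 1) / (a + 1))"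
  using has_integral_powr_from_0[OF assms] by (intro nn_integral_has_integral_lebesgue') auto

lemma nn_integral_reflect:
  assumes [measurable]: "f \<in> borel_measurable borel"
  shows "(\<integral>\<^sup>+x. f (m - x) \<partial>lborel) = (\<integral>\<^sup>+x. f (x :: real) \<partial>lborel)"
  using nn_integral_real_affine[OF assms, of "-1" m] by simp

lemma nn_integral_translate:
  assumes [measurable]: "f \<in> borel_measurable borel"
  shows "(\<integral>\<^sup>+x. f (x - m) \<partial>lborel) = (\<integral>\<^sup>+x. f (x :: real) \<partial>lborel)"
  using nn_integral_real_affine[OF assms, of 1 "- m"] by simp

lemma measurable_pos_powr [measurable (raw)]:
  assumes [measurable]: "f \<in> borel_measurable M"
  shows "(\<lambda>w. pos_powr (f w) \<gamma>) \<in> borel_measurable M"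
  unfolding pos_powr_def by measurable

lemma pos_powr_nonneg [simp]: "0 \<le> pos_powr u \<gamma>"
  by (simp add: pos_powr_def)

lemma pos_powr_tendsto:
  assumes "(u \<longlongrightarrow> a) F" "a \<noteq> 0"
  shows "((\<lambda>j. pos_powr (u j) \<gamma>) \<longlongrightarrow> pos_powr a \<gamma>) F"
proof (cases "a > 0")
  case True
  then have "eventually (\<lambda>j. pos_powr (u j) \<gamma> = u j powr \<gamma>) F"
    using order_tendstoD(1)[OF assms(1), of 0] by (auto elim!: eventually_mono simp: pos_powr_def)
  moreover have "((\<lambda>j. u j powr \<gamma>) \<longlongrightarrow> a powr \<gamma>) F"
    using True by (intro tendsto_intros assms(1)) auto
  ultimately show ?thesis using True by (simp add: pos_powr_def tendsto_cong)
next
  case False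
  then have "a < 0" using assms(2) by simp
  then have "eventually (\<lambda>j. pos_powr (u j) \<gamma> = 0) F"
    using order_tendstoD(2)[OF assms(1), of 0] by (auto elim!: eventually_mono simp: pos_powr_def)
  then show ?thesis using False by (simp add: pos_powr_def tendsto_eventually)
qed

definition one_sided :: "real \<Rightarrow> real \<Rightarrow> real \<Rightarrow> ennreal" where
  "one_sided \<gamma> s x = ennreal (pos_powr (s - x) \<gamma>)"

lemma measurable_one_sided [measurable (raw)]:
  "f \<in> borel_measurable M \<Longrightarrow> g \<in> borel_measurable M \<Longrightarrow> (\<lambda>w. one_sided \<gamma> (f w) (g w)) \<in> borel_measurable M"
  unfolding one_sided_def by measurable

definition overlap :: "real \<Rightarrow> real \<Rightarrow> real \<Rightarrow> real \<Rightarrow> ennreal" where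
  "overlap a b s t = (\<integral>\<^sup>+x. one_sided a s x * one_sided b t x \<partial>lborel)"

lemma overlap_commute: "overlap a b s t = overlap b a t s"
  by (simp add: overlap_def mult.commute)

text \<open>
  Both exponents are negative, so replacing s - x and t - x by the larger one, max s t - x, decreases
  the product to a single power, which is integrated over the x at distance at least 1.
\<close>

lemma overlap_lower:
  assumes ab: "a < 0" "b < 0" "a + b < -1" and st: "0 \<le> s" "s \<le> 1" "0 \<le> t" "t \<le> 1"
  shows "ennreal (1 / (- a - b - 1)) \<le> overlap a b s t"
proof -
  let ?c = "- a - b - 1" and ?m = "max s t"
  have "ennreal (1 / ?c) = (\<integral>\<^sup>+u. ennreal (u powr (- ?c - 1)) * indicator {1..} u \<partial>lborel)"
    using nn_integral_powr_tail[of ?c 1] ab by simp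
  also have "\<dots> = (\<integral>\<^sup>+x. ennreal ((?m - x) powr (- ?c - 1)) * indicator {1..} (?m - x) \<partial>lborel)"
    by (rule nn_integral_reflect[symmetric]) measurable
  also have "\<dots> \<le> overlap a b s t"
    unfolding overlap_def
  proof (rule nn_integral_mono_AE)
    have "AE x in lborel. x \<noteq> s" "AE x in lborel. x \<noteq> t" by (auto intro: AE_lborel_singleton)
    then show "AE x in lborel. ennreal ((?m - x) powr (- ?c - 1)) * indicator {1..} (?m - x)
        \<le> one_sided a s x * one_sided b t x"
    proof eventually_elim
      case (elim x)
      show ?case
      proof (cases "1 \<le> ?m - x")
        case True
        then have x: "x < s" "x < t" using st elim by (auto simp: max_def split: if_splits)
        have "(?m - x) powr (- ?c - 1) = (?m - x) powr a * (?m - x) powr b"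
          by (simp flip: powr_add add: algebra_simps)
        also have "\<dots> \<le> (s - x) powr a * (t - x) powr b"
          using x ab by (intro mult_mono powr_mono2') auto
        finally have "ennreal ((?m - x) powr (- ?c - 1)) \<le> ennreal ((s - x) powr a) * ennreal ((t - x) powr b)"
          by (simp flip: ennreal_mult)
        then show ?thesis using x True by (simp add: one_sided_def pos_powr_def)
      qed simp
    qed
  qed
  finally show ?thesis .
qed

text \<open>
  Split at the distance t - s below s. Further away both factors are at most powers of
  s - x, which integrates to the main term; in the remaining interval the second
  factor is at most (t - s) powr b and the first one is integrable.
\<close>

lemma overlap_upper_less:
  assumes a: "-1 < a" and b: "b < 0" and ab: "a + b < -1" and st: "s < t"
  shows "overlap a b s t \<le> ennreal ((t - s) powr (1 + a + b) * (1 / (- a - b - 1) + 1 / (a + 1)))"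
proof -
  let ?c = "- a - b - 1" and ?d = "t - s"
  let ?w = "\<lambda>u. ennreal (?d powr b) * (ennreal (u powr a) * indicator {0..?d} u)
     + ennreal (u powr (- ?c - 1)) * indicator {?d..} u"
  have "overlap a b s t \<le> (\<integral>\<^sup>+x. ?w (s - x) \<partial>lborel)"
    unfolding overlap_def
  proof (rule nn_integral_mono)
    fix x
    show "one_sided a s x * one_sided b t x \<le> ?w (s - x)"
    proof (cases "x < s")
      case True
      define u where "u = s - x"
      have u: "u > 0" "t - x = u + ?d" using True by (auto simp: u_def)
      have eq: "one_sided a s x * one_sided b t x = ennreal (u powr a * (u + ?d) powr b)"
        using True st u by (simp add: one_sided_def pos_powr_def u_def ennreal_mult)
      show ?thesis
      proof (cases "u \<le> ?d")
        case True
        have "u powr a * (u + ?d) powr b \<le> ?d powr b * u powr a"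
          using u st b by (subst mult.commute, intro mult_right_mono powr_mono2') auto
        then have "ennreal (u powr a * (u + ?d) powr b) \<le> ennreal (?d powr b) * ennreal (u powr a)"
          by (simp flip: ennreal_mult)
        then show ?thesis using True u eq by (auto simp flip: u_def intro: order.trans add_increasing2)
      next
        case False
        have "u powr a * (u + ?d) powr b \<le> u powr a * u powr b"
          using u st b by (intro mult_left_mono powr_mono2') auto
        also have "\<dots> = u powr (- ?c - 1)" by (simp flip: powr_add)
        finally have "ennreal (u powr a * (u + ?d) powr b) \<le> ennreal (u powr (- ?c - 1))"
          by (rule ennreal_leI)
        then show ?thesis using False u eq by (auto simp flip: u_def intro: order.trans add_increasing)
      qed
    qed (simp add: one_sided_def pos_powr_def)
  qed
  also have "\<dots> = (\<integral>\<^sup>+u. ?w u \<partial>lborel)"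
    by (rule nn_integral_reflect) measurable
  also have "\<dots> = ennreal (?d powr b) * (\<integral>\<^sup>+u. ennreal (u powr a) * indicator {0..?d} u \<partial>lborel)
     + (\<integral>\<^sup>+u. ennreal (u powr (- ?c - 1)) * indicator {?d..} u \<partial>lborel)"
    by (simp add: nn_integral_add nn_integral_cmult)
  also have "\<dots> = ennreal (?d powr b) * ennreal (?d powr (a + 1) / (a + 1)) + ennreal (?d powr (- ?c) / ?c)"
    using a ab st by (subst nn_integral_powr_head, simp, simp, subst nn_integral_powr_tail) auto
  also have "\<dots> = ennreal (?d powr b * (?d powr (a + 1) / (a + 1)) + ?d powr (- ?c) / ?c)"
  proof -
    have n: "0 \<le> ?d powr (a + 1) / (a + 1)" "0 \<le> ?d powr (- ?c) / ?c" using a ab by auto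
    show ?thesis
      by (simp only: ennreal_plus[OF mult_nonneg_nonneg[OF powr_ge_zero n(1)] n(2)]
          ennreal_mult[OF powr_ge_zero n(1)])
  qed
  also have "?d powr b * (?d powr (a + 1) / (a + 1)) + ?d powr (- ?c) / ?c
     = ?d powr (1 + a + b) * (1 / ?c + 1 / (a + 1))"
  proof -
    have "?d powr b * ?d powr (a + 1) = ?d powr (1 + a + b)" by (simp flip: powr_add add: add_ac)
    moreover have "- ?c = 1 + a + b" by simp
    ultimately show ?thesis by (simp only: times_divide_eq_right distrib_left mult_1_right add.commute)
  qed
  finally show ?thesis .
qed

text \<open>
  The exponent c and the number e are common to all pairs of exponents; enlarging the exponent
  is possible because |s - t| \<le> 1.
\<close>

lemma overlap_upper:
  assumes a: "e \<le> a + 1" "a < 0" and b: "e \<le> b + 1" "b < 0" and e: "0 < e" and ab: "a + b < -1"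
    and st: "s \<noteq> t" "0 \<le> s" "s \<le> 1" "0 \<le> t" "t \<le> 1" and c: "- a - b - 1 \<le> c"
  shows "overlap a b s t \<le> ennreal (1 / (- a - b - 1) + 1 / e) * ennreal (\<bar>s - t\<bar> powr (- c))"
proof -
  have main: "overlap a b s t \<le> ennreal (1 / (- a - b - 1) + 1 / e) * ennreal (\<bar>s - t\<bar> powr (- c))"
    if "e \<le> a + 1" "a < 0" "e \<le> b + 1" "b < 0" "a + b < -1" "s < t" "0 \<le> s" "t \<le> 1" "- a - b - 1 \<le> c"
    for a b s t
  proof -
    have "overlap a b s t \<le> ennreal ((t - s) powr (1 + a + b) * (1 / (- a - b - 1) + 1 / (a + 1)))"
      using that e by (intro overlap_upper_less) auto
    also have "\<dots> \<le> ennreal ((t - s) powr (- c) * (1 / (- a - b - 1) + 1 / e))"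
      using that e
      by (intro ennreal_leI mult_mono powr_mono' add_left_mono divide_left_mono add_nonneg_nonneg) auto
    also have "\<dots> = ennreal (1 / (- a - b - 1) + 1 / e) * ennreal (\<bar>s - t\<bar> powr (- c))"
      using that e by (simp add: ennreal_mult mult.commute)
    finally show ?thesis .
  qed
  show ?thesis
  proof (cases "s < t")
    case True
    with main[of a b s t] assms show ?thesis by auto
  next
    case False
    have eq: "- b - a - 1 = - a - b - 1" by simp
    have "overlap b a t s \<le> ennreal (1 / (- b - a - 1) + 1 / e) * ennreal (\<bar>t - s\<bar> powr (- c))"
      by (rule main) (use False assms in auto)
    then show ?thesis unfolding eq overlap_commute[of a] abs_minus_commute[of s] .
  qed
qed

text \<open>
  The integral is (s^(1-p) + (1-s)^(1-p)) / (1-p), and Young's inequality bounds s^(1-p) by (1-p) s + p.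
  What matters is that the bound is 1 + O(p).
\<close>

lemma singular_mass:
  assumes p: "0 < p" "p < 1" and s: "0 \<le> s" "s \<le> 1"
  shows "unit_integral (\<lambda>u. ennreal (\<bar>s - u\<bar> powr (- p))) \<le> ennreal ((1 + p) / (1 - p))"
proof -
  let ?w = "\<lambda>d u. ennreal (u powr (- p)) * indicator {0..d} u"
  have young: "r powr (1 - p) \<le> (1 - p) * r + p" if "0 \<le> r" for r
    using Youngs_inequality_0[of "1 - p" p r 1] p that by (cases "r = 0") auto
  have "unit_integral (\<lambda>u. ennreal (\<bar>s - u\<bar> powr (- p)))
     \<le> (\<integral>\<^sup>+u. ?w s (s - u) + ?w (1 - s) (u - s) \<partial>lborel)"
    by (intro nn_integral_mono) (auto simp: indicator_def abs_if)
  also have "\<dots> = (\<integral>\<^sup>+u. ?w s (s - u) \<partial>lborel) + (\<integral>\<^sup>+u. ?w (1 - s) (u - s) \<partial>lborel)"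
    by (rule nn_integral_add) measurable
  also have "(\<integral>\<^sup>+u. ?w s (s - u) \<partial>lborel) = (\<integral>\<^sup>+u. ?w s u \<partial>lborel)"
    by (rule nn_integral_reflect) measurable
  also have "(\<integral>\<^sup>+u. ?w (1 - s) (u - s) \<partial>lborel) = (\<integral>\<^sup>+u. ?w (1 - s) u \<partial>lborel)"
    by (rule nn_integral_translate) measurable
  also have "(\<integral>\<^sup>+u. ?w s u \<partial>lborel) + (\<integral>\<^sup>+u. ?w (1 - s) u \<partial>lborel)
     = ennreal (s powr (1 - p) / (1 - p)) + ennreal ((1 - s) powr (1 - p) / (1 - p))"
    using nn_integral_powr_head[of "- p" s] nn_integral_powr_head[of "- p" "1 - s"] p s by simp
  also have "\<dots> = ennreal ((s powr (1 - p) + (1 - s) powr (1 - p)) / (1 - p))"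
    using p by (simp add: add_divide_distrib flip: ennreal_plus)
  also have "\<dots> \<le> ennreal ((1 + p) / (1 - p))"
  proof (intro ennreal_leI divide_right_mono)
    have "s powr (1 - p) + (1 - s) powr (1 - p) \<le> ((1 - p) * s + p) + ((1 - p) * (1 - s) + p)"
      using s by (intro add_mono young) auto
    then show "s powr (1 - p) + (1 - s) powr (1 - p) \<le> 1 + p" by (simp add: algebra_simps)
  qed (use p in auto)
  finally show ?thesis .
qed

text \<open>
  The kernel of the Rosenblatt variable as an extended real: it may be infinite on the diagonal.
\<close>

definition product_kernel :: "real \<Rightarrow> real \<Rightarrow> real \<Rightarrow> real \<Rightarrow> ennreal" where
  "product_kernel a b x y = (\<integral>\<^sup>+s. one_sided a s x * one_sided b s y * indicator {0..1} s \<partial>lborel)"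

lemma product_kernel_commute: "product_kernel a b x y = product_kernel b a y x"
  by (simp add: product_kernel_def mult.commute mult.left_commute)

lemma measurable_product_kernel:
  "(\<lambda>(x, y). product_kernel a b x y) \<in> borel_measurable plane"
  unfolding product_kernel_def by measurable

lemma rosenblatt_kernel_eq: "rosenblatt_kernel a b z = enn2real (product_kernel a b (fst z) (snd z))"
proof -
  have "rosenblatt_kernel a b z = (\<integral>s. indicator {0..1} s * (pos_powr (s - fst z) a * pos_powr (s - snd z) b) \<partial>lborel)"
    by (simp add: rosenblatt_kernel_def set_lebesgue_integral_def)
  also have "\<dots> = enn2real (\<integral>\<^sup>+s. ennreal (indicator {0..1} s * (pos_powr (s - fst z) a * pos_powr (s - snd z) b)) \<partial>lborel)"
    by (rule integral_eq_nn_integral) auto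
  also have "(\<integral>\<^sup>+s. ennreal (indicator {0..1} s * (pos_powr (s - fst z) a * pos_powr (s - snd z) b)) \<partial>lborel)
     = product_kernel a b (fst z) (snd z)"
    unfolding product_kernel_def one_sided_def
    by (intro nn_integral_cong) (auto simp: indicator_def ennreal_mult)
  finally show ?thesis .
qed

text \<open>
  If x < y, the first factor is bounded by (y - x) powr a wherever the second one does not vanish.
\<close>

lemma product_kernel_finite:
  assumes "-1 < a" "a < 0" "-1 < b" "b < 0" "x \<noteq> y"
  shows "product_kernel a b x y < \<infinity>"
proof -
  have main: "product_kernel a b x y < \<infinity>" if a: "a < 0" and b: "-1 < b" and xy: "x < y" for a b x y
  proof -
    let ?w = "\<lambda>u. ennreal (u powr b) * indicator {0..max 0 (1 - y)} u"
    have "product_kernel a b x y \<le> (\<integral>\<^sup>+s. ennreal ((y - x) powr a) * ?w (s - y) \<partial>lborel)"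
      unfolding product_kernel_def
    proof (rule nn_integral_mono)
      fix s
      show "one_sided a s x * one_sided b s y * indicator {0..1} s \<le> ennreal ((y - x) powr a) * ?w (s - y)"
      proof (cases "y < s \<and> s \<le> 1 \<and> 0 \<le> s")
        case True
        have "(s - x) powr a \<le> (y - x) powr a" using True xy a by (intro powr_mono2') auto
        then show ?thesis using True xy
          by (auto simp: one_sided_def pos_powr_def indicator_def intro!: mult_right_mono ennreal_leI)
      qed (auto simp: one_sided_def pos_powr_def indicator_def)
    qed
    also have "\<dots> = ennreal ((y - x) powr a) * (\<integral>\<^sup>+s. ?w (s - y) \<partial>lborel)"
      by (rule nn_integral_cmult) measurable
    also have "(\<integral>\<^sup>+s. ?w (s - y) \<partial>lborel) = (\<integral>\<^sup>+u. ?w u \<partial>lborel)"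
      by (rule nn_integral_translate) measurable
    also have "\<dots> = ennreal (max 0 (1 - y) powr (b + 1) / (b + 1))"
      using b by (intro nn_integral_powr_head) auto
    finally show ?thesis by (rule le_less_trans) (simp add: ennreal_mult_less_top)
  qed
  show ?thesis
    using main[of a b x y] main[of b a y x] assms by (cases "x < y") (auto simp: product_kernel_commute[of a])
qed

lemma product_kernel_lsc:
  assumes "u \<longlonglongrightarrow> x" "v \<longlonglongrightarrow> y"
  shows "product_kernel a b x y \<le> liminf (\<lambda>j. product_kernel a b (u j) (v j))"
proof -
  let ?I = "\<lambda>x y s. one_sided a s x * one_sided b s y * indicator {0..1} s"
  have "AE s in lborel. s \<noteq> x" "AE s in lborel. s \<noteq> y" by (auto intro: AE_lborel_singleton)
  then have "AE s in lborel. ?I x y s = liminf (\<lambda>j. ?I (u j) (v j) s)"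
  proof eventually_elim
    case (elim s)
    let ?r = "\<lambda>x y. pos_powr (s - x) a * pos_powr (s - y) b * indicator {0..1} s"
    have eq: "?I x y s = ennreal (?r x y)" for x y
      by (simp add: one_sided_def indicator_def ennreal_mult)
    have "(\<lambda>j. ?r (u j) (v j)) \<longlonglongrightarrow> ?r x y"
      using elim assms by (intro tendsto_intros pos_powr_tendsto) auto
    then have "(\<lambda>j. ennreal (?r (u j) (v j))) \<longlonglongrightarrow> ennreal (?r x y)"
      by (rule tendsto_ennrealI)
    from lim_imp_Liminf[OF sequentially_bot this] show ?case unfolding eq by simp
  qed
  then have "product_kernel a b x y = (\<integral>\<^sup>+s. liminf (\<lambda>j. ?I (u j) (v j) s) \<partial>lborel)"
    unfolding product_kernel_def by (rule nn_integral_cong_AE)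
  also have "\<dots> \<le> liminf (\<lambda>j. \<integral>\<^sup>+s. ?I (u j) (v j) s \<partial>lborel)"
    by (rule nn_integral_liminf) measurable
  finally show ?thesis unfolding product_kernel_def .
qed

section \<open>Expansion of the trace\<close>

text \<open>
  The two exponents are indexed by bool, so that the symmetrization becomes a sum
  over bool in which negation exchanges the exponents.
\<close>

definition sym_kernel :: "(bool \<Rightarrow> real) \<Rightarrow> real \<Rightarrow> real \<Rightarrow> ennreal" where
  "sym_kernel \<gamma> x y = (product_kernel (\<gamma> True) (\<gamma> False) x y + product_kernel (\<gamma> True) (\<gamma> False) y x) / 2"

text \<open>
  The inner product of (s - x)_+^(\<gamma> i) with the n-th power of the kernel in its first variable.
\<close>

fun smear :: "(bool \<Rightarrow> real) \<Rightarrow> nat \<Rightarrow> bool \<Rightarrow> real \<Rightarrow> real \<Rightarrow> ennreal" where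
  "smear \<gamma> 0 i s y = one_sided (\<gamma> i) s y"
| "smear \<gamma> (Suc n) i s y =
     (unit_integral (\<lambda>u. \<Sum>l\<in>UNIV. overlap (\<gamma> i) (\<gamma> l) s u * smear \<gamma> n (\<not> l) u y)) / 2"

text \<open>
  The inner product of smear with (t - y)_+^(\<gamma> j), that is a chain of n + 1 overlaps with
  n intermediate points.
\<close>

fun overlap_chain :: "(bool \<Rightarrow> real) \<Rightarrow> nat \<Rightarrow> bool \<Rightarrow> bool \<Rightarrow> real \<Rightarrow> real \<Rightarrow> ennreal" where
  "overlap_chain \<gamma> 0 i j s t = overlap (\<gamma> i) (\<gamma> j) s t"
| "overlap_chain \<gamma> (Suc n) i j s t =
     (unit_integral (\<lambda>u. \<Sum>l\<in>UNIV. overlap (\<gamma> i) (\<gamma> l) s u * overlap_chain \<gamma> n (\<not> l) j u t)) / 2"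

lemma measurable_overlap [measurable (raw)]:
  assumes [measurable]: "f \<in> borel_measurable M" "g \<in> borel_measurable M"
  shows "(\<lambda>w. overlap a b (f w) (g w)) \<in> borel_measurable M"
  unfolding overlap_def by measurable

lemma measurable_smear_pair: "(\<lambda>p. smear \<gamma> n i (fst p) (snd p)) \<in> borel_measurable plane"
proof (induction n arbitrary: i)
  case (Suc n)
  have [measurable]: "(\<lambda>q :: (real \<times> real) \<times> real. smear \<gamma> n l (snd q) (snd (fst q)))
      \<in> borel_measurable (plane \<Otimes>\<^sub>M lborel)" for l
    using measurable_compose[OF _ Suc, of "\<lambda>q. (snd q, snd (fst q))" "plane \<Otimes>\<^sub>M lborel"]
    by simp
  show ?case unfolding smear.simps by measurable
qed (unfold smear.simps, measurable)

lemma measurable_smear [measurable (raw)]: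
  assumes "f \<in> borel_measurable M" "g \<in> borel_measurable M"
  shows "(\<lambda>w. smear \<gamma> n i (f w) (g w)) \<in> borel_measurable M"
proof -
  have "(\<lambda>w. (f w, g w)) \<in> measurable M plane" using assms by measurable
  from measurable_compose[OF this measurable_smear_pair] show ?thesis by simp
qed

lemma measurable_sym_kernel: "(\<lambda>(x, y). sym_kernel \<gamma> x y) \<in> borel_measurable plane"
  unfolding sym_kernel_def product_kernel_def by measurable

lemma measurable_sym_kernel_power [measurable (raw)]:
  assumes "f \<in> borel_measurable M" "g \<in> borel_measurable M"
  shows "(\<lambda>w. kernel_power (sym_kernel \<gamma>) n (f w) (g w)) \<in> borel_measurable M"
proof -
  have "(\<lambda>w. (f w, g w)) \<in> measurable M plane" using assms by measurable
  from measurable_compose[OF this measurable_kernel_power[OF measurable_sym_kernel]] show ?thesis by simp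
qed

lemmas measurable_sym_kernel_fun [measurable (raw)] =
  measurable_sym_kernel_power[where n = 0, unfolded kernel_power.simps]

lemma sym_kernel_commute: "sym_kernel \<gamma> x y = sym_kernel \<gamma> y x"
  by (simp add: sym_kernel_def add.commute)

lemma sym_kernel_sum:
  "sym_kernel \<gamma> x y = unit_integral (\<lambda>u. \<Sum>l\<in>UNIV. one_sided (\<gamma> l) u x * one_sided (\<gamma> (\<not> l)) u y) / 2"
  unfolding sym_kernel_def product_kernel_def
  by (subst nn_integral_add[symmetric]) (auto simp: UNIV_bool algebra_simps intro!: arg_cong[where f = "\<lambda>x. x / 2"] nn_integral_cong)

text \<open>
  The product kernel is at most twice the symmetrized one, and the trace of the square of the latter is its
  squared norm.
\<close>

lemma product_kernel_square_integrable:
  assumes "kernel_trace (sym_kernel \<gamma>) 2 < \<infinity>"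
  shows "(\<integral>\<^sup>+x. \<integral>\<^sup>+y. (product_kernel (\<gamma> True) (\<gamma> False) x y)\<^sup>2 \<partial>lborel \<partial>lborel) < \<infinity>"
proof -
  let ?k = "product_kernel (\<gamma> True) (\<gamma> False)" and ?K = "sym_kernel \<gamma>"
  have "(?k x y)\<^sup>2 \<le> 4 * (?K x y * ?K x y)" for x y
  proof -
    have "2 * ?K x y = (?k x y + ?k y x) * 2 / 2"
      by (simp only: sym_kernel_def ennreal_times_divide mult.commute)
    also have "\<dots> = ?k x y + ?k y x" by (rule mult_divide_eq_ennreal) simp_all
    finally have "?k x y \<le> 2 * ?K x y" by simp
    then have "(?k x y)\<^sup>2 \<le> (2 * ?K x y)\<^sup>2" by (rule power_mono) simp
    then show ?thesis by (simp add: power2_eq_square mult_ac)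
  qed
  then have "(\<integral>\<^sup>+x. \<integral>\<^sup>+y. (?k x y)\<^sup>2 \<partial>lborel \<partial>lborel)
      \<le> (\<integral>\<^sup>+x. \<integral>\<^sup>+y. 4 * (?K x y * ?K x y) \<partial>lborel \<partial>lborel)"
    by (intro nn_integral_mono)
  also have "\<dots> = 4 * kernel_trace ?K 2"
    by (simp add: kernel_trace_def nn_integral_cmult)
  also have "\<dots> < \<infinity>" using assms by (simp add: ennreal_mult_less_top)
  finally show ?thesis .
qed

text \<open>
  The one application of Tonelli's theorem behind all computations of this section: an integration in
  the space variable is carried out under the integral over the parameter u.
\<close>

lemma nn_integral_half_sum:
  fixes A :: "bool \<Rightarrow> real \<Rightarrow> ennreal" and F :: "bool \<Rightarrow> real \<Rightarrow> real \<Rightarrow> ennreal" and C :: "real \<Rightarrow> ennreal"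
  assumes A: "\<And>l. A l \<in> borel_measurable borel" and C: "C \<in> borel_measurable borel"
    and F: "\<And>l. (\<lambda>(u, z). F l u z) \<in> borel_measurable plane"
  shows "(\<integral>\<^sup>+z. C z * (unit_integral (\<lambda>u. \<Sum>l\<in>UNIV. A l u * F l u z) / 2) \<partial>lborel)
    = unit_integral (\<lambda>u. \<Sum>l\<in>UNIV. A l u * (\<integral>\<^sup>+z. C z * F l u z \<partial>lborel)) / 2"
proof -
  note [measurable] = A C F
  let ?S = "\<lambda>u z. \<Sum>l\<in>UNIV. A l u * F l u z"
  have F1 [measurable]: "(\<lambda>z. F l u z) \<in> borel_measurable borel" for l u
    using measurable_compose[OF _ F[of l], of "\<lambda>z. (u, z)" borel] by simp
  have F2 [measurable]: "(\<lambda>u. F l u z) \<in> borel_measurable borel" for l z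
    using measurable_compose[OF _ F[of l], of "\<lambda>u. (u, z)" borel] by simp
  have F3 [measurable]: "(\<lambda>p. F l (fst p) (snd p)) \<in> borel_measurable plane" for l
    using F[of l] by (simp add: split_beta')
  have "(\<integral>\<^sup>+z. C z * (unit_integral (\<lambda>u. (?S u z)) / 2) \<partial>lborel)
    = (\<integral>\<^sup>+z. (\<integral>\<^sup>+u. C z * ((?S u z) * indicator {0..1} u) \<partial>lborel) / 2 \<partial>lborel)"
    by (intro nn_integral_cong) (simp add: nn_integral_cmult ennreal_times_divide)
  also have "\<dots> = (\<integral>\<^sup>+z. (\<integral>\<^sup>+u. C z * ((?S u z) * indicator {0..1} u) \<partial>lborel) \<partial>lborel) / 2"
  proof (rule nn_integral_divide)
    have "(\<lambda>(z, u). C z * ((?S u z) * indicator {0..1} u)) \<in> borel_measurable plane"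
    proof -
      have [measurable]: "(\<lambda>p. F l (snd p) (fst p)) \<in> borel_measurable plane" for l
        using measurable_compose[OF _ F[of l], of "\<lambda>p. (snd p, fst p)" "plane"] by simp
      show ?thesis unfolding split_beta' by measurable
    qed
    then show "(\<lambda>z. \<integral>\<^sup>+u. C z * ((?S u z) * indicator {0..1} u) \<partial>lborel) \<in> borel_measurable lborel"
      by (rule lborel.borel_measurable_nn_integral)
  qed
  also have "(\<integral>\<^sup>+z. (\<integral>\<^sup>+u. C z * ((?S u z) * indicator {0..1} u) \<partial>lborel) \<partial>lborel)
    = (\<integral>\<^sup>+u. (\<integral>\<^sup>+z. C z * ((?S u z) * indicator {0..1} u) \<partial>lborel) \<partial>lborel)"
    by (rule lborel_pair.Fubini') (simp add: split_beta')
  also have "\<dots> = unit_integral (\<lambda>u. \<Sum>l\<in>UNIV. A l u * (\<integral>\<^sup>+z. C z * F l u z \<partial>lborel))"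
  proof (intro nn_integral_cong)
    fix u
    have "(\<integral>\<^sup>+z. C z * ((?S u z) * indicator {0..1} u) \<partial>lborel)
      = (\<integral>\<^sup>+z. (\<Sum>l\<in>UNIV. A l u * (C z * F l u z)) * indicator {0..1} u \<partial>lborel)"
      by (intro nn_integral_cong) (simp only: sum_distrib_left sum_distrib_right mult_ac)
    also have "\<dots> = (\<Sum>l\<in>UNIV. A l u * (\<integral>\<^sup>+z. C z * F l u z \<partial>lborel)) * indicator {0..1} u"
      by (simp add: nn_integral_multc nn_integral_sum nn_integral_cmult)
    finally show "(\<integral>\<^sup>+z. C z * ((?S u z) * indicator {0..1} u) \<partial>lborel)
      = (\<Sum>l\<in>UNIV. A l u * (\<integral>\<^sup>+z. C z * F l u z \<partial>lborel)) * indicator {0..1} u" .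
  qed
  finally show ?thesis .
qed

text \<open>
  Expand the first factor of the power and integrate out the intermediate space variable; the
  inner products with the remaining power are again of the form smear.
\<close>

lemma kernel_power_smear:
  "kernel_power (sym_kernel \<gamma>) n x y
    = unit_integral (\<lambda>u. \<Sum>l\<in>UNIV. one_sided (\<gamma> l) u x * smear \<gamma> n (\<not> l) u y) / 2"
proof (induction n arbitrary: x)
  case 0
  show ?case by (simp add: sym_kernel_sum)
next
  case (Suc n)
  have sm: "(\<integral>\<^sup>+z. one_sided (\<gamma> i) s z * kernel_power (sym_kernel \<gamma>) n z y \<partial>lborel) = smear \<gamma> (Suc n) i s y" for i s
  proof -
    have "(\<integral>\<^sup>+z. one_sided (\<gamma> i) s z * kernel_power (sym_kernel \<gamma>) n z y \<partial>lborel)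
      = (\<integral>\<^sup>+z. one_sided (\<gamma> i) s z * (unit_integral (\<lambda>u. \<Sum>l\<in>UNIV. smear \<gamma> n (\<not> l) u y * one_sided (\<gamma> l) u z) / 2) \<partial>lborel)"
      unfolding Suc.IH by (simp only: mult.commute)
    also have "\<dots> = unit_integral (\<lambda>u. \<Sum>l\<in>UNIV. smear \<gamma> n (\<not> l) u y * (\<integral>\<^sup>+z. one_sided (\<gamma> i) s z * one_sided (\<gamma> l) u z \<partial>lborel)) / 2"
      by (rule nn_integral_half_sum) measurable
    finally show ?thesis by (simp add: overlap_def mult.commute)
  qed
  have "kernel_power (sym_kernel \<gamma>) (Suc n) x y
    = (\<integral>\<^sup>+z. kernel_power (sym_kernel \<gamma>) n z y * (unit_integral (\<lambda>u. \<Sum>l\<in>UNIV. one_sided (\<gamma> l) u x * one_sided (\<gamma> (\<not> l)) u z) / 2) \<partial>lborel)"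
    unfolding kernel_power.simps sym_kernel_sum[symmetric] by (simp only: mult.commute)
  also have "\<dots> = unit_integral (\<lambda>u. \<Sum>l\<in>UNIV. one_sided (\<gamma> l) u x * (\<integral>\<^sup>+z. kernel_power (sym_kernel \<gamma>) n z y * one_sided (\<gamma> (\<not> l)) u z \<partial>lborel)) / 2"
    by (rule nn_integral_half_sum) measurable
  also have "\<dots> = unit_integral (\<lambda>u. \<Sum>l\<in>UNIV. one_sided (\<gamma> l) u x * smear \<gamma> (Suc n) (\<not> l) u y) / 2"
    by (simp only: mult.commute[of "kernel_power _ _ _ _"] sm)
  finally show ?case .
qed

lemma smear_overlap:
  "(\<integral>\<^sup>+y. one_sided (\<gamma> j) t y * smear \<gamma> n i s y \<partial>lborel) = overlap_chain \<gamma> n i j s t"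
proof (induction n arbitrary: i s)
  case 0
  show ?case by (simp add: overlap_def mult.commute)
next
  case (Suc n)
  have "(\<integral>\<^sup>+y. one_sided (\<gamma> j) t y * smear \<gamma> (Suc n) i s y \<partial>lborel)
    = unit_integral (\<lambda>u. \<Sum>l\<in>UNIV. overlap (\<gamma> i) (\<gamma> l) s u * (\<integral>\<^sup>+y. one_sided (\<gamma> j) t y * smear \<gamma> n (\<not> l) u y \<partial>lborel)) / 2"
    unfolding smear.simps by (rule nn_integral_half_sum) measurable
  then show ?case by (simp only: Suc.IH overlap_chain.simps)
qed

text \<open>
  Closing the chain: the trace is the integral of the kernel power over the diagonal.
\<close>

lemma kernel_trace_overlap_chain:
  assumes m: "2 \<le> m"
  shows "kernel_trace (sym_kernel \<gamma>) m
    = unit_integral (\<lambda>u. \<Sum>l\<in>UNIV. overlap_chain \<gamma> (m - 1) (\<not> l) l u u) / 2"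
proof -
  have m1: "m - 1 = Suc (m - 2)" using m by simp
  have "kernel_trace (sym_kernel \<gamma>) m = (\<integral>\<^sup>+y. \<integral>\<^sup>+x. sym_kernel \<gamma> x y * kernel_power (sym_kernel \<gamma>) (m - 2) x y \<partial>lborel \<partial>lborel)"
    unfolding kernel_trace_def
  proof (rule lborel_pair.Fubini')
    show "(\<lambda>(y, x). sym_kernel \<gamma> x y * kernel_power (sym_kernel \<gamma>) (m - 2) x y) \<in> borel_measurable plane"
      unfolding split_beta' by measurable
  qed
  also have "\<dots> = (\<integral>\<^sup>+y. kernel_power (sym_kernel \<gamma>) (m - 1) y y \<partial>lborel)"
    unfolding m1 kernel_power.simps by (simp only: sym_kernel_commute[of \<gamma> _ y for y])
  also have "\<dots> = (\<integral>\<^sup>+y. 1 * (unit_integral (\<lambda>u. \<Sum>l\<in>UNIV. 1 * (one_sided (\<gamma> l) u y * smear \<gamma> (m - 1) (\<not> l) u y)) / 2) \<partial>lborel)"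
    by (simp only: kernel_power_smear mult_1_left)
  also have "\<dots> = unit_integral (\<lambda>u. \<Sum>l\<in>UNIV. 1 * (\<integral>\<^sup>+y. 1 * (one_sided (\<gamma> l) u y * smear \<gamma> (m - 1) (\<not> l) u y) \<partial>lborel)) / 2"
    by (rule nn_integral_half_sum) measurable
  finally show ?thesis by (simp only: mult_1_left smear_overlap)
qed

section \<open>Comparison with constant matrices\<close>

text \<open>
  What overlap_chain becomes if the overlaps are replaced by constants. If S is the matrix exchanging the two
  indices, this is the entry (i, j) of (\<beta> S / 2)^n \<beta>.
\<close>

fun matrix_chain :: "(bool \<Rightarrow> bool \<Rightarrow> real) \<Rightarrow> nat \<Rightarrow> bool \<Rightarrow> bool \<Rightarrow> real" where
  "matrix_chain \<beta> 0 i j = \<beta> i j"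
| "matrix_chain \<beta> (Suc n) i j = (\<Sum>l\<in>UNIV. \<beta> i l * matrix_chain \<beta> n (\<not> l) j) / 2"

definition matrix_trace :: "(bool \<Rightarrow> bool \<Rightarrow> real) \<Rightarrow> nat \<Rightarrow> real" where
  "matrix_trace \<beta> m = (\<Sum>l\<in>UNIV. matrix_chain \<beta> (m - 1) (\<not> l) l) / 2"

lemma matrix_chain_nonneg: "(\<And>i j. 0 \<le> \<beta> i j) \<Longrightarrow> 0 \<le> matrix_chain \<beta> n i j"
  by (induction n arbitrary: i) (auto intro!: sum_nonneg)

lemma ennreal_half_sum:
  assumes "\<And>l. 0 \<le> a l" "\<And>l. 0 \<le> b l"
  shows "ennreal ((\<Sum>l\<in>(UNIV :: bool set). a l * b l) / 2) = (\<Sum>l\<in>UNIV. ennreal (a l) * ennreal (b l)) / 2"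
proof -
  have "(\<Sum>l\<in>UNIV. ennreal (a l) * ennreal (b l)) = ennreal (\<Sum>l\<in>UNIV. a l * b l)"
    using assms by (simp add: UNIV_bool ennreal_mult ennreal_plus)
  then show ?thesis using assms by (simp add: sum_nonneg divide_ennreal flip: ennreal_numeral)
qed

lemma nn_integral_unit_const: "unit_integral (\<lambda>u. c) = (c :: ennreal)"
  by (simp add: nn_integral_cmult)

lemma overlap_chain_lower:
  assumes b: "\<And>i j. 0 \<le> \<beta> i j"
    and low: "\<And>i j s t. s \<in> {0..1} \<Longrightarrow> t \<in> {0..1} \<Longrightarrow> ennreal (\<beta> i j) \<le> overlap (\<gamma> i) (\<gamma> j) s t"
    and "s \<in> {0..1}" "t \<in> {0..1}"
  shows "ennreal (matrix_chain \<beta> n i j) \<le> overlap_chain \<gamma> n i j s t"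
  using assms(3)
proof (induction n arbitrary: i s)
  case (Suc n)
  let ?C = "\<Sum>l\<in>UNIV. ennreal (\<beta> i l) * ennreal (matrix_chain \<beta> n (\<not> l) j)"
  have "ennreal (matrix_chain \<beta> (Suc n) i j) = unit_integral (\<lambda>u. ?C) / 2"
    unfolding matrix_chain.simps nn_integral_unit_const
    by (intro ennreal_half_sum b matrix_chain_nonneg)
  also have "\<dots> \<le> overlap_chain \<gamma> (Suc n) i j s t"
    unfolding overlap_chain.simps
  proof (intro divide_right_mono_ennreal nn_integral_mono)
    fix u :: real
    show "?C * indicator {0..1} u \<le> (\<Sum>l\<in>UNIV. overlap (\<gamma> i) (\<gamma> l) s u * overlap_chain \<gamma> n (\<not> l) j u t) * indicator {0..1} u"
    proof (cases "u \<in> {0..1}")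
      case True
      then show ?thesis using Suc.prems
        by (intro mult_right_mono sum_mono mult_mono low Suc.IH) auto
    qed simp
  qed
  finally show ?case .
qed (use low assms(4) in simp)

context
  fixes \<gamma> :: "bool \<Rightarrow> real" and \<beta> :: "bool \<Rightarrow> bool \<Rightarrow> real" and c :: real
  assumes b: "\<And>i j. 0 \<le> \<beta> i j" and c: "0 < c" "2 * c < 1"
    and up: "\<And>i j s t. s \<in> {0..1} \<Longrightarrow> t \<in> {0..1} \<Longrightarrow> s \<noteq> t \<Longrightarrow>
        overlap (\<gamma> i) (\<gamma> j) s t \<le> ennreal (\<beta> i j) * ennreal (\<bar>s - t\<bar> powr (- c))"
begin

lemma singular_mass_square:
  assumes "s \<in> {0..1}"
  shows "unit_integral (\<lambda>u. ennreal (\<bar>s - u\<bar> powr (- (2 * c)))) \<le> ennreal ((1 + 2 * c) / (1 - 2 * c))"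
  using assms c by (intro singular_mass) auto

text \<open>
  The inequality a b \<le> (a^2 + b^2) / 2 separates the two singularities at the end points. The resulting bound is
  uniform in s and t, including s = t, where the overlap itself is infinite.
\<close>

lemma overlap_chain_upper_Suc_0:
  assumes s: "s \<in> {0..1}" and t: "t \<in> {0..1}"
  shows "overlap_chain \<gamma> (Suc 0) i j s t \<le> ennreal ((1 + 2 * c) / (1 - 2 * c) * matrix_chain \<beta> (Suc 0) i j)"
proof -
  let ?f = "\<lambda>u. \<Sum>l\<in>UNIV. overlap (\<gamma> i) (\<gamma> l) s u * overlap (\<gamma> (\<not> l)) (\<gamma> j) u t"
  let ?J = "(1 + 2 * c) / (1 - 2 * c)"
  have J: "0 \<le> ?J" using c by simp
  let ?C = "\<Sum>l\<in>UNIV. ennreal (\<beta> i l) * ennreal (\<beta> (\<not> l) j)"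
  let ?w = "\<lambda>s u. ennreal (\<bar>s - u\<bar> powr (- (2 * c))) * indicator {0..1} u"
  have "unit_integral (\<lambda>u. (?f u))
     \<le> (\<integral>\<^sup>+u. ?C * ((?w s u + ?w t u) / 2) \<partial>lborel)"
  proof (rule nn_integral_mono_AE)
    have "AE u in lborel. u \<noteq> s" "AE u in lborel. u \<noteq> t" by (auto intro: AE_lborel_singleton)
    then show "AE u in lborel. (?f u) * indicator {0..1} u
        \<le> ?C * ((?w s u + ?w t u) / 2)"
    proof eventually_elim
      case (elim u)
      show ?case
      proof (cases "u \<in> {0..1}")
        case True
        let ?a = "\<bar>s - u\<bar> powr (- c)" and ?b = "\<bar>u - t\<bar> powr (- c)"
        have "(?f u)
          \<le> (\<Sum>l\<in>UNIV. (ennreal (\<beta> i l) * ennreal ?a) * (ennreal (\<beta> (\<not> l) j) * ennreal ?b))"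
          using True s t elim by (intro sum_mono mult_mono up) auto
        also have "\<dots> = ?C * (ennreal ?a * ennreal ?b)"
          by (simp only: sum_distrib_left sum_distrib_right mult_ac)
        also have "ennreal ?a * ennreal ?b \<le> (?w s u + ?w t u) / 2"
        proof -
          have sq: "r powr (- (2 * c)) = (r powr (- c))\<^sup>2" for r :: real
            by (simp add: power2_eq_square flip: powr_add)
          have "0 \<le> (?a - ?b)\<^sup>2" by simp
          then have "?a * ?b \<le> (?a\<^sup>2 + ?b\<^sup>2) / 2" by (simp add: power2_eq_square algebra_simps)
          then have "ennreal (?a * ?b) \<le> ennreal ((?a\<^sup>2 + ?b\<^sup>2) / 2)" by (rule ennreal_leI)
          also have "\<dots> = (ennreal (?a\<^sup>2) + ennreal (?b\<^sup>2)) / 2"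
            by (simp flip: ennreal_plus ennreal_numeral add: divide_ennreal)
          finally show ?thesis using True by (simp add: ennreal_mult sq abs_minus_commute)
        qed
        finally show ?thesis using True by (simp add: mult_left_mono)
      qed simp
    qed
  qed
  also have "\<dots> = ?C * (((\<integral>\<^sup>+u. ?w s u \<partial>lborel) + (\<integral>\<^sup>+u. ?w t u \<partial>lborel)) / 2)"
    by (simp add: nn_integral_cmult nn_integral_divide nn_integral_add)
  also have "\<dots> \<le> ?C * ((ennreal ?J + ennreal ?J) / 2)"
    using s t by (intro mult_left_mono divide_right_mono_ennreal add_mono singular_mass_square) auto
  also have "(ennreal ?J + ennreal ?J) / 2 = ennreal ?J"
    by (simp add: mult_2_right[symmetric] mult_divide_eq_ennreal)
  finally have "overlap_chain \<gamma> (Suc 0) i j s t \<le> (?C * ennreal ?J) / 2"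
    by (simp add: divide_right_mono_ennreal)
  also have "\<dots> = ennreal ?J * (?C / 2)"
    by (simp add: ennreal_times_divide mult.commute)
  also have "?C / 2 = ennreal (matrix_chain \<beta> (Suc 0) i j)"
    unfolding matrix_chain.simps by (intro ennreal_half_sum[symmetric] b)
  finally show ?thesis using J matrix_chain_nonneg[of \<beta> "Suc 0", OF b] by (simp only: ennreal_mult)
qed

text \<open>
  Once one intermediate point has been integrated out the chain is bounded uniformly, so each further
  point meets a single singularity.
\<close>

lemma overlap_chain_upper:
  assumes "s \<in> {0..1}" and t: "t \<in> {0..1}"
  shows "overlap_chain \<gamma> (Suc n) i j s t \<le> ennreal (((1 + 2 * c) / (1 - 2 * c)) ^ Suc n * matrix_chain \<beta> (Suc n) i j)"
  using assms(1)
proof (induction n arbitrary: i s)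
  case 0
  then show ?case using overlap_chain_upper_Suc_0[OF 0 t] by simp
next
  case (Suc n)
  let ?f = "\<lambda>u. \<Sum>l\<in>UNIV. overlap (\<gamma> i) (\<gamma> l) s u * overlap_chain \<gamma> (Suc n) (\<not> l) j u t"
  let ?J = "(1 + 2 * c) / (1 - 2 * c)"
  have J: "0 \<le> ?J" using c by simp
  let ?C = "\<Sum>l\<in>UNIV. ennreal (\<beta> i l) * ennreal (?J ^ Suc n * matrix_chain \<beta> (Suc n) (\<not> l) j)"
  let ?w = "\<lambda>s u. ennreal (\<bar>s - u\<bar> powr (- (2 * c))) * indicator {0..1} u"
  have nn: "0 \<le> ?J ^ Suc n * matrix_chain \<beta> (Suc n) l j" for l
    by (intro mult_nonneg_nonneg zero_le_power J matrix_chain_nonneg b)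
  have "unit_integral (\<lambda>u. (?f u))
     \<le> (\<integral>\<^sup>+u. ?C * ?w s u \<partial>lborel)"
  proof (rule nn_integral_mono_AE)
    have "AE u in lborel. u \<noteq> s" by (rule AE_lborel_singleton)
    then show "AE u in lborel. (?f u) * indicator {0..1} u
        \<le> ?C * ?w s u"
    proof eventually_elim
      case (elim u)
      show ?case
      proof (cases "u \<in> {0..1}")
        case True
        have "(?f u)
          \<le> (\<Sum>l\<in>UNIV. (ennreal (\<beta> i l) * ennreal (\<bar>s - u\<bar> powr (- c))) * ennreal (?J ^ Suc n * matrix_chain \<beta> (Suc n) (\<not> l) j))"
          using True Suc.prems elim by (intro sum_mono mult_mono up Suc.IH) auto
        also have "\<dots> = ?C * ennreal (\<bar>s - u\<bar> powr (- c))"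
          by (simp only: sum_distrib_left sum_distrib_right mult_ac)
        also have "\<dots> \<le> ?C * ennreal (\<bar>s - u\<bar> powr (- (2 * c)))"
          using True Suc.prems c by (intro mult_left_mono ennreal_leI powr_mono') auto
        finally show ?thesis using True by simp
      qed simp
    qed
  qed
  also have "\<dots> = ?C * (\<integral>\<^sup>+u. ?w s u \<partial>lborel)"
    by (rule nn_integral_cmult) measurable
  also have "\<dots> \<le> ?C * ennreal ?J"
    using Suc.prems by (intro mult_left_mono singular_mass_square) auto
  finally have "overlap_chain \<gamma> (Suc (Suc n)) i j s t \<le> (?C * ennreal ?J) / 2"
    unfolding overlap_chain.simps(2)[of _ "Suc n"] by (rule divide_right_mono_ennreal)
  also have "\<dots> = ennreal ?J * (?C / 2)"
    by (simp only: ennreal_times_divide mult.commute)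
  also have "?C / 2 = ennreal ((\<Sum>l\<in>UNIV. \<beta> i l * (?J ^ Suc n * matrix_chain \<beta> (Suc n) (\<not> l) j)) / 2)"
    by (intro ennreal_half_sum[symmetric] b nn)
  also have "(\<Sum>l\<in>UNIV. \<beta> i l * (?J ^ Suc n * matrix_chain \<beta> (Suc n) (\<not> l) j)) / 2
      = ?J ^ Suc n * matrix_chain \<beta> (Suc (Suc n)) i j"
    unfolding matrix_chain.simps(2)[of _ "Suc n"] times_divide_eq_right sum_distrib_left
    by (simp only: mult_ac)
  also have "ennreal ?J * ennreal (?J ^ Suc n * matrix_chain \<beta> (Suc (Suc n)) i j)
     = ennreal (?J ^ Suc (Suc n) * matrix_chain \<beta> (Suc (Suc n)) i j)"
    using J matrix_chain_nonneg[of \<beta> "Suc (Suc n)", OF b]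
    by (subst ennreal_mult[symmetric]) (simp_all only: power_Suc mult_ac mult_nonneg_nonneg zero_le_power)
  finally show ?case .
qed

lemma kernel_trace_upper:
  assumes m: "2 \<le> m"
  shows "kernel_trace (sym_kernel \<gamma>) m \<le> ennreal (((1 + 2 * c) / (1 - 2 * c)) ^ (m - 1) * matrix_trace \<beta> m)"
proof -
  let ?J = "((1 + 2 * c) / (1 - 2 * c)) ^ (m - 1)"
  have J: "0 \<le> ?J" using c by (intro zero_le_power) auto
  have m1: "m - 1 = Suc (m - 2)" using m by simp
  let ?C = "\<Sum>l\<in>UNIV. ennreal ?J * ennreal (matrix_chain \<beta> (m - 1) (\<not> l) l)"
  have "kernel_trace (sym_kernel \<gamma>) m \<le> unit_integral (\<lambda>u. ?C) / 2"
    unfolding kernel_trace_overlap_chain[OF m]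
  proof (intro divide_right_mono_ennreal nn_integral_mono)
    fix u :: real
    show "(\<Sum>l\<in>UNIV. overlap_chain \<gamma> (m - 1) (\<not> l) l u u) * indicator {0..1} u \<le> ?C * indicator {0..1} u"
    proof (cases "u \<in> {0..1}")
      case True
      have "overlap_chain \<gamma> (m - 1) (\<not> l) l u u \<le> ennreal ?J * ennreal (matrix_chain \<beta> (m - 1) (\<not> l) l)" for l
        using overlap_chain_upper[OF True True, of "m - 2" "\<not> l" l] J matrix_chain_nonneg[of \<beta>, OF b]
        unfolding m1 by (simp only: ennreal_mult)
      then show ?thesis by (intro mult_right_mono sum_mono) auto
    qed simp
  qed
  also have "\<dots> = ennreal ((\<Sum>l\<in>UNIV. ?J * matrix_chain \<beta> (m - 1) (\<not> l) l) / 2)"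
    unfolding nn_integral_unit_const
    by (intro ennreal_half_sum[symmetric] J matrix_chain_nonneg b)
  also have "(\<Sum>l\<in>UNIV. ?J * matrix_chain \<beta> (m - 1) (\<not> l) l) / 2 = ?J * matrix_trace \<beta> m"
    by (simp only: matrix_trace_def sum_distrib_left times_divide_eq_right)
  finally show ?thesis .
qed

end

lemma kernel_trace_lower:
  assumes b: "\<And>i j. 0 \<le> \<beta> i j"
    and low: "\<And>i j s t. s \<in> {0..1} \<Longrightarrow> t \<in> {0..1} \<Longrightarrow> ennreal (\<beta> i j) \<le> overlap (\<gamma> i) (\<gamma> j) s t"
    and m: "2 \<le> m"
  shows "ennreal (matrix_trace \<beta> m) \<le> kernel_trace (sym_kernel \<gamma>) m"
proof -
  let ?C = "\<Sum>l\<in>UNIV. ennreal 1 * ennreal (matrix_chain \<beta> (m - 1) (\<not> l) l)"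
  have "ennreal (matrix_trace \<beta> m) = ennreal ((\<Sum>l\<in>UNIV. 1 * matrix_chain \<beta> (m - 1) (\<not> l) l) / 2)"
    by (simp only: matrix_trace_def mult_1_left)
  also have "\<dots> = unit_integral (\<lambda>u. ?C) / 2"
    unfolding nn_integral_unit_const by (intro ennreal_half_sum matrix_chain_nonneg b) simp
  also have "\<dots> \<le> kernel_trace (sym_kernel \<gamma>) m"
    unfolding kernel_trace_overlap_chain[OF m]
  proof (intro divide_right_mono_ennreal nn_integral_mono)
    fix u :: real
    show "?C * indicator {0..1} u \<le> (\<Sum>l\<in>UNIV. overlap_chain \<gamma> (m - 1) (\<not> l) l u u) * indicator {0..1} u"
    proof (cases "u \<in> {0..1}")
      case True
      then have "ennreal 1 * ennreal (matrix_chain \<beta> (m - 1) (\<not> l) l) \<le> overlap_chain \<gamma> (m - 1) (\<not> l) l u u" for l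
        using overlap_chain_lower[of \<beta>, OF b low] by simp
      then show ?thesis by (intro mult_right_mono sum_mono) auto
    qed simp
  qed
  finally show ?thesis .
qed

section \<open>Errors of first order at the critical exponent\<close>

text \<open>
  Convergence to c with an error of first order as the exponent tends to -1/2 from below. Such functions are
  closed under the operations that build the normalized traces.
\<close>

definition near_crit :: "(real \<Rightarrow> real) \<Rightarrow> real \<Rightarrow> bool" where
  "near_crit f c \<longleftrightarrow> (\<lambda>g. f g - c) \<in> O[at_left (- 1/2)](\<lambda>g. - g - 1/2)"

lemma near_crit_const: "near_crit (\<lambda>_. c) c"
  by (simp add: near_crit_def)

lemma tendsto_crit: "((\<lambda>g. - g - 1/2) \<longlongrightarrow> 0) (at_left (- 1/2 :: real))"
  by (auto intro!: tendsto_eq_intros)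

lemma near_crit_tendsto:
  assumes "near_crit f c" shows "(f \<longlongrightarrow> c) (at_left (- 1/2))"
proof -
  obtain K where K: "eventually (\<lambda>g. norm (f g - c) \<le> K * norm (- g - 1/2 :: real)) (at_left (- 1/2))"
    using assms unfolding near_crit_def by (rule landau_o.bigE)
  have "((\<lambda>g. K * norm (- g - 1/2 :: real)) \<longlongrightarrow> K * 0) (at_left (- 1/2))"
    by (intro tendsto_mult tendsto_const tendsto_norm_zero tendsto_crit)
  then have "((\<lambda>g. K * norm (- g - 1/2 :: real)) \<longlongrightarrow> 0) (at_left (- 1/2))" by simp
  from Lim_null_comparison[OF K this] show ?thesis by (rule LIM_zero_cancel)
qed

lemma near_crit_add:
  assumes "near_crit f c" "near_crit g d"
  shows "near_crit (\<lambda>x. f x + g x) (c + d)"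
proof -
  have "(\<lambda>x. (f x - c) + (g x - d)) \<in> O[at_left (- 1/2)](\<lambda>g. - g - 1/2)"
    using assms unfolding near_crit_def by (rule sum_in_bigo)
  then show ?thesis by (simp add: near_crit_def algebra_simps)
qed

lemma near_crit_mult:
  assumes f: "near_crit f c" and g: "near_crit g d"
  shows "near_crit (\<lambda>x. f x * g x) (c * d)"
proof -
  have "g \<in> O[at_left (- 1/2)](\<lambda>_. 1)"
    using near_crit_tendsto[OF g] by (intro bigoI_tendsto[of _ _ d]) auto
  with f have "(\<lambda>x. (f x - c) * g x) \<in> O[at_left (- 1/2)](\<lambda>g. (- g - 1/2) * 1)"
    unfolding near_crit_def by (rule landau_o.big.mult)
  moreover have "(\<lambda>x. c * (g x - d)) \<in> O[at_left (- 1/2)](\<lambda>g. - g - 1/2)"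
    using g unfolding near_crit_def by (cases "c = 0") auto
  ultimately have "(\<lambda>x. (f x - c) * g x + c * (g x - d)) \<in> O[at_left (- 1/2)](\<lambda>g. - g - 1/2)"
    by (intro sum_in_bigo) simp_all
  then show ?thesis by (simp add: near_crit_def algebra_simps)
qed

lemma near_crit_power: "near_crit f c \<Longrightarrow> near_crit (\<lambda>x. f x ^ n) (c ^ n)"
  by (induction n) (auto intro: near_crit_const near_crit_mult)

lemma near_crit_id: "near_crit (\<lambda>g. - g - 1/2) 0"
  by (simp add: near_crit_def)

lemma near_crit_linear: "near_crit (\<lambda>g. c + d * (- g - 1/2)) c"
  using near_crit_add[OF near_crit_const[of c] near_crit_mult[OF near_crit_const[of d] near_crit_id]] by simp

text \<open>
  A function differentiable at c satisfies |G y - G c| \<le> (|D| + 1) |y - c| near c.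
\<close>

lemma near_crit_compose:
  assumes f: "near_crit f c" and G: "(G has_field_derivative D) (at c)"
  shows "near_crit (\<lambda>x. G (f x)) (G c)"
proof -
  have "((\<lambda>y. (G y - G c) / (y - c)) \<longlongrightarrow> D) (at c)"
    using G by (simp add: has_field_derivative_iff)
  then have "((\<lambda>y. \<bar>(G y - G c) / (y - c)\<bar>) \<longlongrightarrow> \<bar>D\<bar>) (at c)" by (rule tendsto_rabs)
  then have "eventually (\<lambda>y. \<bar>(G y - G c) / (y - c)\<bar> < \<bar>D\<bar> + 1) (at c)"
    by (rule order_tendstoD) simp
  then have "eventually (\<lambda>y. y \<noteq> c \<longrightarrow> \<bar>(G y - G c) / (y - c)\<bar> < \<bar>D\<bar> + 1) (nhds c)"
    by (simp add: eventually_at_filter)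
  then have "eventually (\<lambda>y. \<bar>G y - G c\<bar> \<le> (\<bar>D\<bar> + 1) * \<bar>y - c\<bar>) (nhds c)"
  proof eventually_elim
    case (elim y)
    then show ?case by (cases "y = c") (auto simp: abs_divide pos_divide_less_eq intro: less_imp_le)
  qed
  then have "eventually (\<lambda>x. \<bar>G (f x) - G c\<bar> \<le> (\<bar>D\<bar> + 1) * \<bar>f x - c\<bar>) (at_left (- 1/2))"
    using near_crit_tendsto[OF f] by (rule eventually_compose_filterlim)
  then have "(\<lambda>x. G (f x) - G c) \<in> O[at_left (- 1/2)](\<lambda>x. f x - c)"
    by (intro bigoI[of _ "\<bar>D\<bar> + 1"]) simp
  then show ?thesis using f unfolding near_crit_def by (rule landau_o.big_trans)
qed

lemma near_crit_cong:
  assumes "near_crit f c" "eventually (\<lambda>x. f x = g x) (at_left (- 1/2))"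
  shows "near_crit g c"
proof -
  have "eventually (\<lambda>x. f x - c = g x - c) (at_left (- 1/2))"
    using assms(2) by eventually_elim simp
  from landau_o.big.in_cong[OF this] show ?thesis using assms(1) by (simp add: near_crit_def)
qed

lemma near_crit_sandwich:
  assumes l: "near_crit l c" and u: "near_crit u c"
    and e: "eventually (\<lambda>x. l x \<le> f x \<and> f x \<le> u x) (at_left (- 1/2))"
  shows "near_crit f c"
proof -
  have "(\<lambda>x. f x - c) \<in> O[at_left (- 1/2)](\<lambda>x. \<bar>l x - c\<bar> + \<bar>u x - c\<bar>)"
    by (intro bigoI[of _ 1]) (use e in \<open>auto elim!: eventually_mono\<close>)
  moreover have "(\<lambda>x. \<bar>l x - c\<bar> + \<bar>u x - c\<bar>) \<in> O[at_left (- 1/2)](\<lambda>g. - g - 1/2)"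
    using l u unfolding near_crit_def by (intro sum_in_bigo) auto
  ultimately show ?thesis unfolding near_crit_def by (rule landau_o.big_trans)
qed

lemma near_crit_matrix_chain:
  assumes "\<And>i j. near_crit (\<lambda>x. \<beta> x i j) (\<beta>' i j)"
  shows "near_crit (\<lambda>x. matrix_chain (\<beta> x) n i j) (matrix_chain \<beta>' n i j)"
proof (induction n arbitrary: i)
  case (Suc n)
  have "near_crit (\<lambda>x. (1 / 2) * (\<beta> x i False * matrix_chain (\<beta> x) n True j + \<beta> x i True * matrix_chain (\<beta> x) n False j))
     ((1 / 2) * (\<beta>' i False * matrix_chain \<beta>' n True j + \<beta>' i True * matrix_chain \<beta>' n False j))"
    by (intro near_crit_mult near_crit_add near_crit_const assms Suc.IH)
  then show ?case by (simp add: UNIV_bool)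
qed (use assms in simp)

lemma near_crit_matrix_trace:
  assumes "\<And>i j. near_crit (\<lambda>x. \<beta> x i j) (\<beta>' i j)"
  shows "near_crit (\<lambda>x. matrix_trace (\<beta> x) m) (matrix_trace \<beta>' m)"
proof -
  have "near_crit (\<lambda>x. (1 / 2) * (matrix_chain (\<beta> x) (m - 1) True False + matrix_chain (\<beta> x) (m - 1) False True))
     ((1 / 2) * (matrix_chain \<beta>' (m - 1) True False + matrix_chain \<beta>' (m - 1) False True))"
    by (intro near_crit_mult near_crit_add near_crit_const near_crit_matrix_chain assms)
  then show ?thesis by (simp add: matrix_trace_def UNIV_bool)
qed

lemma matrix_chain_scale: "matrix_chain (\<lambda>i j. A * \<beta> i j) n i j = A ^ Suc n * matrix_chain \<beta> n i j"
  by (induction n arbitrary: i) (auto simp: sum_distrib_left mult_ac)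

lemma matrix_trace_scale: "1 \<le> m \<Longrightarrow> matrix_trace (\<lambda>i j. A * \<beta> i j) m = A ^ m * matrix_trace \<beta> m"
  by (simp add: matrix_trace_def matrix_chain_scale sum_distrib_left flip: power_Suc)

lemma matrix_chain_le:
  assumes "\<And>i j. 0 \<le> \<beta> i j" "\<And>i j. \<beta> i j \<le> b"
  shows "matrix_chain \<beta> n i j \<le> b ^ Suc n"
proof (induction n arbitrary: i)
  case (Suc n)
  have b: "0 \<le> b" using assms order.trans by blast
  have "(\<Sum>l\<in>UNIV. \<beta> i l * matrix_chain \<beta> n (\<not> l) j) \<le> (\<Sum>l\<in>(UNIV :: bool set). b * b ^ Suc n)"
    by (intro sum_mono mult_mono assms Suc.IH matrix_chain_nonneg b)
  then show ?case by simp
qed (use assms in simp)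

lemma matrix_trace_le:
  assumes "\<And>i j. 0 \<le> \<beta> i j" "\<And>i j. \<beta> i j \<le> b" "1 \<le> m"
  shows "matrix_trace \<beta> m \<le> b ^ m"
proof -
  have "(\<Sum>l\<in>UNIV. matrix_chain \<beta> (m - 1) (\<not> l) l) \<le> (\<Sum>l\<in>(UNIV :: bool set). b ^ Suc (m - 1))"
    by (intro sum_mono matrix_chain_le assms)
  then show ?thesis using assms(3) by (simp add: matrix_trace_def)
qed

text \<open>
  The matrix \<beta> S / 2 has diagonal entries p/2 and off-diagonal entries with product q^2/4, hence the
  eigenvalues (p + q)/2 and (p - q)/2. The powers are computed together with the off-diagonal
  entries, which involve the difference instead of the sum of the powers.
\<close>

lemma matrix_trace_eigenvalues:
  assumes sym: "\<beta> True False = p" "\<beta> False True = p" and q: "\<beta> True True * \<beta> False False = q\<^sup>2" "q \<noteq> 0"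
    and m: "1 \<le> m"
  shows "matrix_trace \<beta> m = ((p + q) / 2) ^ m + ((p - q) / 2) ^ m"
proof -
  let ?x = "(p + q) / 2" and ?y = "(p - q) / 2"
  define X Y where "X n = ?x ^ Suc n" and "Y n = ?y ^ Suc n" for n
  have XY: "X (Suc n) = (p + q) / 2 * X n" "Y (Suc n) = (p - q) / 2 * Y n" for n
    by (simp_all add: X_def Y_def)
  have "matrix_chain \<beta> n True False = X n + Y n \<and> matrix_chain \<beta> n False True = X n + Y n
     \<and> q * matrix_chain \<beta> n True True = \<beta> True True * (X n - Y n)
     \<and> q * matrix_chain \<beta> n False False = \<beta> False False * (X n - Y n)" for n
  proof (induction n)
    case 0
    show ?case by (simp add: sym X_def Y_def field_simps)
  next
    case (Suc n)
    let ?M = "matrix_chain \<beta> n"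
    have tt: "?M True True = \<beta> True True * (X n - Y n) / q" and ff: "?M False False = \<beta> False False * (X n - Y n) / q"
      using Suc q(2) by (simp_all add: field_simps)
    have tf: "?M True False = X n + Y n" "?M False True = X n + Y n" using Suc by auto
    have c1: "\<beta> True True * ?M False False = q * (X n - Y n)"
    proof -
      have "\<beta> True True * ?M False False = (\<beta> True True * \<beta> False False) * (X n - Y n) / q"
        unfolding ff by simp
      then show ?thesis using q(2) unfolding q(1) by (simp add: power2_eq_square)
    qed
    have c2: "\<beta> False False * ?M True True = q * (X n - Y n)"
    proof -
      have "\<beta> False False * ?M True True = (\<beta> True True * \<beta> False False) * (X n - Y n) / q"
        unfolding tt by simp
      then show ?thesis using q(2) unfolding q(1) by (simp add: power2_eq_square)
    qed
    have "matrix_chain \<beta> (Suc n) True False = X (Suc n) + Y (Suc n)"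
      unfolding matrix_chain.simps UNIV_bool XY using c1 by (simp add: sym tf algebra_simps add_divide_distrib diff_divide_distrib)
    moreover have "matrix_chain \<beta> (Suc n) False True = X (Suc n) + Y (Suc n)"
      unfolding matrix_chain.simps UNIV_bool XY using c2 by (simp add: sym tf algebra_simps add_divide_distrib diff_divide_distrib)
    moreover have "q * matrix_chain \<beta> (Suc n) True True = \<beta> True True * (X (Suc n) - Y (Suc n))"
      unfolding matrix_chain.simps UNIV_bool XY using q(2) by (simp add: sym tf tt algebra_simps add_divide_distrib diff_divide_distrib)
    moreover have "q * matrix_chain \<beta> (Suc n) False False = \<beta> False False * (X (Suc n) - Y (Suc n))"
      unfolding matrix_chain.simps UNIV_bool XY using q(2) by (simp add: sym tf ff algebra_simps add_divide_distrib diff_divide_distrib)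
    ultimately show ?case by blast
  qed
  then show ?thesis using m by (simp add: matrix_trace_def UNIV_bool X_def Y_def flip: power_Suc)
qed

section \<open>The generalized Rosenblatt variable\<close>

text \<open>
  With \<delta> = -\<gamma>1 - 1/2 the two exponents are -1/2 - \<delta> weight i, True standing for \<gamma>1.
\<close>

definition weight :: "real \<Rightarrow> bool \<Rightarrow> real" where
  "weight \<rho> i = (if i then 1 else 1 / \<rho>)"

text \<open>
  The condition \<delta> / \<rho> < 1/8 keeps the exponents above -3/4, which gives the constant 4 in the upper
  matrix, and keeps the doubled singularity 4 \<delta> / \<rho> below 1.
\<close>

lemma cumulant_rosenblatt_bounds:
  fixes \<rho> \<gamma> :: real
  defines "\<delta> \<equiv> - \<gamma> - 1/2" and "\<gamma>' \<equiv> (\<gamma> + 1/2) / \<rho> - 1/2"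
  defines "A \<equiv> rosenblatt_const \<gamma> \<gamma>'"
  assumes BM: "two_sided_brownian_motion M B"
    and \<rho>: "0 < \<rho>" "\<rho> < 1" and \<delta>: "0 < \<delta>" "\<delta> / \<rho> < 1/8" and m: "2 \<le> m"
  obtains T where "cumulant M (rosenblatt M B \<gamma> \<gamma>') m = 2 ^ (m - 1) * fact (m - 1) * T"
    "matrix_trace (\<lambda>i j. A / ((weight \<rho> i + weight \<rho> j) * \<delta>)) m \<le> T"
    "T \<le> ((1 + 4 * \<delta> / \<rho>) / (1 - 4 * \<delta> / \<rho>)) ^ (m - 1)
        * matrix_trace (\<lambda>i j. A / ((weight \<rho> i + weight \<rho> j) * \<delta>) + 4 * A) m"
proof -
  interpret two_sided_brownian_motion M B by fact
  define g where "g i = - 1/2 - \<delta> * weight \<rho> i" for i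
  have gT: "g True = \<gamma>" and gF: "g False = \<gamma>'"
    using \<rho> by (simp_all add: g_def weight_def \<delta>_def \<gamma>'_def field_simps)
  have w: "1 \<le> weight \<rho> i" "weight \<rho> i \<le> 1 / \<rho>" for i
    using \<rho> by (auto simp: weight_def)
  have dw: "0 < \<delta> * weight \<rho> i" "\<delta> * weight \<rho> i < 1/8" "\<delta> * weight \<rho> i \<le> \<delta> / \<rho>" for i
  proof -
    show "0 < \<delta> * weight \<rho> i" using w(1)[of i] \<delta>(1) by (intro mult_pos_pos) auto
    show *: "\<delta> * weight \<rho> i \<le> \<delta> / \<rho>" using mult_left_mono[OF w(2)[of i], of \<delta>] \<delta>(1) by simp
    show "\<delta> * weight \<rho> i < 1/8" using * \<delta>(2) by linarith
  qed
  have g: "-1 < g i" "1/4 \<le> g i + 1" "g i < 0" for i using dw[of i] by (auto simp: g_def)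
  have gs: "g i + g j < -1" "- g i - g j - 1 = (weight \<rho> i + weight \<rho> j) * \<delta>" for i j
    using dw(1)[of i] dw(1)[of j] by (auto simp: g_def algebra_simps)
  let ?c = "2 * \<delta> / \<rho>"
  have c: "0 < ?c" "2 * ?c < 1" using \<delta> \<rho> by (auto simp: field_simps)
  define \<beta> where "\<beta> i j = 1 / ((weight \<rho> i + weight \<rho> j) * \<delta>)" for i j
  have \<beta>: "0 \<le> \<beta> i j" for i j using w(1)[of i] w(1)[of j] \<delta>(1) by (simp add: \<beta>_def)
  define K where "K = sym_kernel g"
  have low: "ennreal (matrix_trace \<beta> m) \<le> kernel_trace K m" if "2 \<le> m" for m
    unfolding K_def
  proof (rule kernel_trace_lower[OF \<beta> _ that])
    fix i j s t assume "s \<in> {0..1::real}" "t \<in> {0..1::real}"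
    then show "ennreal (\<beta> i j) \<le> overlap (g i) (g j) s t"
      unfolding \<beta>_def gs(2)[symmetric] by (intro overlap_lower g gs) auto
  qed
  let ?J = "(1 + 4 * \<delta> / \<rho>) / (1 - 4 * \<delta> / \<rho>)"
  have J: "1 \<le> ?J" using c \<delta> \<rho> by (auto simp: field_simps)
  then have J0: "0 \<le> ?J" by linarith
  have up: "kernel_trace K m \<le> ennreal (?J ^ (m - 1) * matrix_trace (\<lambda>i j. \<beta> i j + 4) m)" if "2 \<le> m" for m
  proof -
    have "kernel_trace K m \<le> ennreal (((1 + 2 * ?c) / (1 - 2 * ?c)) ^ (m - 1) * matrix_trace (\<lambda>i j. \<beta> i j + 4) m)"
      unfolding K_def
    proof (rule kernel_trace_upper[OF _ c _ that])
      show "0 \<le> \<beta> i j + 4" for i j using \<beta>[of i j] by simp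
      fix i j s t assume st: "s \<in> {0..1::real}" "t \<in> {0..1::real}" "s \<noteq> t"
      have "- g i - g j - 1 \<le> ?c" using dw(3)[of i] dw(3)[of j] by (simp add: g_def)
      then have "overlap (g i) (g j) s t \<le> ennreal (1 / (- g i - g j - 1) + 1 / (1/4)) * ennreal (\<bar>s - t\<bar> powr (- ?c))"
        using st by (intro overlap_upper g gs) auto
      then show "overlap (g i) (g j) s t \<le> ennreal (\<beta> i j + 4) * ennreal (\<bar>s - t\<bar> powr (- ?c))"
        unfolding \<beta>_def gs(2) by simp
    qed
    then show ?thesis by simp
  qed
  let ?k = "product_kernel (g True) (g False)"
  have Kk: "(\<lambda>x y. (?k x y + ?k y x) / 2) = K" by (simp add: K_def sym_kernel_def fun_eq_iff)
  have fk: "(\<lambda>z. enn2real (?k (fst z) (snd z))) = rosenblatt_kernel \<gamma> \<gamma>'"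
    by (simp add: rosenblatt_kernel_eq gT gF fun_eq_iff)
  have L2: "(\<integral>\<^sup>+x. \<integral>\<^sup>+y. (?k x y)\<^sup>2 \<partial>lborel \<partial>lborel) < \<infinity>"
    using up[of 2] unfolding K_def by (intro product_kernel_square_integrable) (simp add: le_less_trans)
  \<comment> \<open>Any bound of geometric growth suffices as the h of the general theorem.\<close>
  obtain b where b: "0 < b" "\<And>i j. \<beta> i j + 4 \<le> b"
  proof (rule that[of "\<beta> True True + \<beta> True False + \<beta> False True + \<beta> False False + 4"])
    show "0 < \<beta> True True + \<beta> True False + \<beta> False True + \<beta> False False + 4"
      using \<beta>[of True True] \<beta>[of True False] \<beta>[of False True] \<beta>[of False False] by linarith
    show "\<beta> i j + 4 \<le> \<beta> True True + \<beta> True False + \<beta> False True + \<beta> False False + 4" for i j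
      using \<beta>[of True True] \<beta>[of True False] \<beta>[of False True] \<beta>[of False False] by (cases i; cases j) auto
  qed
  have Jb: "0 < ?J * b" using J b(1) by (intro mult_pos_pos) auto
  have hb: "kernel_trace K m \<le> ennreal ((?J * b) ^ m)" if "2 \<le> m" for m
  proof -
    have "?J ^ (m - 1) * matrix_trace (\<lambda>i j. \<beta> i j + 4) m \<le> ?J ^ m * b ^ m"
    proof (intro mult_mono power_increasing matrix_trace_le J b(2))
      show "0 \<le> \<beta> i j + 4" for i j using \<beta>[of i j] by simp
      show "0 \<le> matrix_trace (\<lambda>i j. \<beta> i j + 4) m"
        unfolding matrix_trace_def using \<beta>
        by (intro divide_nonneg_nonneg sum_nonneg matrix_chain_nonneg add_nonneg_nonneg) auto
      show "0 \<le> ?J ^ m" by (rule zero_le_power[OF J0])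
    qed (use that in auto)
    then show ?thesis
      using order.trans[OF up[OF that] ennreal_leI] by (simp only: power_mult_distrib)
  qed
  note law = chaos_law_lsc_kernel[OF measurable_product_kernel, of "g True" "g False" "?J * b", unfolded Kk fk,
      OF product_kernel_finite product_kernel_lsc L2 Jb hb]
  have "chaos_law M (double_wiener_integral M B (rosenblatt_kernel \<gamma> \<gamma>')) (\<lambda>m. enn2real (kernel_trace K m))"
    and "double_wiener_integral M B (rosenblatt_kernel \<gamma> \<gamma>') \<in> borel_measurable M"
    by (rule law; (rule g)?; assumption?)+
  from chaos_law_scale[OF this, of A]
  have "chaos_law M (rosenblatt M B \<gamma> \<gamma>') (\<lambda>m. A ^ m * enn2real (kernel_trace K m))"
    by (simp add: rosenblatt_def [abs_def] A_def)
  then have 1: "cumulant M (rosenblatt M B \<gamma> \<gamma>') m = 2 ^ (m - 1) * fact (m - 1) * (A ^ m * enn2real (kernel_trace K m))"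
    using m by (rule cumulant_chaos_law)
  have A: "0 \<le> A ^ m" by (intro zero_le_power) (simp add: A_def rosenblatt_const_def)
  have fin: "kernel_trace K m < top" using up[OF m] by (rule le_less_trans) simp
  have m1: "1 \<le> m" using m by simp
  have "matrix_trace \<beta> m \<le> enn2real (kernel_trace K m)"
  proof -
    have "0 \<le> matrix_trace \<beta> m"
      unfolding matrix_trace_def by (intro divide_nonneg_nonneg sum_nonneg matrix_chain_nonneg \<beta>) auto
    then show ?thesis using enn2real_mono[OF low[OF m] fin] by simp
  qed
  then have 2: "matrix_trace (\<lambda>i j. A * \<beta> i j) m \<le> A ^ m * enn2real (kernel_trace K m)"
    unfolding matrix_trace_scale[OF m1] using A by (rule mult_left_mono)
  have "enn2real (kernel_trace K m) \<le> ?J ^ (m - 1) * matrix_trace (\<lambda>i j. \<beta> i j + 4) m"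
  proof -
    have "0 \<le> ?J ^ (m - 1) * matrix_trace (\<lambda>i j. \<beta> i j + 4) m"
      unfolding matrix_trace_def using \<beta>
      by (intro mult_nonneg_nonneg zero_le_power[OF J0] divide_nonneg_nonneg sum_nonneg matrix_chain_nonneg add_nonneg_nonneg) auto
    then show ?thesis by (rule enn2real_leI[OF _ up[OF m]])
  qed
  then have "A ^ m * enn2real (kernel_trace K m) \<le> A ^ m * (?J ^ (m - 1) * matrix_trace (\<lambda>i j. \<beta> i j + 4) m)"
    using A by (rule mult_left_mono)
  also have "\<dots> = ?J ^ (m - 1) * matrix_trace (\<lambda>i j. A * (\<beta> i j + 4)) m"
    unfolding matrix_trace_scale[OF m1] by (simp only: mult_ac)
  finally have 3: "A ^ m * enn2real (kernel_trace K m) \<le> ?J ^ (m - 1) * matrix_trace (\<lambda>i j. A * (\<beta> i j + 4)) m" .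
  have e: "(\<lambda>i j. A * \<beta> i j) = (\<lambda>i j. A / ((weight \<rho> i + weight \<rho> j) * \<delta>))"
    "(\<lambda>i j. A * (\<beta> i j + 4)) = (\<lambda>i j. A / ((weight \<rho> i + weight \<rho> j) * \<delta>) + 4 * A)"
    by (simp_all add: \<beta>_def fun_eq_iff distrib_left)
  show ?thesis by (rule that[OF 1 2[unfolded e] 3[unfolded e]])
qed

text \<open>
  This is y Beta x y, in a form that is also smooth at the pole y = 0 of Beta, where it has the value 1.
\<close>

definition regular_Beta :: "real \<Rightarrow> real \<Rightarrow> real" where
  "regular_Beta x y = Gamma x * Gamma (1 + y) * inverse (Gamma (x + y))"

lemma Beta_regular: "0 < y \<Longrightarrow> Beta x y = regular_Beta x y / y"
proof -
  assume y: "0 < y"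
  then have "y \<notin> \<int>\<^sub>\<le>\<^sub>0" by (auto elim: nonpos_Ints_cases)
  then have "Gamma (1 + y) = y * Gamma y" using Gamma_plus1[of y] by (simp add: add.commute)
  then show ?thesis using y by (simp add: Beta_def regular_Beta_def divide_inverse)
qed

lemma powr_minus_half: "0 \<le> x \<Longrightarrow> x powr (- 1/2) = 1 / sqrt x"
  using powr_minus[of x "1/2"] by (simp add: powr_half_sqrt inverse_eq_divide)

lemma near_crit_Gamma:
  assumes "near_crit f c" "0 < c"
  shows "near_crit (\<lambda>x. Gamma (f x)) (Gamma c)"
proof -
  have "c \<notin> \<int>\<^sub>\<le>\<^sub>0" using assms(2) by (auto elim: nonpos_Ints_cases)
  from has_field_derivative_Gamma[OF this] show ?thesis by (rule near_crit_compose[OF assms(1)])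
qed

lemma near_crit_inverse:
  assumes "near_crit f c" "c \<noteq> 0"
  shows "near_crit (\<lambda>x. inverse (f x)) (inverse c)"
  by (rule near_crit_compose[OF assms(1) DERIV_inverse[OF assms(2)]])

lemma near_crit_powr:
  assumes "near_crit f c" "0 < c"
  shows "near_crit (\<lambda>x. f x powr p) (c powr p)"
  by (rule near_crit_compose[OF assms(1) has_real_derivative_powr[OF assms(2)]])

lemma near_crit_regular_Beta:
  "near_crit (\<lambda>\<gamma>. regular_Beta (1/2 - w * (- \<gamma> - 1/2)) (v * (- \<gamma> - 1/2))) 1"
proof -
  have 1: "near_crit (\<lambda>\<gamma>. 1/2 - w * (- \<gamma> - 1/2)) (1/2)"
    using near_crit_linear[of "1/2" "- w"] by simp
  have 2: "near_crit (\<lambda>\<gamma>. 1 + v * (- \<gamma> - 1/2)) 1"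
    by (rule near_crit_linear)
  have 3: "near_crit (\<lambda>\<gamma>. (1/2 - w * (- \<gamma> - 1/2)) + v * (- \<gamma> - 1/2)) (1/2)"
    using near_crit_linear[of "1/2" "v - w"] by (simp only: left_diff_distrib add_diff_eq diff_add_eq)
  have "0 < Gamma (1/2 :: real)" by (rule Gamma_real_pos) simp
  then have "Gamma (1/2 :: real) \<noteq> 0" by (rule less_imp_neq[THEN not_sym])
  then have "near_crit (\<lambda>\<gamma>. regular_Beta (1/2 - w * (- \<gamma> - 1/2)) (v * (- \<gamma> - 1/2)))
     (Gamma (1/2) * Gamma 1 * inverse (Gamma (1/2)))"
    unfolding regular_Beta_def
    by (intro near_crit_mult near_crit_inverse near_crit_Gamma 1 2 3) auto
  then show ?thesis using \<open>Gamma (1/2 :: real) \<noteq> 0\<close> by simp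
qed

lemma eventually_crit:
  assumes "0 < e"
  shows "eventually (\<lambda>\<gamma> :: real. 0 < - \<gamma> - 1/2 \<and> - \<gamma> - 1/2 < e) (at_left (- 1/2))"
proof -
  have "eventually (\<lambda>\<gamma> :: real. \<gamma> \<in> {- 1/2 - e<..<- 1/2}) (at_left (- 1/2))"
    using assms by (intro eventually_at_left_real) auto
  then show ?thesis by eventually_elim auto
qed

text \<open>
  The limit of the normalizing constant divided by \<delta>.
\<close>

definition limit_const :: "real \<Rightarrow> real" where
  "limit_const \<rho> = (1 / (1 + 1 / \<rho>)\<^sup>2 + \<rho> / 4) powr (- 1/2)"

text \<open>
  All four Beta values have a simple pole, with second argument a multiple of \<delta>. Taking the factor \<delta>^(-2)
  out of the sum of their products leaves a smooth function of \<delta> with a positive value at 0.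
\<close>

lemma near_crit_rosenblatt_const:
  assumes \<rho>: "0 < \<rho>" "\<rho> < 1"
  shows "near_crit (\<lambda>\<gamma>. rosenblatt_const \<gamma> ((\<gamma> + 1/2) / \<rho> - 1/2) / (- \<gamma> - 1/2)) (limit_const \<rho>)"
proof -
  let ?d = "\<lambda>\<gamma> :: real. - \<gamma> - 1/2"
  let ?U = "\<lambda>w v \<gamma>. regular_Beta (1/2 - w * ?d \<gamma>) (v * ?d \<gamma>)"
  let ?r = "1 / \<rho>"
  define \<Psi> where "\<Psi> \<gamma> = ?U 1 (1 + ?r) \<gamma> * ?U ?r (1 + ?r) \<gamma> * (1 / (1 + ?r)\<^sup>2)
      + ?U 1 2 \<gamma> * ?U ?r (2 * ?r) \<gamma> * (\<rho> / 4)" for \<gamma>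
  define X where "X \<gamma> = (1 + (- (1 + ?r)) * ?d \<gamma>) * (1 + (- 2 * (1 + ?r)) * ?d \<gamma>)" for \<gamma>
  have "near_crit \<Psi> (1 * 1 * (1 / (1 + ?r)\<^sup>2) + 1 * 1 * (\<rho> / 4))"
    unfolding \<Psi>_def by (intro near_crit_add near_crit_mult near_crit_const near_crit_regular_Beta)
  then have \<Psi>: "near_crit \<Psi> (1 / (1 + ?r)\<^sup>2 + \<rho> / 4)" by simp
  have X: "near_crit X (1 * 1)"
    unfolding X_def by (intro near_crit_mult near_crit_linear)
  have pos: "0 < 1 / (1 + ?r)\<^sup>2 + \<rho> / 4" using \<rho> by (intro add_nonneg_pos) auto
  have "near_crit (\<lambda>\<gamma>. X \<gamma> powr (1/2) * \<Psi> \<gamma> powr (- 1/2)) (1 powr (1/2) * (1 / (1 + ?r)\<^sup>2 + \<rho> / 4) powr (- 1/2))"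
    using X by (intro near_crit_mult near_crit_powr \<Psi> pos) auto
  then have "near_crit (\<lambda>\<gamma>. X \<gamma> powr (1/2) * \<Psi> \<gamma> powr (- 1/2)) (limit_const \<rho>)"
    by (simp add: limit_const_def)
  moreover have "eventually (\<lambda>\<gamma>. X \<gamma> powr (1/2) * \<Psi> \<gamma> powr (- 1/2)
      = rosenblatt_const \<gamma> ((\<gamma> + 1/2) / \<rho> - 1/2) / ?d \<gamma>) (at_left (- 1/2))"
    using eventually_crit[of "\<rho> / 8", OF divide_pos_pos[OF \<rho>(1) zero_less_numeral]]
  proof (eventually_elim)
    case (elim \<gamma>)
    define d where "d = ?d \<gamma>"
    have d: "0 < d" "d * ?r < 1/8" using elim \<rho> by (auto simp: d_def field_simps)
    have \<gamma>: "\<gamma> = - 1/2 - d" by (simp add: d_def)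
    let ?\<gamma> = "(\<gamma> + 1/2) / \<rho> - 1/2"
    have \<gamma>': "?\<gamma> = - 1/2 - d * ?r" by (simp add: \<gamma>)
    have a: "\<gamma> + 1 = 1/2 - 1 * d" "?\<gamma> + 1 = 1/2 - ?r * d" "- \<gamma> - ?\<gamma> - 1 = (1 + ?r) * d"
      "- 2 * \<gamma> - 1 = 2 * d" "- 2 * ?\<gamma> - 1 = 2 * ?r * d"
      unfolding \<gamma>' by (simp_all add: \<gamma> algebra_simps)
    have p: "0 < (1 + ?r) * d" "0 < 2 * d" "0 < 2 * ?r * d" using d \<rho> by (auto intro!: mult_pos_pos add_pos_pos)
    let ?S = "Beta (\<gamma> + 1) (- \<gamma> - ?\<gamma> - 1) * Beta (?\<gamma> + 1) (- \<gamma> - ?\<gamma> - 1)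
      + Beta (\<gamma> + 1) (- 2 * \<gamma> - 1) * Beta (?\<gamma> + 1) (- 2 * ?\<gamma> - 1)"
    have S: "?S = \<Psi> \<gamma> / d\<^sup>2"
      unfolding a Beta_regular[OF p(1)] Beta_regular[OF p(2)] Beta_regular[OF p(3)] \<Psi>_def d_def[symmetric]
      using d \<rho> by (simp add: power2_eq_square add_divide_distrib mult_ac)
    have X: "(\<gamma> + ?\<gamma> + 2) * (2 * (\<gamma> + ?\<gamma>) + 3) = X \<gamma>"
      unfolding X_def d_def[symmetric] \<gamma>' by (simp add: \<gamma> algebra_simps)
    have "?S powr (- 1/2) = \<Psi> \<gamma> powr (- 1/2) / (d\<^sup>2) powr (- 1/2)"
      unfolding S by (rule powr_divide)
    also have "(d\<^sup>2) powr (- 1/2) = 1 / d"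
      using d(1) by (simp only: powr_minus_half zero_le_power2 real_sqrt_abs abs_of_pos)
    finally have "?S powr (- 1/2) = \<Psi> \<gamma> powr (- 1/2) * d" by simp
    then show ?case using d(1) unfolding rosenblatt_const_def X d_def[symmetric] by simp
  qed
  ultimately show ?thesis by (rule near_crit_cong)
qed

text \<open>
  The entries of the limit matrix are limit_const \<rho> times 1/2, \<rho>/2 and \<rho>/(1+\<rho>), so that
  p = limit_const \<rho> \<rho>/(1+\<rho>) and q = limit_const \<rho> \<surd>\<rho>/2 in the eigenvalue formula.
\<close>

lemma matrix_trace_limit:
  assumes \<rho>: "0 < \<rho>" "\<rho> < 1" and m: "1 \<le> m"
  shows "matrix_trace (\<lambda>i j. limit_const \<rho> / (weight \<rho> i + weight \<rho> j)) m
     = (a_coeff \<rho> / sqrt 2) ^ m + (b_coeff \<rho> / sqrt 2) ^ m"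
proof -
  define r where "r = sqrt \<rho>"
  have r: "0 < r" "\<rho> = r\<^sup>2" using \<rho> by (auto simp: r_def)
  define E where "E = 1 / (\<rho> + 1)\<^sup>2 + 1 / (4 * \<rho>)"
  have E: "0 < E" using \<rho> by (auto simp: E_def intro!: add_pos_pos)
  have L: "limit_const \<rho> = 1 / (\<rho> * sqrt E)"
  proof -
    have "1 / (1 + 1 / \<rho>)\<^sup>2 + \<rho> / 4 = \<rho>\<^sup>2 * E"
    proof -
      have "1 + 1 / \<rho> = (\<rho> + 1) / \<rho>" using \<rho> by (simp add: add_divide_distrib)
      then have "1 / (1 + 1 / \<rho>)\<^sup>2 = \<rho>\<^sup>2 / (\<rho> + 1)\<^sup>2" by (simp add: power_divide)
      moreover have "\<rho> / 4 = \<rho>\<^sup>2 * (1 / (4 * \<rho>))" using \<rho> by (simp add: power2_eq_square)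
      ultimately show ?thesis by (simp add: E_def distrib_left)
    qed
    moreover have "sqrt (\<rho>\<^sup>2 * E) = \<rho> * sqrt E" using \<rho> by (simp add: real_sqrt_mult)
    moreover have "0 \<le> \<rho>\<^sup>2 * E" using E by simp
    ultimately show ?thesis by (simp only: limit_const_def powr_minus_half)
  qed
  have D: "sqrt (2 / (\<rho> + 1)\<^sup>2 + 1 / (2 * \<rho>)) = sqrt 2 * sqrt E"
  proof -
    have "2 / (\<rho> + 1)\<^sup>2 + 1 / (2 * \<rho>) = 2 * E" by (simp add: E_def)
    then show ?thesis by (simp only: real_sqrt_mult)
  qed
  let ?\<beta> = "\<lambda>i j. limit_const \<rho> / (weight \<rho> i + weight \<rho> j)"
  let ?p = "limit_const \<rho> / (1 + 1 / \<rho>)" and ?q = "limit_const \<rho> * r / 2"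
  have "matrix_trace ?\<beta> m = ((?p + ?q) / 2) ^ m + ((?p - ?q) / 2) ^ m"
  proof (rule matrix_trace_eigenvalues[OF _ _ _ _ m])
    show "?\<beta> True True * ?\<beta> False False = ?q\<^sup>2"
      using \<rho> by (simp add: weight_def r(2) power2_eq_square)
    show "?q \<noteq> 0" unfolding L using r(1) E \<rho> by simp
  qed (simp_all add: weight_def add.commute)
  moreover have "(?p + ?q) / 2 = a_coeff \<rho> / sqrt 2"
  proof -
    have "a_coeff \<rho> / sqrt 2 = (1 / (\<rho> + 1) + 1 / (2 * r)) / (2 * sqrt E)"
      by (simp add: a_coeff_def D r_def)
    moreover have "?p = 1 / (\<rho> + 1) / sqrt E" using \<rho> by (simp add: L field_simps)
    moreover have "?q = 1 / (2 * r) / sqrt E"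
      unfolding L using r(1) by (simp add: r(2) power2_eq_square)
    ultimately show ?thesis by (simp add: add_divide_distrib)
  qed
  moreover have "(?p - ?q) / 2 = b_coeff \<rho> / sqrt 2"
  proof -
    have "b_coeff \<rho> / sqrt 2 = (1 / (\<rho> + 1) - 1 / (2 * r)) / (2 * sqrt E)"
      by (simp add: b_coeff_def D r_def)
    moreover have "?p = 1 / (\<rho> + 1) / sqrt E" using \<rho> by (simp add: L field_simps)
    moreover have "?q = 1 / (2 * r) / sqrt E"
      unfolding L using r(1) by (simp add: r(2) power2_eq_square)
    ultimately show ?thesis by (simp add: diff_divide_distrib)
  qed
  ultimately show ?thesis by simp
qed

theorem lemma3p2:
  fixes M :: "'a measure" and B :: "real \<Rightarrow> 'a \<Rightarrow> real"
    and N :: "'b measure" and Z1 Z2 :: "'b \<Rightarrow> real"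
    and \<rho> :: real and m :: nat
  assumes "two_sided_brownian_motion M B"
    and "prob_space N"
    and "distributed N lborel Z1 std_normal_density"
    and "distributed N lborel Z2 std_normal_density"
    and "prob_space.indep_var N borel Z1 borel Z2"
    and "0 < \<rho>" and "\<rho> < 1"
    and "m \<ge> 3"
  shows "(\<lambda>\<gamma>1. cumulant M (rosenblatt M B \<gamma>1 ((\<gamma>1 + 1/2) / \<rho> - 1/2)) m
                 - cumulant N (Y_limit \<rho> Z1 Z2) m)
           \<in> O[at_left (- 1/2)](\<lambda>\<gamma>1. - \<gamma>1 - 1/2)"
proof -
  note \<rho> = \<open>0 < \<rho>\<close> \<open>\<rho> < 1\<close>
  have m: "2 \<le> m" "1 \<le> m" using \<open>m \<ge> 3\<close> by auto
  let ?d = "\<lambda>\<gamma> :: real. - \<gamma> - 1/2"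
  let ?\<gamma> = "\<lambda>\<gamma>. (\<gamma> + 1/2) / \<rho> - 1/2"
  let ?A = "\<lambda>\<gamma>. rosenblatt_const \<gamma> (?\<gamma> \<gamma>)"
  let ?F = "2 ^ (m - 1) * fact (m - 1) :: real"
  let ?\<kappa> = "\<lambda>\<gamma>. cumulant M (rosenblatt M B \<gamma> (?\<gamma> \<gamma>)) m"
  let ?\<beta> = "\<lambda>\<gamma> i j. ?A \<gamma> / ((weight \<rho> i + weight \<rho> j) * ?d \<gamma>)"
  let ?\<beta>' = "\<lambda>i j. limit_const \<rho> / (weight \<rho> i + weight \<rho> j)"
  let ?J = "\<lambda>\<gamma>. (1 + 4 * ?d \<gamma> / \<rho>) / (1 - 4 * ?d \<gamma> / \<rho>)"
  have \<beta>: "near_crit (\<lambda>\<gamma>. ?\<beta> \<gamma> i j) (?\<beta>' i j)" for i j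
    using near_crit_mult[OF near_crit_rosenblatt_const[OF \<rho>] near_crit_const[of "1 / (weight \<rho> i + weight \<rho> j)"]]
    by (simp add: mult.commute)
  have A: "near_crit (\<lambda>\<gamma>. 4 * ?A \<gamma>) 0"
  proof -
    have "near_crit (\<lambda>\<gamma>. 4 * ((?A \<gamma> / ?d \<gamma>) * ?d \<gamma>)) (4 * (limit_const \<rho> * 0))"
      by (intro near_crit_mult near_crit_const near_crit_rosenblatt_const \<rho> near_crit_id)
    then have "near_crit (\<lambda>\<gamma>. 4 * ((?A \<gamma> / ?d \<gamma>) * ?d \<gamma>)) 0" by simp
    then show ?thesis
      by (rule near_crit_cong) (use eventually_crit[of 1] in \<open>auto elim!: eventually_mono\<close>)
  qed
  have \<beta>2: "near_crit (\<lambda>\<gamma>. ?\<beta> \<gamma> i j + 4 * ?A \<gamma>) (?\<beta>' i j)" for i j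
    using near_crit_add[OF \<beta> A] by simp
  have J: "near_crit ?J 1"
  proof -
    have "near_crit (\<lambda>\<gamma>. (1 + (4 / \<rho>) * ?d \<gamma>) * inverse (1 + (- 4 / \<rho>) * ?d \<gamma>)) (1 * inverse 1)"
      by (intro near_crit_mult near_crit_inverse near_crit_linear) simp
    moreover have "(1 + (4 / \<rho>) * x) * inverse (1 + (- 4 / \<rho>) * x) = (1 + 4 * x / \<rho>) / (1 - 4 * x / \<rho>)" for x
      by (simp add: divide_inverse mult_ac)
    ultimately show ?thesis by (simp only: mult_1_left inverse_1)
  qed
  let ?l = "\<lambda>\<gamma>. ?F * matrix_trace (?\<beta> \<gamma>) m"
  let ?u = "\<lambda>\<gamma>. ?F * (?J \<gamma> ^ (m - 1) * matrix_trace (\<lambda>i j. ?\<beta> \<gamma> i j + 4 * ?A \<gamma>) m)"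
  have l: "near_crit ?l (?F * matrix_trace ?\<beta>' m)"
    by (intro near_crit_mult near_crit_const near_crit_matrix_trace \<beta>)
  have "near_crit ?u (?F * (1 ^ (m - 1) * matrix_trace ?\<beta>' m))"
    by (intro near_crit_mult near_crit_const near_crit_power J near_crit_matrix_trace \<beta>2)
  then have u: "near_crit ?u (?F * matrix_trace ?\<beta>' m)" by simp
  have "eventually (\<lambda>\<gamma>. ?l \<gamma> \<le> ?\<kappa> \<gamma> \<and> ?\<kappa> \<gamma> \<le> ?u \<gamma>) (at_left (- 1/2))"
  proof -
    have "0 < \<rho> / 8" using \<rho> by simp
    from eventually_crit[OF this] show ?thesis
    proof eventually_elim
      case (elim \<gamma>)
      then have d: "0 < ?d \<gamma>" "?d \<gamma> / \<rho> < 1/8" using \<rho> by (auto simp: field_simps)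
      obtain T where T: "?\<kappa> \<gamma> = ?F * T" "matrix_trace (?\<beta> \<gamma>) m \<le> T"
         "T \<le> ?J \<gamma> ^ (m - 1) * matrix_trace (\<lambda>i j. ?\<beta> \<gamma> i j + 4 * ?A \<gamma>) m"
        by (rule cumulant_rosenblatt_bounds[OF assms(1) \<rho> d m(1)])
      show ?case unfolding T(1) by (intro conjI mult_left_mono T) auto
    qed
  qed
  from near_crit_sandwich[OF l u this] have "near_crit ?\<kappa> (?F * matrix_trace ?\<beta>' m)" .
  moreover have "cumulant N (Y_limit \<rho> Z1 Z2) m = ?F * matrix_trace ?\<beta>' m"
    unfolding matrix_trace_limit[OF \<rho> m(2)]
    by (rule cumulant_chaos_law[OF chaos_law_Y_limit[OF assms(2-5)] m(1)])
  ultimately show ?thesis by (simp only: near_crit_def)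
qed

end
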